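(* Let $(L,R,\eta,\epsilon)$ be an adjunction with $R:\mathcal{A}\to\mathcal{B}$, $(L',R',\eta',\epsilon')$ an adjunction with $R':\mathcal{A}'\to\mathcal{B}$, and $F:\mathcal{A}\to\mathcal{A}'$ a functor with $F\circ L=L'$. Assume that: (1) $\mathcal{A}$ has all coequalizers and $F$ preserves them; (2) $R'$ preserves coequalizers of pairs $(fe,f)$ where $f$ is a composition of regular epimorphisms and $e$ is an idempotent morphism; (3) $R'$ preserves regular epimorphisms; (4) the monad $R'L'$ has an augmentation $\gamma':R'L'\to\mathrm{Id}_{\mathcal{B}}$. If the adjunction $(L_N,R_N)$ of the monadic tower of $(L,R)$ is idempotent for some $N\in\mathbb{N}$, then every object in $\mathcal{B}$ has combinatorial rank at most $N$ with respect to the adjunction $(L,R)$. In particular, the length of the monadic decomposition of $R:\mathcal{A}\to\mathcal{B}$ (when $R$ has one) is an upper bound for the combinatorial rank of objects in $\mathcal{B}$ with respect to the adjunction $(L,R)$.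
   Context: Whiskering of a natural transformation by functors is written $F\alpha$, $\alpha G$. Coequalizers in $\mathcal{A}$ are fixed once and for all. An augmentation for a monad $(M,m,u)$ is a natural transformation $\gamma:M\to\mathrm{Id}$ with $\gamma\circ u=\mathrm{Id}$ and $\gamma\gamma=\gamma\circ m$. Adjoint decomposition of $(L,R,\eta,\epsilon)$. Define recursively categories $\mathcal{B}_{[n]}$, functors $U_{[n]}:\mathcal{B}_{[n]}\to\mathcal{B}$, adjunctions $(L_{[n]},R_{[n]},\eta_{[n]},\epsilon_{[n]})$ with $R_{[n]}:\mathcal{A}\to\mathcal{B}_{[n]}$ and $U_{[n]}R_{[n]}=R$, and natural transformations $\pi_{[n]}:LU_{[n]}\to L_{[n]}$. For $n=0$: $\mathcal{B}_{[0]}=\mathcal{B}$, $U_{[0]}=\mathrm{Id}$, $(L_{[0]},R_{[0]},\eta_{[0]},\epsilon_{[0]})=(L,R,\eta,\epsilon)$, $\pi_{[0]}=\mathrm{Id}_L$. Given stage $n$: - objects of $\mathcal{B}_{[n+1]}$ are pairs $(B_{[n]},b_{[n]})$ with $B_{[n]}\in\mathcal{B}_{[n]}$ and $b_{[n]}:RL_{[n]}B_{[n]}\to U_{[n]}B_{[n]}$ any morphism in $\mathcal{B}$; morphisms $(B_{[n]},b_{[n]})\to(B'_{[n]},b'_{[n]})$ are morphisms $f:B_{[n]}\to B'_{[n]}$ in $\mathcal{B}_{[n]}$ with $U_{[n]}f\circ b_{[n]}=b'_{[n]}\circ RL_{[n]}f$; $U_{[n,n+1]}:\mathcal{B}_{[n+1]}\to\mathcal{B}_{[n]}$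 is the forgetful functor and $U_{[n+1]}=U_{[n]}U_{[n,n+1]}$; - $R_{[n+1]}A=(R_{[n]}A,R\epsilon_{[n]}A)$, $R_{[n+1]}f=R_{[n]}f$; - $\pi_{[n,n+1]}B_{[n+1]}:L_{[n]}B_{[n]}\to L_{[n+1]}B_{[n+1]}$ is the coequalizer of $\pi_{[n]}B_{[n]}\circ Lb_{[n]}$ and $\epsilon L_{[n]}B_{[n]}$, both from $LRL_{[n]}B_{[n]}$ to $L_{[n]}B_{[n]}$, where $B_{[n+1]}=(B_{[n]},b_{[n]})$; $\pi_{[n+1]}=\pi_{[n,n+1]}\circ\pi_{[n]}U_{[n,n+1]}$; - the unit and counit of $(L_{[n+1]},R_{[n+1]})$ are determined by $U_{[n,n+1]}\eta_{[n+1]}=R_{[n]}\pi_{[n,n+1]}\circ\eta_{[n]}U_{[n,n+1]}$ and $\epsilon_{[n+1]}\circ\pi_{[n,n+1]}R_{[n+1]}=\epsilon_{[n]}$. Monadic tower of $(L,R)$. $\mathcal{B}_0=\mathcal{B}$, $(L_0,R_0,\eta_0,\epsilon_0)=(L,R,\eta,\epsilon)$. Given $(L_n,R_n,\eta_n,\epsilon_n)$ with $R_n:\mathcal{A}\to\mathcal{B}_n$: $\mathcal{B}_{n+1}$ is the Eilenberg-Moore category of the monad $(R_nL_n,R_n\epsilon_nL_n,\eta_n)$ on $\mathcal{B}_n$, $U_{n,n+1}:\mathcal{B}_{n+1}\to\mathcal{B}_n$ is the forgetful functor, $R_{n+1}:\mathcal{A}\to\mathcal{B}_{n+1}$, $A\mapsto(R_nA,R_n\epsilon_nA)$,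 is the comparison functor, and $L_{n+1}$ is its left adjoint (it exists since $\mathcal{A}$ has coequalizers), with unit $\eta_{n+1}$ and counit $\epsilon_{n+1}$. The adjunction $(L_N,R_N)$ is idempotent if $\eta_NR_N$ is an isomorphism; equivalently $\eta_NU_{N,N+1}$ is an isomorphism. $R$ has a monadic decomposition of monadic length $N$ if $L_N$ is fully faithful while $L_m$ is not fully faithful for $0\le m\le N-1$. The functors $\Gamma_{[n]}:\mathcal{B}\to\mathcal{B}_{[n]}$ (well defined under assumptions (1)-(4)). Put $\xi:=R'F\epsilon\circ\eta'R:R\to R'F$. Let $\Gamma_{[0]}=\mathrm{Id}_{\mathcal{B}}$ and $\gamma'_{[0]}=\gamma'$. Recursively put $S_{[n]}:=L_{[n]}\Gamma_{[n]}:\mathcal{B}\to\mathcal{A}$, $\gamma_{[n]}:=\gamma'_{[n]}\circ\xi S_{[n]}:RS_{[n]}\to\mathrm{Id}_{\mathcal{B}}$, $\Gamma_{[n+1]}B:=(\Gamma_{[n]}B,\gamma_{[n]}B)$ (with $U_{[n,n+1]}\Gamma_{[n+1]}=\Gamma_{[n]}$), and let $\gamma'_{[n+1]}:R'FS_{[n+1]}\to\mathrm{Id}_{\mathcal{B}}$ be the unique natural transformation with $\gamma'_{[n+1]}\circ R'F\pi_{[n,n+1]}\Gamma_{[n+1]}=\gamma'_{[n]}$. They satisfy $U_{[n]}\Gamma_{[n]}=\mathrm{Id}_{\mathcal{B}}$, $\gamma_{[n]}\circ U_{[n]}\eta_{[n]}\Gamma_{[n]}=\mathrm{Id}$ and $\gamma_{[n+1]}\circ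 R\pi_{[n,n+1]}\Gamma_{[n+1]}=\gamma_{[n]}$. The combinatorial rank of $B\in\mathcal{B}$ with respect to $(L,R)$ is the smallest $n$ such that $\pi_{[n,n+1]}\Gamma_{[n+1]}B:S_{[n]}B\to S_{[n+1]}B$ is invertible, if such an $n$ exists. *)

theory Defs
  imports Main "HOL-Library.FuncSet"
begin

section \<open>Categories, functors, natural transformations, adjunctions\<close>

record ('o, 'm) cat =
  Obj :: "'o set"
  Arr :: "'m set"
  Dom :: "'m \<Rightarrow> 'o"
  Cod :: "'m \<Rightarrow> 'o"
  Idn :: "'o \<Rightarrow> 'm"
  Comp :: "'m \<Rightarrow> 'm \<Rightarrow> 'm"  (infixr "\<cdot>\<index>" 55)

definition Hom :: "('o, 'm) cat \<Rightarrow> 'o \<Rightarrow> 'o \<Rightarrow> 'm set" where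
  "Hom C X Y = {f \<in> Arr C. Dom C f = X \<and> Cod C f = Y}"

locale category =
  fixes C :: "('o, 'm) cat" (structure)
  assumes Dom_Obj: "f \<in> Arr C \<Longrightarrow> Dom C f \<in> Obj C"
    and Cod_Obj: "f \<in> Arr C \<Longrightarrow> Cod C f \<in> Obj C"
    and Idn_Hom: "X \<in> Obj C \<Longrightarrow> Idn C X \<in> Hom C X X"
    and Comp_Hom: "\<lbrakk>f \<in> Hom C X Y; g \<in> Hom C Y Z\<rbrakk> \<Longrightarrow> g \<cdot> f \<in> Hom C X Z"
    and Comp_Idn: "f \<in> Hom C X Y \<Longrightarrow> f \<cdot> Idn C X = f"
    and Idn_Comp: "f \<in> Hom C X Y \<Longrightarrow> Idn C Y \<cdot> f = f"
    and Comp_assoc: "\<lbrakk>f \<in> Hom C W X; g \<in> Hom C X Y; h \<in> Hom C Y Z\<rbrakk>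
      \<Longrightarrow> (h \<cdot> g) \<cdot> f = h \<cdot> (g \<cdot> f)"

record ('o1, 'm1, 'o2, 'm2) func =
  omap :: "'o1 \<Rightarrow> 'o2"
  amap :: "'m1 \<Rightarrow> 'm2"

locale cat_functor =
  source: category C + target: category D
  for C :: "('o1, 'm1) cat" and D :: "('o2, 'm2) cat" +
  fixes F :: "('o1, 'm1, 'o2, 'm2) func"
  assumes omap_Obj: "X \<in> Obj C \<Longrightarrow> omap F X \<in> Obj D"
    and amap_Hom: "f \<in> Hom C X Y \<Longrightarrow> amap F f \<in> Hom D (omap F X) (omap F Y)"
    and amap_Idn: "X \<in> Obj C \<Longrightarrow> amap F (Idn C X) = Idn D (omap F X)"
    and amap_Comp: "\<lbrakk>f \<in> Hom C X Y; g \<in> Hom C Y Z\<rbrakk>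
      \<Longrightarrow> amap F (g \<cdot>\<^bsub>C\<^esub> f) = amap F g \<cdot>\<^bsub>D\<^esub> amap F f"

definition fid :: "('o, 'm, 'o, 'm) func" where
  "fid = \<lparr>omap = (\<lambda>X. X), amap = (\<lambda>f. f)\<rparr>"

definition fcomp :: "('o2, 'm2, 'o3, 'm3) func \<Rightarrow> ('o1, 'm1, 'o2, 'm2) func
    \<Rightarrow> ('o1, 'm1, 'o3, 'm3) func"  (infixr "\<circ>\<^sub>F" 55) where
  "G \<circ>\<^sub>F F = \<lparr>omap = (\<lambda>X. omap G (omap F X)), amap = (\<lambda>f. amap G (amap F f))\<rparr>"

text \<open>Equality of functors out of \<open>C\<close>; values outside of \<open>C\<close> carry no meaning.\<close>

definition functor_eq :: "('o1, 'm1) cat \<Rightarrow> ('o1, 'm1, 'o2, 'm2) func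
    \<Rightarrow> ('o1, 'm1, 'o2, 'm2) func \<Rightarrow> bool" where
  "functor_eq C F G \<longleftrightarrow>
    (\<forall>X\<in>Obj C. omap F X = omap G X) \<and> (\<forall>f\<in>Arr C. amap F f = amap G f)"

definition fully_faithful :: "('o1, 'm1) cat \<Rightarrow> ('o2, 'm2) cat
    \<Rightarrow> ('o1, 'm1, 'o2, 'm2) func \<Rightarrow> bool" where
  "fully_faithful C D F \<longleftrightarrow>
    (\<forall>X\<in>Obj C. \<forall>Y\<in>Obj C. bij_betw (amap F) (Hom C X Y) (Hom D (omap F X) (omap F Y)))"

locale nat_trans =
  F: cat_functor C D F + G: cat_functor C D G
  for C :: "('o1, 'm1) cat" and D :: "('o2, 'm2) cat"
    and F :: "('o1, 'm1, 'o2, 'm2) func" and G :: "('o1, 'm1, 'o2, 'm2) func" +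
  fixes t :: "'o1 \<Rightarrow> 'm2"
  assumes component: "X \<in> Obj C \<Longrightarrow> t X \<in> Hom D (omap F X) (omap G X)"
    and naturality: "f \<in> Hom C X Y \<Longrightarrow> t Y \<cdot>\<^bsub>D\<^esub> amap F f = amap G f \<cdot>\<^bsub>D\<^esub> t X"

text \<open>An adjunction with left adjoint \<open>L : B \<rightarrow> A\<close> and right adjoint \<open>R : A \<rightarrow> B\<close>.\<close>

locale adjunction =
  left: cat_functor B A L + right: cat_functor A B R +
  unit: nat_trans B B fid "R \<circ>\<^sub>F L" \<eta> + counit: nat_trans A A "L \<circ>\<^sub>F R" fid \<epsilon>
  for A :: "('a, 'k) cat" and B :: "('o, 'm) cat"
    and L :: "('o, 'm, 'a, 'k) func" and R :: "('a, 'k, 'o, 'm) func"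
    and \<eta> :: "'o \<Rightarrow> 'm" and \<epsilon> :: "'a \<Rightarrow> 'k" +
  assumes triangle_left: "X \<in> Obj B \<Longrightarrow> \<epsilon> (omap L X) \<cdot>\<^bsub>A\<^esub> amap L (\<eta> X) = Idn A (omap L X)"
    and triangle_right: "Y \<in> Obj A \<Longrightarrow> amap R (\<epsilon> Y) \<cdot>\<^bsub>B\<^esub> \<eta> (omap R Y) = Idn B (omap R Y)"

text \<open>In the last axiom, the horizontal composite \<open>\<gamma>\<gamma>\<close> is written as \<open>\<gamma> \<circ> M\<gamma>\<close>.\<close>

locale augmentation =
  nat_trans C C M fid \<gamma>
  for C :: "('o, 'm) cat" and M :: "('o, 'm, 'o, 'm) func"
    and m :: "'o \<Rightarrow> 'm" and u :: "'o \<Rightarrow> 'm" and \<gamma> :: "'o \<Rightarrow> 'm" +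
  assumes aug_unit: "X \<in> Obj C \<Longrightarrow> \<gamma> X \<cdot>\<^bsub>C\<^esub> u X = Idn C X"
    and aug_mult: "X \<in> Obj C \<Longrightarrow> \<gamma> X \<cdot>\<^bsub>C\<^esub> amap M (\<gamma> X) = \<gamma> X \<cdot>\<^bsub>C\<^esub> m X"


section \<open>Isomorphisms, idempotents, coequalizers, regular epimorphisms\<close>

definition iso_arr :: "('o, 'm) cat \<Rightarrow> 'm \<Rightarrow> bool" where
  "iso_arr C f \<longleftrightarrow> f \<in> Arr C \<and>
    (\<exists>g\<in>Hom C (Cod C f) (Dom C f). g \<cdot>\<^bsub>C\<^esub> f = Idn C (Dom C f) \<and> f \<cdot>\<^bsub>C\<^esub> g = Idn C (Cod C f))"

definition idempotent_arr :: "('o, 'm) cat \<Rightarrow> 'm \<Rightarrow> bool" where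
  "idempotent_arr C e \<longleftrightarrow> e \<in> Arr C \<and> Dom C e = Cod C e \<and> e \<cdot>\<^bsub>C\<^esub> e = e"

definition parallel :: "('o, 'm) cat \<Rightarrow> 'm \<Rightarrow> 'm \<Rightarrow> bool" where
  "parallel C f g \<longleftrightarrow> f \<in> Arr C \<and> g \<in> Arr C \<and> Dom C f = Dom C g \<and> Cod C f = Cod C g"

definition is_coequalizer :: "('o, 'm) cat \<Rightarrow> 'm \<Rightarrow> 'm \<Rightarrow> 'm \<Rightarrow> bool" where
  "is_coequalizer C f g p \<longleftrightarrow>
    parallel C f g \<and> p \<in> Arr C \<and> Dom C p = Cod C f \<and> p \<cdot>\<^bsub>C\<^esub> f = p \<cdot>\<^bsub>C\<^esub> g \<and>
    (\<forall>h\<in>Arr C. Dom C h = Cod C f \<longrightarrow> h \<cdot>\<^bsub>C\<^esub> f = h \<cdot>\<^bsub>C\<^esub> g \<longrightarrow>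
      (\<exists>!k. k \<in> Hom C (Cod C p) (Cod C h) \<and> k \<cdot>\<^bsub>C\<^esub> p = h))"

definition has_coequalizers :: "('o, 'm) cat \<Rightarrow> bool" where
  "has_coequalizers C \<longleftrightarrow> (\<forall>f g. parallel C f g \<longrightarrow> (\<exists>p. is_coequalizer C f g p))"

definition coequalizer_choice :: "('o, 'm) cat \<Rightarrow> ('m \<Rightarrow> 'm \<Rightarrow> 'm) \<Rightarrow> bool" where
  "coequalizer_choice C q \<longleftrightarrow> (\<forall>f g. parallel C f g \<longrightarrow> is_coequalizer C f g (q f g))"

definition preserves_coequalizer :: "('o2, 'm2) cat \<Rightarrow> ('o1, 'm1, 'o2, 'm2) func
    \<Rightarrow> ('o1, 'm1) cat \<Rightarrow> 'm1 \<Rightarrow> 'm1 \<Rightarrow> bool" where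
  "preserves_coequalizer D F C f g \<longleftrightarrow>
    (\<forall>p. is_coequalizer C f g p \<longrightarrow> is_coequalizer D (amap F f) (amap F g) (amap F p))"

definition regular_epi :: "('o, 'm) cat \<Rightarrow> 'm \<Rightarrow> bool" where
  "regular_epi C p \<longleftrightarrow> (\<exists>f g. is_coequalizer C f g p)"

inductive comp_regular_epis :: "('o, 'm) cat \<Rightarrow> 'm \<Rightarrow> bool" for C where
  single: "regular_epi C p \<Longrightarrow> comp_regular_epis C p"
| compose: "\<lbrakk>comp_regular_epis C f; regular_epi C p; Dom C p = Cod C f\<rbrakk>
    \<Longrightarrow> comp_regular_epis C (p \<cdot>\<^bsub>C\<^esub> f)"


section \<open>Iterated categories of objects with structure\<close>

text \<open>
  The categories occurring at stage \<open>n\<close> of both towers have as objects iterated pairs whose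
  length depends on \<open>n\<close>. To have one type for all stages, the objects and arrows are taken from
  the two datatypes below: an object is an object of the ground category (\<open>Base_obj\<close>) or a pair
  consisting of an object of the preceding stage and a structure arrow (\<open>Over_obj\<close>); an arrow
  is an arrow of the ground category (\<open>Base_arr\<close>) or an arrow of the preceding stage together
  with its source and target (\<open>Over_arr\<close>). The ground category itself is thus replaced by its
  copy \<open>lift_cat\<close>.
\<close>

datatype ('o, 'm) tobj =
    Base_obj (the_obj: 'o)
  | Over_obj (under: "('o, 'm) tobj") (str: "('o, 'm) tarr")
and ('o, 'm) tarr =
    Base_arr (the_arr: 'm)
  | Over_arr (src: "('o, 'm) tobj") (under_arr: "('o, 'm) tarr") (tgt: "('o, 'm) tobj")

definition lift_cat :: "('o, 'm) cat \<Rightarrow> (('o, 'm) tobj, ('o, 'm) tarr) cat" where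
  "lift_cat B =
    \<lparr>Obj = Base_obj ` Obj B, Arr = Base_arr ` Arr B,
     Dom = (\<lambda>f. Base_obj (Dom B (the_arr f))), Cod = (\<lambda>f. Base_obj (Cod B (the_arr f))),
     Idn = (\<lambda>X. Base_arr (Idn B (the_obj X))),
     Comp = (\<lambda>g f. Base_arr (the_arr g \<cdot>\<^bsub>B\<^esub> the_arr f))\<rparr>"

definition lift :: "('o, 'm, ('o, 'm) tobj, ('o, 'm) tarr) func" where
  "lift = \<lparr>omap = Base_obj, amap = Base_arr\<rparr>"

definition unlift :: "(('o, 'm) tobj, ('o, 'm) tarr, 'o, 'm) func" where
  "unlift = \<lparr>omap = the_obj, amap = the_arr\<rparr>"

text \<open>
  \<open>over_cat C Os P\<close> has the set \<open>Os\<close> of pairs as objects; an arrow \<open>X \<rightarrow> Y\<close> is an arrow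
  \<open>f\<close> of \<open>C\<close> between the underlying objects that satisfies \<open>P X f Y\<close>.
\<close>

definition over_cat :: "(('o, 'm) tobj, ('o, 'm) tarr) cat \<Rightarrow> ('o, 'm) tobj set
    \<Rightarrow> (('o, 'm) tobj \<Rightarrow> ('o, 'm) tarr \<Rightarrow> ('o, 'm) tobj \<Rightarrow> bool)
    \<Rightarrow> (('o, 'm) tobj, ('o, 'm) tarr) cat" where
  "over_cat C Os P =
    \<lparr>Obj = Os,
     Arr = {Over_arr X f Y | X f Y.
       X \<in> Os \<and> Y \<in> Os \<and> f \<in> Hom C (under X) (under Y) \<and> P X f Y},
     Dom = src, Cod = tgt,
     Idn = (\<lambda>X. Over_arr X (Idn C (under X)) X),
     Comp = (\<lambda>g f. Over_arr (src f) (under_arr g \<cdot>\<^bsub>C\<^esub> under_arr f) (tgt g))\<rparr>"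

definition forget :: "(('o, 'm) tobj, ('o, 'm) tarr, ('o, 'm) tobj, ('o, 'm) tarr) func" where
  "forget = \<lparr>omap = under, amap = under_arr\<rparr>"

text \<open>The functor with \<open>X \<mapsto> (G X, s X)\<close> and \<open>f \<mapsto> G f\<close>.\<close>

definition over_func :: "('o1, 'm1) cat \<Rightarrow> ('o1, 'm1, ('o, 'm) tobj, ('o, 'm) tarr) func
    \<Rightarrow> ('o1 \<Rightarrow> ('o, 'm) tarr) \<Rightarrow> ('o1, 'm1, ('o, 'm) tobj, ('o, 'm) tarr) func" where
  "over_func D G s =
    \<lparr>omap = (\<lambda>X. Over_obj (omap G X) (s X)),
     amap = (\<lambda>f. Over_arr (Over_obj (omap G (Dom D f)) (s (Dom D f))) (amap G f)
                          (Over_obj (omap G (Cod D f)) (s (Cod D f))))\<rparr>"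

text \<open>An adjunction between a fixed category \<open>A\<close> and a category on top of \<open>B\<close>.\<close>

record ('o, 'm, 'a, 'k) adj =
  acat :: "(('o, 'm) tobj, ('o, 'm) tarr) cat"
  aL :: "(('o, 'm) tobj, ('o, 'm) tarr, 'a, 'k) func"
  aR :: "('a, 'k, ('o, 'm) tobj, ('o, 'm) tarr) func"
  aunit :: "('o, 'm) tobj \<Rightarrow> ('o, 'm) tarr"
  acounit :: "'a \<Rightarrow> 'k"

definition lift_adj :: "('o, 'm) cat \<Rightarrow> ('o, 'm, 'a, 'k) func \<Rightarrow> ('a, 'k, 'o, 'm) func
    \<Rightarrow> ('o \<Rightarrow> 'm) \<Rightarrow> ('a \<Rightarrow> 'k) \<Rightarrow> ('o, 'm, 'a, 'k) adj" where
  "lift_adj B L R \<eta> \<epsilon> =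
    \<lparr>acat = lift_cat B, aL = L \<circ>\<^sub>F unlift, aR = lift \<circ>\<^sub>F R,
     aunit = (\<lambda>X. Base_arr (\<eta> (the_obj X))), acounit = \<epsilon>\<rparr>"


section \<open>The monadic tower\<close>

definition EM_cat :: "(('o, 'm) tobj, ('o, 'm) tarr) cat
    \<Rightarrow> (('o, 'm) tobj, ('o, 'm) tarr, ('o, 'm) tobj, ('o, 'm) tarr) func
    \<Rightarrow> (('o, 'm) tobj \<Rightarrow> ('o, 'm) tarr) \<Rightarrow> (('o, 'm) tobj \<Rightarrow> ('o, 'm) tarr)
    \<Rightarrow> (('o, 'm) tobj, ('o, 'm) tarr) cat" where
  "EM_cat C M m u =
    over_cat C
      {Over_obj X a | X a. X \<in> Obj C \<and> a \<in> Hom C (omap M X) X \<and>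
         a \<cdot>\<^bsub>C\<^esub> u X = Idn C X \<and> a \<cdot>\<^bsub>C\<^esub> amap M a = a \<cdot>\<^bsub>C\<^esub> m X}
      (\<lambda>X f Y. f \<cdot>\<^bsub>C\<^esub> str X = str Y \<cdot>\<^bsub>C\<^esub> amap M f)"

definition adj_EM_cat :: "('o, 'm, 'a, 'k) adj \<Rightarrow> (('o, 'm) tobj, ('o, 'm) tarr) cat" where
  "adj_EM_cat T =
    EM_cat (acat T) (aR T \<circ>\<^sub>F aL T) (\<lambda>X. amap (aR T) (acounit T (omap (aL T) X))) (aunit T)"

definition comparison :: "('a, 'k) cat \<Rightarrow> ('o, 'm, 'a, 'k) adj
    \<Rightarrow> ('a, 'k, ('o, 'm) tobj, ('o, 'm) tarr) func" where
  "comparison A T = over_func A (aR T) (\<lambda>Y. amap (aR T) (acounit T Y))"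

text \<open>
  The left adjoints of the comparison functors are only determined up to isomorphism, so a
  monadic tower is any sequence obtained by choosing them.
\<close>

definition monadic_tower :: "('a, 'k) cat \<Rightarrow> ('o, 'm) cat
    \<Rightarrow> ('o, 'm, 'a, 'k) func \<Rightarrow> ('a, 'k, 'o, 'm) func \<Rightarrow> ('o \<Rightarrow> 'm) \<Rightarrow> ('a \<Rightarrow> 'k)
    \<Rightarrow> (nat \<Rightarrow> ('o, 'm, 'a, 'k) adj) \<Rightarrow> bool" where
  "monadic_tower A B L R \<eta> \<epsilon> T \<longleftrightarrow>
    T 0 = lift_adj B L R \<eta> \<epsilon> \<and>
    (\<forall>n. acat (T (Suc n)) = adj_EM_cat (T n) \<and>
         aR (T (Suc n)) = comparison A (T n) \<and>
         adjunction A (acat (T (Suc n))) (aL (T (Suc n))) (aR (T (Suc n)))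
           (aunit (T (Suc n))) (acounit (T (Suc n))))"

definition idempotent_adj :: "('a, 'k) cat \<Rightarrow> ('o, 'm, 'a, 'k) adj \<Rightarrow> bool" where
  "idempotent_adj A T \<longleftrightarrow> (\<forall>Y\<in>Obj A. iso_arr (acat T) (aunit T (omap (aR T) Y)))"

definition monadic_length :: "('a, 'k) cat \<Rightarrow> (nat \<Rightarrow> ('o, 'm, 'a, 'k) adj) \<Rightarrow> nat \<Rightarrow> bool" where
  "monadic_length A T N \<longleftrightarrow>
    fully_faithful (acat (T N)) A (aL (T N)) \<and>
    (\<forall>m<N. \<not> fully_faithful (acat (T m)) A (aL (T m)))"


section \<open>The adjoint decomposition\<close>

text \<open>
  A stage consists of \<open>B\<^sub>[\<^sub>n\<^sub>]\<close> with its adjunction to \<open>A\<close>, the functor \<open>U\<^sub>[\<^sub>n\<^sub>]\<close> to \<open>B\<close> and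
  \<open>\<pi>\<^sub>[\<^sub>n\<^sub>] : L U\<^sub>[\<^sub>n\<^sub>] \<rightarrow> L\<^sub>[\<^sub>n\<^sub>]\<close>.
\<close>

record ('o, 'm, 'a, 'k) stage = "('o, 'm, 'a, 'k) adj" +
  sU :: "(('o, 'm) tobj, ('o, 'm) tarr, 'o, 'm) func"
  sproj :: "('o, 'm) tobj \<Rightarrow> 'k"

context
  fixes A :: "('a, 'k) cat" and B :: "('o, 'm) cat"
    and L :: "('o, 'm, 'a, 'k) func" and R :: "('a, 'k, 'o, 'm) func"
    and \<eta> :: "'o \<Rightarrow> 'm" and \<epsilon> :: "'a \<Rightarrow> 'k"
    and q :: "'k \<Rightarrow> 'k \<Rightarrow> 'k"  \<comment> \<open>the fixed coequalizers in \<open>A\<close>\<close>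
begin

text \<open>The component of \<open>\<pi>\<^sub>[\<^sub>n\<^sub>,\<^sub>n\<^sub>+\<^sub>1\<^sub>]\<close> at the object \<open>X\<close> of stage \<open>n+1\<close>.\<close>

definition link :: "('o, 'm, 'a, 'k) stage \<Rightarrow> ('o, 'm) tobj \<Rightarrow> 'k" where
  "link S X =
    q (sproj S (under X) \<cdot>\<^bsub>A\<^esub> amap L (the_arr (str X))) (\<epsilon> (omap (aL S) (under X)))"

definition next_cat :: "('o, 'm, 'a, 'k) stage \<Rightarrow> (('o, 'm) tobj, ('o, 'm) tarr) cat" where
  "next_cat S =
    over_cat (acat S)
      {Over_obj X (Base_arr b) | X b. X \<in> Obj (acat S) \<and>
         b \<in> Hom B (omap R (omap (aL S) X)) (omap (sU S) X)}
      (\<lambda>X f Y. amap (sU S) f \<cdot>\<^bsub>B\<^esub> the_arr (str X)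
             = the_arr (str Y) \<cdot>\<^bsub>B\<^esub> amap R (amap (aL S) f))"

text \<open>On arrows, \<open>L\<^sub>[\<^sub>n\<^sub>+\<^sub>1\<^sub>]\<close> is determined by the naturality of \<open>\<pi>\<^sub>[\<^sub>n\<^sub>,\<^sub>n\<^sub>+\<^sub>1\<^sub>]\<close>.\<close>

definition next_L :: "('o, 'm, 'a, 'k) stage
    \<Rightarrow> (('o, 'm) tobj, ('o, 'm) tarr, 'a, 'k) func" where
  "next_L S =
    \<lparr>omap = (\<lambda>X. Cod A (link S X)),
     amap = (\<lambda>f. THE g. g \<in> Hom A (Cod A (link S (src f))) (Cod A (link S (tgt f))) \<and>
       g \<cdot>\<^bsub>A\<^esub> link S (src f) = link S (tgt f) \<cdot>\<^bsub>A\<^esub> amap (aL S) (under_arr f))\<rparr>"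

definition next_R :: "('o, 'm, 'a, 'k) stage
    \<Rightarrow> ('a, 'k, ('o, 'm) tobj, ('o, 'm) tarr) func" where
  "next_R S = over_func A (aR S) (\<lambda>Y. Base_arr (amap R (acounit S Y)))"

definition next_stage :: "('o, 'm, 'a, 'k) stage \<Rightarrow> ('o, 'm, 'a, 'k) stage" where
  "next_stage S =
    \<lparr>acat = next_cat S, aL = next_L S, aR = next_R S,
     aunit = (\<lambda>X. Over_arr X
       (amap (aR S) (link S X) \<cdot>\<^bsub>acat S\<^esub> aunit S (under X))
       (omap (next_R S) (omap (next_L S) X))),
     acounit = (\<lambda>Y. THE g. g \<in> Hom A (omap (next_L S) (omap (next_R S) Y)) Y \<and>
       g \<cdot>\<^bsub>A\<^esub> link S (omap (next_R S) Y) = acounit S Y),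
     sU = sU S \<circ>\<^sub>F forget,
     sproj = (\<lambda>X. link S X \<cdot>\<^bsub>A\<^esub> sproj S (under X))\<rparr>"

primrec decomposition :: "nat \<Rightarrow> ('o, 'm, 'a, 'k) stage" where
  "decomposition 0 =
    adj.extend (lift_adj B L R \<eta> \<epsilon>)
      \<lparr>sU = unlift, sproj = (\<lambda>X. Idn A (omap L (the_obj X)))\<rparr>"
| "decomposition (Suc n) = next_stage (decomposition n)"

end


section \<open>The functors \<open>\<Gamma>\<^sub>[\<^sub>n\<^sub>]\<close> and the combinatorial rank\<close>

context
  fixes A :: "('a, 'k) cat" and B :: "('o, 'm) cat"
    and L :: "('o, 'm, 'a, 'k) func" and R :: "('a, 'k, 'o, 'm) func"
    and \<eta> :: "'o \<Rightarrow> 'm" and \<epsilon> :: "'a \<Rightarrow> 'k" and q :: "'k \<Rightarrow> 'k \<Rightarrow> 'k"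
    and R' :: "('c, 'l, 'o, 'm) func" and \<eta>' :: "'o \<Rightarrow> 'm"
    and F :: "('a, 'k, 'c, 'l) func"
    and \<gamma>' :: "'o \<Rightarrow> 'm"
begin

definition \<xi> :: "'a \<Rightarrow> 'm" where
  "\<xi> Y = amap R' (amap F (\<epsilon> Y)) \<cdot>\<^bsub>B\<^esub> \<eta>' (omap R Y)"

text \<open>
  The recursion produces the pair of \<open>\<Gamma>\<^sub>[\<^sub>n\<^sub>]\<close> and \<open>\<gamma>'\<^sub>[\<^sub>n\<^sub>]\<close>. \<open>next_\<Gamma>\<close> and \<open>next_\<gamma>'\<close> compute
  the next such pair from the present stage \<open>S\<close>, the functor \<open>G\<close> and the transformation \<open>g\<close>.
\<close>

definition next_\<Gamma> :: "('o, 'm, 'a, 'k) stage \<Rightarrow> ('o, 'm, ('o, 'm) tobj, ('o, 'm) tarr) func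
    \<Rightarrow> ('o \<Rightarrow> 'm) \<Rightarrow> ('o, 'm, ('o, 'm) tobj, ('o, 'm) tarr) func" where
  "next_\<Gamma> S G g = over_func B G (\<lambda>X. Base_arr (g X \<cdot>\<^bsub>B\<^esub> \<xi> (omap (aL S) (omap G X))))"

text \<open>
  Membership in \<open>extensional (Obj B)\<close> fixes the irrelevant values outside of \<open>B\<close>, so that a
  natural transformation can be unique as a function.
\<close>

definition next_\<gamma>' :: "('o, 'm, 'a, 'k) stage \<Rightarrow> ('o, 'm, ('o, 'm) tobj, ('o, 'm) tarr) func
    \<Rightarrow> ('o \<Rightarrow> 'm) \<Rightarrow> 'o \<Rightarrow> 'm" where
  "next_\<gamma>' S G g = (THE t.
    t \<in> extensional (Obj B) \<and>
    nat_trans B B (R' \<circ>\<^sub>F F \<circ>\<^sub>F next_L A L \<epsilon> q S \<circ>\<^sub>F next_\<Gamma> S G g) fid t \<and>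
    (\<forall>X\<in>Obj B. t X \<cdot>\<^bsub>B\<^esub> amap R' (amap F (link A L \<epsilon> q S (omap (next_\<Gamma> S G g) X))) = g X))"

primrec \<Gamma>\<gamma>' :: "nat \<Rightarrow> ('o, 'm, ('o, 'm) tobj, ('o, 'm) tarr) func \<times> ('o \<Rightarrow> 'm)" where
  "\<Gamma>\<gamma>' 0 = (lift, \<gamma>')"
| "\<Gamma>\<gamma>' (Suc n) =
    (let S = decomposition A B L R \<eta> \<epsilon> q n; (G, g) = \<Gamma>\<gamma>' n
     in (next_\<Gamma> S G g, next_\<gamma>' S G g))"

definition \<Gamma> :: "nat \<Rightarrow> ('o, 'm, ('o, 'm) tobj, ('o, 'm) tarr) func" where
  "\<Gamma> n = fst (\<Gamma>\<gamma>' n)"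

definition rank_arrow :: "nat \<Rightarrow> 'o \<Rightarrow> 'k" where
  "rank_arrow n X = link A L \<epsilon> q (decomposition A B L R \<eta> \<epsilon> q n) (omap (\<Gamma> (Suc n)) X)"

definition has_combinatorial_rank :: "'o \<Rightarrow> nat \<Rightarrow> bool" where
  "has_combinatorial_rank X n \<longleftrightarrow>
    iso_arr A (rank_arrow n X) \<and> (\<forall>m<n. \<not> iso_arr A (rank_arrow m X))"

end

end

theory Submission
  imports Defs
begin

text \<open>
  All that matters about a stage of either tower is the comonad \<open>(G, \<epsilon>)\<close> that its adjunction
  induces on the common category \<open>A\<close>. In both towers the next comonad is, with its counit, the
  pointwise coequalizer of \<open>G\<epsilon>\<close> and \<open>\<epsilon>G\<close> (\<open>tower_comonad_derived\<close>, \<open>next_comonad_derived\<close>). So the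
  comonads correspond to each other stage by stage (\<open>tower_comonads_retract\<close>), although they come
  from adjunctions over different categories. An adjunction is idempotent exactly when its
  comonad satisfies \<open>G\<epsilon> = \<epsilon>G\<close>; hence idempotency passes from stage \<open>N\<close> of the monadic tower
  to stage \<open>N\<close> of the adjoint decomposition.

  The augmentation enters through \<open>\<Gamma>\<close>. Write \<open>S = L\<^sub>[\<^sub>n\<^sub>]\<Gamma>\<^sub>[\<^sub>n\<^sub>]\<close>. The arrow
  \<open>\<gamma>\<^sub>[\<^sub>n\<^sub>]X : RSX \<rightarrow> X\<close> of \<open>B\<close> underlies an arrow \<open>h : R\<^sub>[\<^sub>n\<^sub>]SX \<rightarrow> \<Gamma>\<^sub>[\<^sub>n\<^sub>]X\<close> of stage \<open>n\<close>
  (\<open>\<gamma>_lift\<close>), and \<open>h\<close> is a retraction of the unit at \<open>\<Gamma>\<^sub>[\<^sub>n\<^sub>]X\<close>. For an idempotent adjunction such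
  a retraction satisfies \<open>L\<^sub>[\<^sub>n\<^sub>]h = \<epsilon>\<^sub>[\<^sub>n\<^sub>]SX\<close> (\<open>idempotent_retraction\<close>). Precomposed with
  \<open>\<pi>\<^sub>[\<^sub>n\<^sub>]\<close>, this equation says that the two arrows whose coequalizer is
  \<open>\<pi>\<^sub>[\<^sub>n\<^sub>,\<^sub>n\<^sub>+\<^sub>1\<^sub>]\<Gamma>\<^sub>[\<^sub>n\<^sub>+\<^sub>1\<^sub>]X\<close> are equal, so the coequalizer is invertible
  (\<open>link_iso_if_idempotent\<close>).

  The lifting of \<open>\<gamma>\<^sub>[\<^sub>n\<^sub>]\<close> rests on a criterion independent of the stage: if
  \<open>a : R'FY \<rightarrow> X\<close> satisfies \<open>\<gamma>' \<circ> R'L'(a \<circ> \<xi>Y) = a \<circ> R'F\<epsilon>Y\<close>, then \<open>a \<circ> \<xi>Y\<close> lifts to every stage.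
  It holds for \<open>a = \<gamma>'\<^sub>[\<^sub>n\<^sub>]X\<close> because the multiplicativity of \<open>\<gamma>'\<close> descends along
  \<open>R'L'R'F\<pi>\<^sub>[\<^sub>n\<^sub>]\<close>, which is epic since each of the functors \<open>F\<close>, \<open>R'\<close> and \<open>L'\<close> preserves regular
  epimorphisms. The same equation provides \<open>\<gamma>'\<^sub>[\<^sub>n\<^sub>+\<^sub>1\<^sub>]\<close>: it says that \<open>\<gamma>'\<^sub>[\<^sub>n\<^sub>]\<close>
  coequalizes a pair of which \<open>R'F\<pi>\<^sub>[\<^sub>n\<^sub>,\<^sub>n\<^sub>+\<^sub>1\<^sub>]\<Gamma>\<^sub>[\<^sub>n\<^sub>+\<^sub>1\<^sub>]\<close> is a coequalizer
  (\<open>R'F_link_coequalizer\<close>, \<open>next_\<gamma>'\<close>).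

  Finally, a stage with fully faithful left adjoint has an invertible unit and is therefore
  idempotent, which covers the monadic length.
\<close>

section \<open>Calculus of arrows\<close>

lemma fcomp_simps [simp]:
  "omap (G \<circ>\<^sub>F F) X = omap G (omap F X)" "amap (G \<circ>\<^sub>F F) f = amap G (amap F f)"
  by (simp_all add: fcomp_def)

lemma fid_simps [simp]: "omap fid X = X" "amap fid f = f"
  by (simp_all add: fid_def)

lemma in_Hom_iff: "f \<in> Hom C X Y \<longleftrightarrow> f \<in> Arr C \<and> Dom C f = X \<and> Cod C f = Y"
  by (simp add: Hom_def)

context category
begin

declare Dom_Obj [simp] Cod_Obj [simp]

lemma Idn_simps [simp]:
  assumes "X \<in> Obj C"
  shows "Idn C X \<in> Arr C" "Dom C (Idn C X) = X" "Cod C (Idn C X) = X"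
  using Idn_Hom[OF assms] by (simp_all add: in_Hom_iff)

lemma Comp_simps [simp]:
  assumes "f \<in> Arr C" "g \<in> Arr C" "Cod C f = Dom C g"
  shows "g \<cdot> f \<in> Arr C" "Dom C (g \<cdot> f) = Dom C f" "Cod C (g \<cdot> f) = Cod C g"
  using Comp_Hom[of f "Dom C f" "Dom C g" g "Cod C g"] assms by (simp_all add: in_Hom_iff)

lemma Comp_Idn' [simp]: "f \<in> Arr C \<Longrightarrow> Dom C f = X \<Longrightarrow> f \<cdot> Idn C X = f"
  using Comp_Idn[of f X "Cod C f"] by (simp add: in_Hom_iff)

lemma Idn_Comp' [simp]: "f \<in> Arr C \<Longrightarrow> Cod C f = Y \<Longrightarrow> Idn C Y \<cdot> f = f"
  using Idn_Comp[of f "Dom C f" Y] by (simp add: in_Hom_iff)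

lemma assoc [simp]:
  "\<lbrakk>f \<in> Arr C; g \<in> Arr C; h \<in> Arr C; Cod C f = Dom C g; Cod C g = Dom C h\<rbrakk>
    \<Longrightarrow> (h \<cdot> g) \<cdot> f = h \<cdot> (g \<cdot> f)"
  using Comp_assoc[of f "Dom C f" "Dom C g" g "Dom C h" h "Cod C h"] by (simp add: in_Hom_iff)

text \<open>
  Composites are kept in right-associated normal form. This lemma lets an equation between
  composites be used at the front of a longer composite.
\<close>

lemma chain:
  assumes "g \<cdot> h = k" "h \<in> Arr C" "g \<in> Arr C" "Cod C h = Dom C g"
    and "x \<in> Arr C" "Cod C x = Dom C h"
  shows "g \<cdot> (h \<cdot> x) = k \<cdot> x"
  using assms(1) assoc[of x h g] assms by simp

end

context cat_functor
begin

declare omap_Obj [simp] amap_Idn [simp]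

lemma amap_simps [simp]:
  assumes "f \<in> Arr C"
  shows "amap F f \<in> Arr D" "Dom D (amap F f) = omap F (Dom C f)"
    "Cod D (amap F f) = omap F (Cod C f)"
  using amap_Hom[of f "Dom C f" "Cod C f"] assms by (simp_all add: in_Hom_iff)

lemma amap_Comp' [simp]:
  "\<lbrakk>f \<in> Arr C; g \<in> Arr C; Cod C f = Dom C g\<rbrakk>
    \<Longrightarrow> amap F (g \<cdot>\<^bsub>C\<^esub> f) = amap F g \<cdot>\<^bsub>D\<^esub> amap F f"
  using amap_Comp[of f "Dom C f" "Dom C g" g "Cod C g"] by (simp add: in_Hom_iff)

end

context nat_trans
begin

lemma component_simps [simp]:
  assumes "X \<in> Obj C"
  shows "t X \<in> Arr D" "Dom D (t X) = omap F X" "Cod D (t X) = omap G X"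
  using component[OF assms] by (simp_all add: in_Hom_iff)

lemma nat: "f \<in> Arr C \<Longrightarrow> Cod C f = Y \<Longrightarrow> t Y \<cdot>\<^bsub>D\<^esub> amap F f = amap G f \<cdot>\<^bsub>D\<^esub> t (Dom C f)"
  using naturality[of f "Dom C f" Y] by (simp add: in_Hom_iff)

end

lemma nat_transI:
  assumes "cat_functor C D F" "cat_functor C D G"
    and "\<And>X. X \<in> Obj C \<Longrightarrow> t X \<in> Hom D (omap F X) (omap G X)"
    and "\<And>f. f \<in> Arr C \<Longrightarrow> t (Cod C f) \<cdot>\<^bsub>D\<^esub> amap F f = amap G f \<cdot>\<^bsub>D\<^esub> t (Dom C f)"
  shows "nat_trans C D F G t"
  using assms by (simp add: nat_trans_def nat_trans_axioms_def in_Hom_iff)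

lemma cat_functor_fcomp:
  assumes "cat_functor C D F" "cat_functor D E G"
  shows "cat_functor C E (G \<circ>\<^sub>F F)"
proof -
  interpret F: cat_functor C D F by fact
  interpret G: cat_functor D E G by fact
  show ?thesis by unfold_locales (auto simp: in_Hom_iff)
qed

lemma cat_functor_fid: "category C \<Longrightarrow> cat_functor C C fid"
  by (simp add: cat_functor_def cat_functor_axioms_def)


section \<open>Epimorphisms and coequalizers\<close>

definition epi_arr :: "('o, 'm) cat \<Rightarrow> 'm \<Rightarrow> bool" where
  "epi_arr C p \<longleftrightarrow> p \<in> Arr C \<and>
    (\<forall>g\<in>Arr C. \<forall>h\<in>Arr C. Dom C g = Cod C p \<longrightarrow> Dom C h = Cod C p \<longrightarrow>
      g \<cdot>\<^bsub>C\<^esub> p = h \<cdot>\<^bsub>C\<^esub> p \<longrightarrow> g = h)"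

lemma epi_cancel:
  "\<lbrakk>g \<cdot>\<^bsub>C\<^esub> p = h \<cdot>\<^bsub>C\<^esub> p; epi_arr C p; g \<in> Arr C; h \<in> Arr C; Dom C g = Cod C p; Dom C h = Cod C p\<rbrakk>
    \<Longrightarrow> g = h"
  by (auto simp: epi_arr_def)

lemma coequalizer_simps:
  assumes "is_coequalizer C f g p"
  shows "parallel C f g" "f \<in> Arr C" "g \<in> Arr C" "p \<in> Arr C" "Dom C p = Cod C f"
    "Dom C g = Dom C f" "Cod C g = Cod C f" "p \<cdot>\<^bsub>C\<^esub> f = p \<cdot>\<^bsub>C\<^esub> g"
  using assms by (auto simp: is_coequalizer_def parallel_def)

lemma coequalizer_factor:
  assumes "is_coequalizer C f g p" "h \<in> Arr C" "Dom C h = Cod C f" "h \<cdot>\<^bsub>C\<^esub> f = h \<cdot>\<^bsub>C\<^esub> g"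
  obtains k where "k \<in> Arr C" "Dom C k = Cod C p" "Cod C k = Cod C h" "k \<cdot>\<^bsub>C\<^esub> p = h"
  using assms unfolding is_coequalizer_def in_Hom_iff by meson

context category
begin

lemma coequalizer_epi:
  assumes "is_coequalizer C f g p"
  shows "epi_arr C p"
  unfolding epi_arr_def
proof (intro conjI ballI impI)
  note c = coequalizer_simps[OF assms]
  show "p \<in> Arr C" by fact
  fix h k assume h: "h \<in> Arr C" "Dom C h = Cod C p" and k: "k \<in> Arr C" "Dom C k = Cod C p"
    and e: "h \<cdot> p = k \<cdot> p"
  have "(h \<cdot> p) \<cdot> f = (h \<cdot> p) \<cdot> g" using h c by simp
  moreover have "h \<cdot> p \<in> Arr C" "Dom C (h \<cdot> p) = Cod C f" using h c by simp_all
  ultimately have "\<exists>!l. l \<in> Hom C (Cod C p) (Cod C (h \<cdot> p)) \<and> l \<cdot> p = h \<cdot> p"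
    using assms unfolding is_coequalizer_def by blast
  moreover have "Cod C k = Cod C h"
    using arg_cong[OF e, of "Cod C"] h k c by simp
  ultimately show "h = k" using h k e c by (auto simp: in_Hom_iff)
qed

lemma is_coequalizerI:
  assumes "parallel C f g" "p \<in> Arr C" "Dom C p = Cod C f" "p \<cdot> f = p \<cdot> g" "epi_arr C p"
    and "\<And>h. \<lbrakk>h \<in> Arr C; Dom C h = Cod C f; h \<cdot> f = h \<cdot> g\<rbrakk>
      \<Longrightarrow> \<exists>k. k \<in> Hom C (Cod C p) (Cod C h) \<and> k \<cdot> p = h"
  shows "is_coequalizer C f g p"
  unfolding is_coequalizer_def
proof (intro conjI ballI impI)
  fix h assume h: "h \<in> Arr C" "Dom C h = Cod C f" "h \<cdot> f = h \<cdot> g"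
  then obtain k where k: "k \<in> Hom C (Cod C p) (Cod C h) \<and> k \<cdot> p = h" using assms(6) by blast
  show "\<exists>!k. k \<in> Hom C (Cod C p) (Cod C h) \<and> k \<cdot> p = h"
  proof (rule ex1I[of _ k])
    fix l assume "l \<in> Hom C (Cod C p) (Cod C h) \<and> l \<cdot> p = h"
    then show "l = k" using k epi_cancel[OF _ assms(5), of l k] by (auto simp: in_Hom_iff)
  qed (use k in blast)
qed (use assms in auto)

lemma epi_Comp:
  assumes "epi_arr C f" "epi_arr C g" "Dom C g = Cod C f"
  shows "epi_arr C (g \<cdot> f)"
  unfolding epi_arr_def
proof (intro conjI ballI impI)
  have a: "f \<in> Arr C" "g \<in> Arr C" using assms by (auto simp: epi_arr_def)
  then show "g \<cdot> f \<in> Arr C" using assms by simp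
  fix h k assume h: "h \<in> Arr C" "Dom C h = Cod C (g \<cdot> f)" "k \<in> Arr C" "Dom C k = Cod C (g \<cdot> f)"
    and e: "h \<cdot> g \<cdot> f = k \<cdot> g \<cdot> f"
  then have "(h \<cdot> g) \<cdot> f = (k \<cdot> g) \<cdot> f" using a assms(3) by simp
  then have "h \<cdot> g = k \<cdot> g"
    by (rule epi_cancel[OF _ assms(1)]) (use a h assms(3) in simp_all)
  then show "h = k"
    by (rule epi_cancel[OF _ assms(2)]) (use a h assms(3) in simp_all)
qed

lemma split_epi_regular:
  assumes "p \<in> Arr C" "s \<in> Arr C" "Dom C s = Cod C p" "Cod C s = Dom C p"
    and ps: "p \<cdot> s = Idn C (Cod C p)"
  shows "is_coequalizer C (s \<cdot> p) (Idn C (Dom C p)) p"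
proof (rule is_coequalizerI)
  show "p \<cdot> s \<cdot> p = p \<cdot> Idn C (Dom C p)" using assms chain[OF ps, of p] by simp
  show "epi_arr C p" unfolding epi_arr_def
  proof (intro conjI ballI impI)
    fix h k assume h: "h \<in> Arr C" "Dom C h = Cod C p" "k \<in> Arr C" "Dom C k = Cod C p"
      and eq: "h \<cdot> p = k \<cdot> p"
    have "h = (h \<cdot> p) \<cdot> s" "k = (k \<cdot> p) \<cdot> s" using h assms by simp_all
    then show "h = k" using eq by simp
  qed fact
next
  fix h assume h: "h \<in> Arr C" "Dom C h = Cod C (s \<cdot> p)" "h \<cdot> s \<cdot> p = h \<cdot> Idn C (Dom C p)"
  show "\<exists>k. k \<in> Hom C (Cod C p) (Cod C h) \<and> k \<cdot> p = h"
    by (rule exI[of _ "h \<cdot> s"]) (use h assms in \<open>simp add: in_Hom_iff\<close>)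
qed (use assms in \<open>simp_all add: parallel_def\<close>)

lemma Idn_regular_epi: "X \<in> Obj C \<Longrightarrow> regular_epi C (Idn C X)"
  using split_epi_regular[of "Idn C X" "Idn C X"] by (auto simp: regular_epi_def)

lemma comp_regular_epis_Arr: "comp_regular_epis C f \<Longrightarrow> f \<in> Arr C"
  by (induction rule: comp_regular_epis.induct)
    (auto simp: regular_epi_def dest: coequalizer_simps)

lemma comp_regular_epis_epi: "comp_regular_epis C f \<Longrightarrow> epi_arr C f"
  by (induction rule: comp_regular_epis.induct)
    (auto simp: regular_epi_def intro: epi_Comp coequalizer_epi)

text \<open>When the two arrows agree, the identity coequalizes them as well.\<close>

lemma coequalizer_of_equal_iso:
  assumes "is_coequalizer C f f p"
  shows "iso_arr C p"
proof -
  note c = coequalizer_simps[OF assms]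
  obtain k where k: "k \<in> Arr C" "Dom C k = Cod C p" "Cod C k = Dom C p" "k \<cdot> p = Idn C (Dom C p)"
    by (rule coequalizer_factor[OF assms, of "Idn C (Dom C p)"]) (use c in auto)
  have "(p \<cdot> k) \<cdot> p = Idn C (Cod C p) \<cdot> p" using k c by simp
  then have "p \<cdot> k = Idn C (Cod C p)"
    by (rule epi_cancel[OF _ coequalizer_epi[OF assms]]) (use k c in simp_all)
  then show ?thesis using k c by (auto simp: iso_arr_def in_Hom_iff)
qed

end

lemma (in cat_functor) comp_regular_epis_amap:
  assumes "\<And>p. regular_epi C p \<Longrightarrow> regular_epi D (amap F p)" "comp_regular_epis C f"
  shows "comp_regular_epis D (amap F f)"
  using assms(2)
proof (induction rule: comp_regular_epis.induct)
  case (single p)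
  then show ?case using assms(1) by (blast intro: comp_regular_epis.single)
next
  case (compose f p)
  have "p \<in> Arr C" "f \<in> Arr C"
    using source.comp_regular_epis_Arr[OF compose.hyps(1)]
      source.comp_regular_epis_Arr[OF comp_regular_epis.single[OF compose.hyps(2)]] by simp_all
  then show ?case using comp_regular_epis.compose[OF compose.IH assms(1)[OF compose.hyps(2)]]
      compose.hyps(3) by simp
qed


section \<open>Adjunctions\<close>

context adjunction
begin

lemma unit_simps [simp]:
  assumes "X \<in> Obj B"
  shows "\<eta> X \<in> Arr B" "Dom B (\<eta> X) = X" "Cod B (\<eta> X) = omap R (omap L X)"
  using unit.component_simps[OF assms] by simp_all

lemma counit_simps [simp]:
  assumes "Y \<in> Obj A"
  shows "\<epsilon> Y \<in> Arr A" "Dom A (\<epsilon> Y) = omap L (omap R Y)" "Cod A (\<epsilon> Y) = Y"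
  using counit.component_simps[OF assms] by simp_all

lemma unit_nat:
  "f \<in> Arr B \<Longrightarrow> Cod B f = Y \<Longrightarrow> \<eta> Y \<cdot>\<^bsub>B\<^esub> f = amap R (amap L f) \<cdot>\<^bsub>B\<^esub> \<eta> (Dom B f)"
  using unit.nat[of f Y] by simp

lemma counit_nat:
  "f \<in> Arr A \<Longrightarrow> Cod A f = Y \<Longrightarrow> \<epsilon> Y \<cdot>\<^bsub>A\<^esub> amap L (amap R f) = f \<cdot>\<^bsub>A\<^esub> \<epsilon> (Dom A f)"
  using counit.nat[of f Y] by simp

lemma counit_nat_chain:
  assumes "f \<in> Arr A" "Cod A f = Y" "x \<in> Arr A" "Cod A x = omap L (omap R (Dom A f))"
  shows "\<epsilon> Y \<cdot>\<^bsub>A\<^esub> amap L (amap R f) \<cdot>\<^bsub>A\<^esub> x = f \<cdot>\<^bsub>A\<^esub> \<epsilon> (Dom A f) \<cdot>\<^bsub>A\<^esub> x"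
proof -
  have "Y \<in> Obj A" using assms by auto
  then show ?thesis using assms left.target.chain[OF counit_nat[of f Y], of x] by simp
qed

text \<open>An arrow \<open>f\<close> into \<open>R Y\<close> is recovered from its transpose \<open>t\<close> as \<open>R t \<circ> \<eta>\<close>.\<close>

lemma transpose_eqD:
  assumes "f \<in> Arr B" "g \<in> Arr B" "Dom B g = Dom B f" "Cod B f = omap R Y" "Cod B g = omap R Y"
    and Y: "Y \<in> Obj A" and eq: "\<epsilon> Y \<cdot>\<^bsub>A\<^esub> amap L f = \<epsilon> Y \<cdot>\<^bsub>A\<^esub> amap L g"
  shows "f = g"
proof -
  have *: "amap R (\<epsilon> Y \<cdot>\<^bsub>A\<^esub> amap L h) \<cdot>\<^bsub>B\<^esub> \<eta> (Dom B h) = h"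
    if h: "h \<in> Arr B" "Cod B h = omap R Y" for h
  proof -
    have "amap R (\<epsilon> Y \<cdot>\<^bsub>A\<^esub> amap L h) \<cdot>\<^bsub>B\<^esub> \<eta> (Dom B h)
        = amap R (\<epsilon> Y) \<cdot>\<^bsub>B\<^esub> (\<eta> (omap R Y) \<cdot>\<^bsub>B\<^esub> h)"
      using h Y unit_nat[of h "omap R Y"] by simp
    also have "\<dots> = h" using h Y left.source.chain[OF triangle_right, of Y h] by simp
    finally show ?thesis .
  qed
  show ?thesis using *[of f] *[of g] assms by simp
qed

text \<open>
  If \<open>\<eta> (R Y)\<close> is invertible, both sides are inverse to \<open>L (\<eta> (R Y))\<close>. The resulting equation
  involves only the comonad \<open>LR\<close> on \<open>A\<close> and can thus be carried over to another adjunction.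
\<close>

lemma idempotent_comonad:
  assumes Y: "Y \<in> Obj A" and iso: "iso_arr B (\<eta> (omap R Y))"
  shows "amap L (amap R (\<epsilon> Y)) = \<epsilon> (omap L (omap R Y))"
proof -
  obtain k where k: "k \<in> Arr B" "Dom B k = omap R (omap L (omap R Y))" "Cod B k = omap R Y"
    "\<eta> (omap R Y) \<cdot>\<^bsub>B\<^esub> k = Idn B (omap R (omap L (omap R Y)))"
    using iso Y by (auto simp: iso_arr_def in_Hom_iff)
  have *: "amap L (\<eta> (omap R Y)) \<cdot>\<^bsub>A\<^esub> amap L k = Idn A (omap L (omap R (omap L (omap R Y))))"
    using k(1-3) Y arg_cong[OF k(4), of "amap L"] by simp
  have "amap L (amap R (\<epsilon> Y)) = amap L (amap R (\<epsilon> Y) \<cdot>\<^bsub>B\<^esub> \<eta> (omap R Y) \<cdot>\<^bsub>B\<^esub> k)"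
    using k Y by simp
  also have "\<dots> = amap L k" using k Y left.source.chain[OF triangle_right, of Y k] by simp
  also have "\<dots> = \<epsilon> (omap L (omap R Y)) \<cdot>\<^bsub>A\<^esub> amap L (\<eta> (omap R Y)) \<cdot>\<^bsub>A\<^esub> amap L k"
    using k Y left.target.chain[OF triangle_left, of "omap R Y" "amap L k"] by simp
  also have "\<dots> = \<epsilon> (omap L (omap R Y))" using * Y by simp
  finally show ?thesis .
qed

text \<open>
  The equation \<open>LR\<epsilon> = \<epsilon>LR\<close> makes \<open>\<eta>R\<close> inverse to \<open>R\<epsilon>\<close>. An object \<open>X\<close> with a retraction
  \<open>g\<close> of its unit is a retract of \<open>RLX\<close>, so its unit is invertible too, with inverse \<open>g\<close>;
  hence \<open>L g\<close> and \<open>\<epsilon> (L X)\<close> are both inverse to \<open>L (\<eta> X)\<close>.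
\<close>

lemma idempotent_retraction:
  assumes idem: "\<And>Y. Y \<in> Obj A \<Longrightarrow> amap L (amap R (\<epsilon> Y)) = \<epsilon> (omap L (omap R Y))"
    and X: "X \<in> Obj B" and g: "g \<in> Hom B (omap R (omap L X)) X" "g \<cdot>\<^bsub>B\<^esub> \<eta> X = Idn B X"
  shows "amap L g = \<epsilon> (omap L X)"
proof -
  have g': "g \<in> Arr B" "Dom B g = omap R (omap L X)" "Cod B g = X" using g by (auto simp: in_Hom_iff)
  let ?E = "\<eta> (omap R (omap L X))" and ?D = "amap R (\<epsilon> (omap L X))"
  have ED: "?E \<cdot>\<^bsub>B\<^esub> ?D = Idn B (omap R (omap L (omap R (omap L X))))"
  proof -
    have "?E \<cdot>\<^bsub>B\<^esub> ?D = amap R (amap L (amap R (\<epsilon> (omap L X)))) \<cdot>\<^bsub>B\<^esub> \<eta> (omap R (omap L (omap R (omap L X))))"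
      using X unit_nat[of ?D] by simp
    also have "\<dots> = Idn B (omap R (omap L (omap R (omap L X))))" using X idem by (simp add: triangle_right)
    finally show ?thesis .
  qed
  let ?RLg = "amap R (amap L g)" and ?RLe = "amap R (amap L (\<eta> X))"
  have RLe: "?RLe = ?E"
  proof -
    have "?RLe = ?E \<cdot>\<^bsub>B\<^esub> ?D \<cdot>\<^bsub>B\<^esub> ?RLe" using X left.source.chain[OF ED, of ?RLe] by simp
    also have "?D \<cdot>\<^bsub>B\<^esub> ?RLe = Idn B (omap R (omap L X))"
      using X arg_cong[OF triangle_left[of X], of "amap R"] by simp
    finally show ?thesis using X by simp
  qed
  have "?RLg \<cdot>\<^bsub>B\<^esub> ?E = Idn B (omap R (omap L X))"
    using X g' arg_cong[OF g(2), of "\<lambda>x. amap R (amap L x)"] by (simp add: RLe[symmetric])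
  then have eg: "\<eta> X \<cdot>\<^bsub>B\<^esub> g = Idn B (omap R (omap L X))" using g' X unit_nat[of g] by simp
  have "amap L g = \<epsilon> (omap L X) \<cdot>\<^bsub>A\<^esub> amap L (\<eta> X) \<cdot>\<^bsub>A\<^esub> amap L g"
    using X g' left.target.chain[OF triangle_left[of X], of "amap L g"] by simp
  also have "\<dots> = \<epsilon> (omap L X)" using X g' arg_cong[OF eg, of "amap L"] by simp
  finally show ?thesis .
qed

text \<open>The preimage of \<open>\<epsilon> (L X)\<close> under \<open>L\<close> is inverse to \<open>\<eta> X\<close>.\<close>

lemma fully_faithful_unit_iso:
  assumes ff: "fully_faithful B A L" and X: "X \<in> Obj B"
  shows "iso_arr B (\<eta> X)"
proof -
  have "bij_betw (amap L) (Hom B (omap R (omap L X)) X) (Hom A (omap L (omap R (omap L X))) (omap L X))"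
    using ff X by (simp add: fully_faithful_def)
  moreover have "\<epsilon> (omap L X) \<in> Hom A (omap L (omap R (omap L X))) (omap L X)"
    using X by (simp add: in_Hom_iff)
  ultimately obtain g where g: "g \<in> Arr B" "Dom B g = omap R (omap L X)" "Cod B g = X"
    and Lg: "amap L g = \<epsilon> (omap L X)" unfolding bij_betw_def in_Hom_iff by (force simp: in_Hom_iff)
  have "inj_on (amap L) (Hom B X X)" using ff X by (simp add: fully_faithful_def bij_betw_def)
  moreover have "amap L (g \<cdot>\<^bsub>B\<^esub> \<eta> X) = amap L (Idn B X)" using g X Lg triangle_left by simp
  ultimately have 1: "g \<cdot>\<^bsub>B\<^esub> \<eta> X = Idn B X"
    by (rule inj_onD) (use g X in \<open>simp_all add: in_Hom_iff\<close>)
  have 2: "\<eta> X \<cdot>\<^bsub>B\<^esub> g = Idn B (omap R (omap L X))" using g X Lg unit_nat[of g X] triangle_right by simp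
  show ?thesis using 1 2 g X by (auto simp: iso_arr_def in_Hom_iff)
qed

text \<open>Transposing a cocone under \<open>(L f, L g)\<close> gives one under \<open>(f, g)\<close>.\<close>

lemma left_adjoint_preserves_coequalizer:
  assumes "is_coequalizer B f g p"
  shows "is_coequalizer A (amap L f) (amap L g) (amap L p)"
proof -
  note c [simp] = coequalizer_simps(2-7)[OF assms]
  have pf: "p \<cdot>\<^bsub>B\<^esub> f = p \<cdot>\<^bsub>B\<^esub> g" by (rule coequalizer_simps(8)[OF assms])
  let ?p = "amap L p"
  show ?thesis
  proof (rule left.target.is_coequalizerI)
    show "?p \<cdot>\<^bsub>A\<^esub> amap L f = ?p \<cdot>\<^bsub>A\<^esub> amap L g"
      using arg_cong[OF pf, of "amap L"] by simp
    show "epi_arr A ?p" unfolding epi_arr_def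
    proof (intro conjI ballI impI)
      fix h k assume hk [simp]: "h \<in> Arr A" "k \<in> Arr A" "Dom A h = Cod A ?p" "Dom A k = Cod A ?p"
        and eq: "h \<cdot>\<^bsub>A\<^esub> ?p = k \<cdot>\<^bsub>A\<^esub> ?p"
      let ?t = "\<lambda>h. amap R h \<cdot>\<^bsub>B\<^esub> \<eta> (Cod B p)"
      have cod: "Cod A h = Cod A k" using arg_cong[OF eq, of "Cod A"] by simp
      have "?t h \<cdot>\<^bsub>B\<^esub> p = ?t k \<cdot>\<^bsub>B\<^esub> p"
        using arg_cong[OF eq, of "\<lambda>x. amap R x \<cdot>\<^bsub>B\<^esub> \<eta> (Dom B p)"] by (simp add: unit_nat)
      then have "?t h = ?t k"
        by (rule epi_cancel[OF _ left.source.coequalizer_epi[OF assms]]) simp_all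
      then have "\<epsilon> (Cod A h) \<cdot>\<^bsub>A\<^esub> amap L (?t h) = \<epsilon> (Cod A k) \<cdot>\<^bsub>A\<^esub> amap L (?t k)"
        by (simp add: cod)
      then show "h = k" by (simp add: counit_nat_chain triangle_left)
    qed simp
  next
    fix h assume [simp]: "h \<in> Arr A" "Dom A h = Cod A (amap L f)"
      and eq: "h \<cdot>\<^bsub>A\<^esub> amap L f = h \<cdot>\<^bsub>A\<^esub> amap L g"
    let ?t = "amap R h \<cdot>\<^bsub>B\<^esub> \<eta> (Cod B f)"
    have "?t \<cdot>\<^bsub>B\<^esub> f = ?t \<cdot>\<^bsub>B\<^esub> g"
      using arg_cong[OF eq, of "\<lambda>x. amap R x \<cdot>\<^bsub>B\<^esub> \<eta> (Dom B f)"] by (simp add: unit_nat)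
    then obtain k where k [simp]: "k \<in> Arr B" "Dom B k = Cod B p" "Cod B k = omap R (Cod A h)"
      and kp: "k \<cdot>\<^bsub>B\<^esub> p = ?t"
      using coequalizer_factor[OF assms, of ?t] by (auto simp del: left.target.assoc)
    have "(\<epsilon> (Cod A h) \<cdot>\<^bsub>A\<^esub> amap L k) \<cdot>\<^bsub>A\<^esub> ?p = h"
      using arg_cong[OF kp, of "amap L"] by (simp add: counit_nat_chain triangle_left)
    then show "\<exists>k. k \<in> Hom A (Cod A ?p) (Cod A h) \<and> k \<cdot>\<^bsub>A\<^esub> ?p = h"
      by (intro exI[of _ "\<epsilon> (Cod A h) \<cdot>\<^bsub>A\<^esub> amap L k"]) (simp add: in_Hom_iff)
  qed (simp_all add: parallel_def)
qed

end

section \<open>Augmented endofunctors\<close>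

text \<open>
  The comonad of the next stage, in terms of the comonad \<open>(G, \<epsilon>)\<close> of the present one. The
  condition involves no category but \<open>A\<close> and determines the next comonad up to isomorphism,
  so that towers over different categories can be compared inside \<open>A\<close>.
\<close>

definition derived_from :: "('a, 'k) cat \<Rightarrow> ('a, 'k, 'a, 'k) func \<Rightarrow> ('a \<Rightarrow> 'k)
    \<Rightarrow> ('a, 'k, 'a, 'k) func \<Rightarrow> ('a \<Rightarrow> 'k) \<Rightarrow> bool" where
  "derived_from A G \<epsilon> G\<^sub>1 \<epsilon>\<^sub>1 \<longleftrightarrow>
    nat_trans A A G\<^sub>1 fid \<epsilon>\<^sub>1 \<and>
    (\<exists>p. nat_trans A A G G\<^sub>1 p \<and>
      (\<forall>Y\<in>Obj A. is_coequalizer A (amap G (\<epsilon> Y)) (\<epsilon> (omap G Y)) (p Y) \<and>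
        \<epsilon>\<^sub>1 Y \<cdot>\<^bsub>A\<^esub> p Y = \<epsilon> Y))"

definition augmented_map :: "('a, 'k) cat \<Rightarrow> ('a, 'k, 'a, 'k) func \<Rightarrow> ('a \<Rightarrow> 'k)
    \<Rightarrow> ('a, 'k, 'a, 'k) func \<Rightarrow> ('a \<Rightarrow> 'k) \<Rightarrow> ('a \<Rightarrow> 'k) \<Rightarrow> bool" where
  "augmented_map A G \<epsilon> H \<delta> \<phi> \<longleftrightarrow>
    nat_trans A A G fid \<epsilon> \<and> nat_trans A A H fid \<delta> \<and> nat_trans A A G H \<phi> \<and>
    (\<forall>Y\<in>Obj A. \<delta> Y \<cdot>\<^bsub>A\<^esub> \<phi> Y = \<epsilon> Y)"

text \<open>A split epimorphism of augmented endofunctors carries the equation \<open>G\<epsilon> = \<epsilon>G\<close> from \<open>G\<close> to \<open>H\<close>.\<close>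

definition augmented_retract :: "('a, 'k) cat \<Rightarrow> ('a, 'k, 'a, 'k) func \<Rightarrow> ('a \<Rightarrow> 'k)
    \<Rightarrow> ('a, 'k, 'a, 'k) func \<Rightarrow> ('a \<Rightarrow> 'k) \<Rightarrow> bool" where
  "augmented_retract A G \<epsilon> H \<delta> \<longleftrightarrow>
    (\<exists>\<phi> \<psi>. augmented_map A G \<epsilon> H \<delta> \<phi> \<and> augmented_map A H \<delta> G \<epsilon> \<psi> \<and>
      (\<forall>Y\<in>Obj A. \<phi> Y \<cdot>\<^bsub>A\<^esub> \<psi> Y = Idn A (omap H Y)))"

text \<open>
  A map \<open>\<phi>\<close> of augmented endofunctors transports the pair \<open>(G\<epsilon>, \<epsilon>G)\<close> to \<open>(H\<delta>, \<delta>H)\<close> along the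
  horizontal composite \<open>\<phi>\<phi>\<close>.
\<close>

lemma augmented_map_square:
  assumes "augmented_map A G \<epsilon> H \<delta> \<phi>" and Y [simp]: "Y \<in> Obj A"
  shows "\<phi> Y \<cdot>\<^bsub>A\<^esub> amap G (\<epsilon> Y) = amap H (\<delta> Y) \<cdot>\<^bsub>A\<^esub> \<phi> (omap H Y) \<cdot>\<^bsub>A\<^esub> amap G (\<phi> Y)"
    and "\<phi> Y \<cdot>\<^bsub>A\<^esub> \<epsilon> (omap G Y) = \<delta> (omap H Y) \<cdot>\<^bsub>A\<^esub> \<phi> (omap H Y) \<cdot>\<^bsub>A\<^esub> amap G (\<phi> Y)"
proof -
  interpret e: nat_trans A A G fid \<epsilon> using assms(1) by (simp add: augmented_map_def)
  interpret d: nat_trans A A H fid \<delta> using assms(1) by (simp add: augmented_map_def)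
  interpret f: nat_trans A A G H \<phi> using assms(1) by (simp add: augmented_map_def)
  have df: "\<delta> Y \<cdot>\<^bsub>A\<^esub> \<phi> Y = \<epsilon> Y" if "Y \<in> Obj A" for Y
    using assms(1) that by (simp add: augmented_map_def)
  have "\<phi> Y \<cdot>\<^bsub>A\<^esub> amap G (\<epsilon> Y) = amap H (\<epsilon> Y) \<cdot>\<^bsub>A\<^esub> \<phi> (omap G Y)"
    by (simp add: f.nat)
  also have "\<dots> = amap H (\<delta> Y) \<cdot>\<^bsub>A\<^esub> amap H (\<phi> Y) \<cdot>\<^bsub>A\<^esub> \<phi> (omap G Y)"
    by (simp add: df[symmetric])
  also have "amap H (\<phi> Y) \<cdot>\<^bsub>A\<^esub> \<phi> (omap G Y) = \<phi> (omap H Y) \<cdot>\<^bsub>A\<^esub> amap G (\<phi> Y)"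
    by (simp add: f.nat)
  finally show "\<phi> Y \<cdot>\<^bsub>A\<^esub> amap G (\<epsilon> Y) = amap H (\<delta> Y) \<cdot>\<^bsub>A\<^esub> \<phi> (omap H Y) \<cdot>\<^bsub>A\<^esub> amap G (\<phi> Y)" .
  have "\<phi> Y \<cdot>\<^bsub>A\<^esub> \<epsilon> (omap G Y) = \<epsilon> (omap H Y) \<cdot>\<^bsub>A\<^esub> amap G (\<phi> Y)"
    using e.nat[of "\<phi> Y"] by simp
  also have "\<dots> = \<delta> (omap H Y) \<cdot>\<^bsub>A\<^esub> \<phi> (omap H Y) \<cdot>\<^bsub>A\<^esub> amap G (\<phi> Y)"
    by (simp add: df[symmetric])
  finally show "\<phi> Y \<cdot>\<^bsub>A\<^esub> \<epsilon> (omap G Y) = \<delta> (omap H Y) \<cdot>\<^bsub>A\<^esub> \<phi> (omap H Y) \<cdot>\<^bsub>A\<^esub> amap G (\<phi> Y)" .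
qed

text \<open>
  By the square above, \<open>r \<circ> \<phi>\<close> coequalizes the pair \<open>(G\<epsilon>, \<epsilon>G)\<close>; the induced arrows are natural
  and compatible with the augmentations because \<open>p\<close> is epic.
\<close>

lemma augmented_map_derived:
  assumes m: "augmented_map A G \<epsilon> H \<delta> \<phi>"
    and p: "nat_trans A A G\<^sub>1 fid \<epsilon>\<^sub>1" "nat_trans A A G G\<^sub>1 p"
      "\<And>Y. Y \<in> Obj A \<Longrightarrow> is_coequalizer A (amap G (\<epsilon> Y)) (\<epsilon> (omap G Y)) (p Y)"
      "\<And>Y. Y \<in> Obj A \<Longrightarrow> \<epsilon>\<^sub>1 Y \<cdot>\<^bsub>A\<^esub> p Y = \<epsilon> Y"
    and r: "nat_trans A A H\<^sub>1 fid \<delta>\<^sub>1" "nat_trans A A H H\<^sub>1 r"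
      "\<And>Y. Y \<in> Obj A \<Longrightarrow> is_coequalizer A (amap H (\<delta> Y)) (\<delta> (omap H Y)) (r Y)"
      "\<And>Y. Y \<in> Obj A \<Longrightarrow> \<delta>\<^sub>1 Y \<cdot>\<^bsub>A\<^esub> r Y = \<delta> Y"
  obtains \<phi>\<^sub>1 where "augmented_map A G\<^sub>1 \<epsilon>\<^sub>1 H\<^sub>1 \<delta>\<^sub>1 \<phi>\<^sub>1"
    and "\<And>Y. Y \<in> Obj A \<Longrightarrow> \<phi>\<^sub>1 Y \<cdot>\<^bsub>A\<^esub> p Y = r Y \<cdot>\<^bsub>A\<^esub> \<phi> Y"
proof -
  interpret e: nat_trans A A G fid \<epsilon> using m by (simp add: augmented_map_def)
  interpret d: nat_trans A A H fid \<delta> using m by (simp add: augmented_map_def)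
  interpret f: nat_trans A A G H \<phi> using m by (simp add: augmented_map_def)
  interpret e': nat_trans A A G\<^sub>1 fid \<epsilon>\<^sub>1 by fact
  interpret d': nat_trans A A H\<^sub>1 fid \<delta>\<^sub>1 by fact
  interpret p: nat_trans A A G G\<^sub>1 p by fact
  interpret r: nat_trans A A H H\<^sub>1 r by fact
  have "\<exists>k. k \<in> Arr A \<and> Dom A k = omap G\<^sub>1 Y \<and> Cod A k = omap H\<^sub>1 Y \<and> k \<cdot>\<^bsub>A\<^esub> p Y = r Y \<cdot>\<^bsub>A\<^esub> \<phi> Y"
    if Y [simp]: "Y \<in> Obj A" for Y
  proof -
    note sq = augmented_map_square[OF m Y]
    have req: "r Y \<cdot>\<^bsub>A\<^esub> amap H (\<delta> Y) = r Y \<cdot>\<^bsub>A\<^esub> \<delta> (omap H Y)"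
      using coequalizer_simps(8)[OF r(3)[OF Y]] .
    have "(r Y \<cdot>\<^bsub>A\<^esub> \<phi> Y) \<cdot>\<^bsub>A\<^esub> amap G (\<epsilon> Y) = (r Y \<cdot>\<^bsub>A\<^esub> \<phi> Y) \<cdot>\<^bsub>A\<^esub> \<epsilon> (omap G Y)"
      by (simp add: sq e.F.source.chain[OF req])
    then obtain k where "k \<in> Arr A" "Dom A k = Cod A (p Y)" "Cod A k = Cod A (r Y \<cdot>\<^bsub>A\<^esub> \<phi> Y)"
      "k \<cdot>\<^bsub>A\<^esub> p Y = r Y \<cdot>\<^bsub>A\<^esub> \<phi> Y"
      by (rule coequalizer_factor[OF p(3)[OF Y], rotated 2]) simp_all
    then show ?thesis by (intro exI[of _ k]) simp
  qed
  then obtain k where k: "\<And>Y. Y \<in> Obj A \<Longrightarrow> k Y \<in> Arr A \<and> Dom A (k Y) = omap G\<^sub>1 Y \<and>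
      Cod A (k Y) = omap H\<^sub>1 Y \<and> k Y \<cdot>\<^bsub>A\<^esub> p Y = r Y \<cdot>\<^bsub>A\<^esub> \<phi> Y"
    by metis
  then have k1 [simp]: "k Y \<in> Arr A" "Dom A (k Y) = omap G\<^sub>1 Y" "Cod A (k Y) = omap H\<^sub>1 Y"
    and kp: "k Y \<cdot>\<^bsub>A\<^esub> p Y = r Y \<cdot>\<^bsub>A\<^esub> \<phi> Y" if "Y \<in> Obj A" for Y
    using that by blast+
  have epi: "epi_arr A (p Y)" if "Y \<in> Obj A" for Y
    using e.F.source.coequalizer_epi p(3) that by blast
  have nat: "nat_trans A A G\<^sub>1 H\<^sub>1 k"
  proof (rule nat_transI)
    fix f assume f [simp]: "f \<in> Arr A"
    let ?X = "Dom A f" and ?Y = "Cod A f"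
    have "(k ?Y \<cdot>\<^bsub>A\<^esub> amap G\<^sub>1 f) \<cdot>\<^bsub>A\<^esub> p ?X = k ?Y \<cdot>\<^bsub>A\<^esub> p ?Y \<cdot>\<^bsub>A\<^esub> amap G f" by (simp add: p.nat)
    also have "\<dots> = r ?Y \<cdot>\<^bsub>A\<^esub> \<phi> ?Y \<cdot>\<^bsub>A\<^esub> amap G f" by (simp add: e.F.source.chain[OF kp])
    also have "\<dots> = r ?Y \<cdot>\<^bsub>A\<^esub> amap H f \<cdot>\<^bsub>A\<^esub> \<phi> ?X" by (simp add: f.nat)
    also have "\<dots> = amap H\<^sub>1 f \<cdot>\<^bsub>A\<^esub> r ?X \<cdot>\<^bsub>A\<^esub> \<phi> ?X" by (simp add: e.F.source.chain[OF r.nat])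
    also have "\<dots> = (amap H\<^sub>1 f \<cdot>\<^bsub>A\<^esub> k ?X) \<cdot>\<^bsub>A\<^esub> p ?X" by (simp add: kp)
    finally show "k ?Y \<cdot>\<^bsub>A\<^esub> amap G\<^sub>1 f = amap H\<^sub>1 f \<cdot>\<^bsub>A\<^esub> k ?X"
      by (rule epi_cancel[OF _ epi]) simp_all
  qed (simp_all add: in_Hom_iff e'.F.cat_functor_axioms d'.F.cat_functor_axioms)
  have "\<delta>\<^sub>1 Y \<cdot>\<^bsub>A\<^esub> k Y = \<epsilon>\<^sub>1 Y" if Y [simp]: "Y \<in> Obj A" for Y
  proof -
    have "(\<delta>\<^sub>1 Y \<cdot>\<^bsub>A\<^esub> k Y) \<cdot>\<^bsub>A\<^esub> p Y = \<epsilon>\<^sub>1 Y \<cdot>\<^bsub>A\<^esub> p Y"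
      using m by (simp add: kp p(4) e.F.source.chain[OF r(4)] augmented_map_def)
    then show ?thesis by (rule epi_cancel[OF _ epi]) simp_all
  qed
  then have "augmented_map A G\<^sub>1 \<epsilon>\<^sub>1 H\<^sub>1 \<delta>\<^sub>1 k"
    using nat p r by (simp add: augmented_map_def)
  then show ?thesis using kp that by blast
qed

lemma augmented_retract_derived:
  assumes G: "augmented_retract A G \<epsilon> H \<delta>"
    and p: "derived_from A G \<epsilon> G\<^sub>1 \<epsilon>\<^sub>1" and r: "derived_from A H \<delta> H\<^sub>1 \<delta>\<^sub>1"
  shows "augmented_retract A G\<^sub>1 \<epsilon>\<^sub>1 H\<^sub>1 \<delta>\<^sub>1"
proof -
  obtain \<phi> \<psi> where m: "augmented_map A G \<epsilon> H \<delta> \<phi>" "augmented_map A H \<delta> G \<epsilon> \<psi>"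
    and id: "\<And>Y. Y \<in> Obj A \<Longrightarrow> \<phi> Y \<cdot>\<^bsub>A\<^esub> \<psi> Y = Idn A (omap H Y)"
    using G by (auto simp: augmented_retract_def)
  obtain p where p: "nat_trans A A G\<^sub>1 fid \<epsilon>\<^sub>1" "nat_trans A A G G\<^sub>1 p"
      "\<And>Y. Y \<in> Obj A \<Longrightarrow> is_coequalizer A (amap G (\<epsilon> Y)) (\<epsilon> (omap G Y)) (p Y)"
      "\<And>Y. Y \<in> Obj A \<Longrightarrow> \<epsilon>\<^sub>1 Y \<cdot>\<^bsub>A\<^esub> p Y = \<epsilon> Y"
    using p by (auto simp: derived_from_def)
  obtain r where r: "nat_trans A A H\<^sub>1 fid \<delta>\<^sub>1" "nat_trans A A H H\<^sub>1 r"
      "\<And>Y. Y \<in> Obj A \<Longrightarrow> is_coequalizer A (amap H (\<delta> Y)) (\<delta> (omap H Y)) (r Y)"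
      "\<And>Y. Y \<in> Obj A \<Longrightarrow> \<delta>\<^sub>1 Y \<cdot>\<^bsub>A\<^esub> r Y = \<delta> Y"
    using r by (auto simp: derived_from_def)
  obtain \<phi>' where m1: "augmented_map A G\<^sub>1 \<epsilon>\<^sub>1 H\<^sub>1 \<delta>\<^sub>1 \<phi>'"
    and f: "\<And>Y. Y \<in> Obj A \<Longrightarrow> \<phi>' Y \<cdot>\<^bsub>A\<^esub> p Y = r Y \<cdot>\<^bsub>A\<^esub> \<phi> Y"
    using augmented_map_derived[OF m(1) p r] by blast
  obtain \<psi>' where m2: "augmented_map A H\<^sub>1 \<delta>\<^sub>1 G\<^sub>1 \<epsilon>\<^sub>1 \<psi>'"
    and g: "\<And>Y. Y \<in> Obj A \<Longrightarrow> \<psi>' Y \<cdot>\<^bsub>A\<^esub> r Y = p Y \<cdot>\<^bsub>A\<^esub> \<psi> Y"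
    using augmented_map_derived[OF m(2) r p] by blast
  interpret f: nat_trans A A G H \<phi> using m by (simp add: augmented_map_def)
  interpret g: nat_trans A A H G \<psi> using m by (simp add: augmented_map_def)
  interpret p: nat_trans A A G G\<^sub>1 p by fact
  interpret r: nat_trans A A H H\<^sub>1 r by fact
  interpret f': nat_trans A A G\<^sub>1 H\<^sub>1 \<phi>' using m1 by (simp add: augmented_map_def)
  interpret g': nat_trans A A H\<^sub>1 G\<^sub>1 \<psi>' using m2 by (simp add: augmented_map_def)
  have "\<phi>' Y \<cdot>\<^bsub>A\<^esub> \<psi>' Y = Idn A (omap H\<^sub>1 Y)" if Y [simp]: "Y \<in> Obj A" for Y
  proof -
    have "(\<phi>' Y \<cdot>\<^bsub>A\<^esub> \<psi>' Y) \<cdot>\<^bsub>A\<^esub> r Y = \<phi>' Y \<cdot>\<^bsub>A\<^esub> p Y \<cdot>\<^bsub>A\<^esub> \<psi> Y" by (simp add: g)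
    also have "\<dots> = r Y \<cdot>\<^bsub>A\<^esub> \<phi> Y \<cdot>\<^bsub>A\<^esub> \<psi> Y" by (simp add: f.F.source.chain[OF f])
    also have "\<dots> = Idn A (omap H\<^sub>1 Y) \<cdot>\<^bsub>A\<^esub> r Y" by (simp add: id)
    finally show ?thesis
      by (rule epi_cancel[OF _ f.F.source.coequalizer_epi[OF r(3)]]) simp_all
  qed
  then show ?thesis using m1 m2 by (auto simp: augmented_retract_def)
qed

text \<open>Cancel the horizontal composite \<open>\<phi>\<phi>\<close>, split by \<open>\<psi>\<psi>\<close>, from the two equations of the square.\<close>

lemma augmented_retract_idempotent:
  assumes "augmented_retract A G \<epsilon> H \<delta>"
    and idem: "\<And>Y. Y \<in> Obj A \<Longrightarrow> amap G (\<epsilon> Y) = \<epsilon> (omap G Y)" and Y [simp]: "Y \<in> Obj A"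
  shows "amap H (\<delta> Y) = \<delta> (omap H Y)"
proof -
  obtain \<phi> \<psi> where m: "augmented_map A G \<epsilon> H \<delta> \<phi>" "augmented_map A H \<delta> G \<epsilon> \<psi>"
    and id: "\<And>Y. Y \<in> Obj A \<Longrightarrow> \<phi> Y \<cdot>\<^bsub>A\<^esub> \<psi> Y = Idn A (omap H Y)"
    using assms(1) by (auto simp: augmented_retract_def)
  interpret f: nat_trans A A G H \<phi> using m by (simp add: augmented_map_def)
  interpret g: nat_trans A A H G \<psi> using m by (simp add: augmented_map_def)
  interpret d: nat_trans A A H fid \<delta> using m by (simp add: augmented_map_def)
  let ?s = "amap G (\<psi> Y) \<cdot>\<^bsub>A\<^esub> \<psi> (omap H Y)"
  have "amap G (\<phi> Y) \<cdot>\<^bsub>A\<^esub> amap G (\<psi> Y) = Idn A (omap G (omap H Y))"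
    using arg_cong[OF id[OF Y], of "amap G"] by simp
  then have s: "\<phi> (omap H Y) \<cdot>\<^bsub>A\<^esub> amap G (\<phi> Y) \<cdot>\<^bsub>A\<^esub> ?s = Idn A (omap H (omap H Y))"
    using f.F.source.chain[of "amap G (\<phi> Y)" "amap G (\<psi> Y)" _ "\<psi> (omap H Y)"] by (simp add: id)
  note sq = augmented_map_square[OF m(1) Y]
  have "amap H (\<delta> Y) = (amap H (\<delta> Y) \<cdot>\<^bsub>A\<^esub> \<phi> (omap H Y) \<cdot>\<^bsub>A\<^esub> amap G (\<phi> Y)) \<cdot>\<^bsub>A\<^esub> ?s"
    using s by simp
  also have "\<dots> = (\<delta> (omap H Y) \<cdot>\<^bsub>A\<^esub> \<phi> (omap H Y) \<cdot>\<^bsub>A\<^esub> amap G (\<phi> Y)) \<cdot>\<^bsub>A\<^esub> ?s"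
    using sq idem by simp
  also have "\<dots> = \<delta> (omap H Y)" using s by simp
  finally show ?thesis .
qed


section \<open>The comonads of the monadic tower\<close>

lemma over_cat_simps [simp]:
  "Obj (over_cat C Os P) = Os" "Dom (over_cat C Os P) = src" "Cod (over_cat C Os P) = tgt"
  "Idn (over_cat C Os P) X = Over_arr X (Idn C (under X)) X"
  "Comp (over_cat C Os P) g f = Over_arr (src f) (under_arr g \<cdot>\<^bsub>C\<^esub> under_arr f) (tgt g)"
  by (simp_all add: over_cat_def)

lemma over_cat_Arr_iff:
  "f \<in> Arr (over_cat C Os P) \<longleftrightarrow> (\<exists>X g Y. f = Over_arr X g Y \<and> X \<in> Os \<and> Y \<in> Os \<and>
    g \<in> Arr C \<and> Dom C g = under X \<and> Cod C g = under Y \<and> P X g Y)"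
  by (auto simp: over_cat_def in_Hom_iff)

lemma over_func_simps [simp]:
  "omap (over_func D G s) X = Over_obj (omap G X) (s X)"
  "amap (over_func D G s) f = Over_arr (Over_obj (omap G (Dom D f)) (s (Dom D f))) (amap G f)
    (Over_obj (omap G (Cod D f)) (s (Cod D f)))"
  by (simp_all add: over_func_def)

text \<open>
  For a comparison functor \<open>K\<close> with left adjoint \<open>L'\<close>, arrows \<open>L' (K Y) \<rightarrow> Z\<close> correspond to
  algebra morphisms \<open>K Y \<rightarrow> K Z\<close>. Transposed along \<open>(L, R)\<close>, the condition on \<open>t : R Y \<rightarrow> R Z\<close> to
  be such a morphism says that the transpose \<open>h : L (R Y) \<rightarrow> Z\<close> coequalizes \<open>LR\<epsilon>\<close> and \<open>\<epsilon>LR\<close>.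
\<close>

lemma tower_comonad_derived:
  assumes adj: "adjunction A (acat T) (aL T) (aR T) (aunit T) (acounit T)"
    and adj': "adjunction A (acat T') (aL T') (aR T') (aunit T') (acounit T')"
    and cat': "acat T' = adj_EM_cat T" and R': "aR T' = comparison A T"
  shows "derived_from A (aL T \<circ>\<^sub>F aR T) (acounit T) (aL T' \<circ>\<^sub>F aR T') (acounit T')"
proof -
  define C L R \<eta> \<epsilon> where "C = acat T" "L = aL T" "R = aR T" "\<eta> = aunit T" "\<epsilon> = acounit T"
  define M L' K \<eta>' \<epsilon>' where "M = acat T'" "L' = aL T'" "K = aR T'" "\<eta>' = aunit T'" "\<epsilon>' = acounit T'"
  note fold1 = C_L_R_\<eta>_\<epsilon>_def M_L'_K_\<eta>'_\<epsilon>'_def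
  interpret t: adjunction A C L R \<eta> \<epsilon> using adj by (simp add: fold1)
  interpret t': adjunction A M L' K \<eta>' \<epsilon>' using adj' by (simp add: fold1)
  have K_o: "omap K Y = Over_obj (omap R Y) (amap R (\<epsilon> Y))" for Y
    by (simp add: fold1 R' comparison_def)
  have K_under: "under (omap K Y) = omap R Y" "str (omap K Y) = amap R (\<epsilon> Y)" for Y
    by (simp_all add: K_o)
  have K_a: "amap K f = Over_arr (omap K (Dom A f)) (amap R f) (omap K (Cod A f))" for f
    by (simp add: fold1 R' comparison_def)
  have Marr: "f \<in> Arr M \<longleftrightarrow> (\<exists>X g Y. f = Over_arr X g Y \<and> X \<in> Obj M \<and> Y \<in> Obj M \<and>
    g \<in> Arr C \<and> Dom C g = under X \<and> Cod C g = under Y \<and>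
    g \<cdot>\<^bsub>C\<^esub> str X = str Y \<cdot>\<^bsub>C\<^esub> amap R (amap L g))" for f
    unfolding M_L'_K_\<eta>'_\<epsilon>'_def cat' adj_EM_cat_def EM_cat_def over_cat_Arr_iff C_L_R_\<eta>_\<epsilon>_def
    by simp
  have Msimps: "Dom M = src" "Cod M = tgt" "under_arr (g \<cdot>\<^bsub>M\<^esub> f) = under_arr g \<cdot>\<^bsub>C\<^esub> under_arr f" for g f
    unfolding M_L'_K_\<eta>'_\<epsilon>'_def cat' adj_EM_cat_def EM_cat_def C_L_R_\<eta>_\<epsilon>_def by simp_all
  let ?G = "\<lambda>Y. omap L' (omap K Y)"
  define u where "u = (\<lambda>Y. under_arr (\<eta>' (omap K Y)))"
  have u [simp]: "u Y \<in> Arr C" "Dom C (u Y) = omap R Y" "Cod C (u Y) = omap R (?G Y)"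
    and u_alg: "u Y \<cdot>\<^bsub>C\<^esub> amap R (\<epsilon> Y) = amap R (\<epsilon> (?G Y)) \<cdot>\<^bsub>C\<^esub> amap R (amap L (u Y))"
    and eta': "\<eta>' (omap K Y) = Over_arr (omap K Y) (u Y) (omap K (?G Y))"
    if Y: "Y \<in> Obj A" for Y
  proof -
    have e: "\<eta>' (omap K Y) \<in> Arr M" "src (\<eta>' (omap K Y)) = omap K Y"
        "tgt (\<eta>' (omap K Y)) = omap K (?G Y)"
      using t'.unit_simps[of "omap K Y"] Y by (simp_all add: Msimps)
    then show "\<eta>' (omap K Y) = Over_arr (omap K Y) (u Y) (omap K (?G Y))"
      unfolding Marr u_def by auto
    with e(1) show "u Y \<in> Arr C" "Dom C (u Y) = omap R Y" "Cod C (u Y) = omap R (?G Y)"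
      "u Y \<cdot>\<^bsub>C\<^esub> amap R (\<epsilon> Y) = amap R (\<epsilon> (?G Y)) \<cdot>\<^bsub>C\<^esub> amap R (amap L (u Y))"
      unfolding Marr by (auto simp: K_o)
  qed
  have u_nat: "u (Cod A f) \<cdot>\<^bsub>C\<^esub> amap R f = amap R (amap L' (amap K f)) \<cdot>\<^bsub>C\<^esub> u (Dom A f)"
    if f: "f \<in> Arr A" for f
    using arg_cong[OF t'.unit_nat[of "amap K f" "omap K (Cod A f)"], of under_arr] f
    by (simp add: Msimps) (simp add: u_def K_a)
  define p where "p = (\<lambda>Y. \<epsilon> (?G Y) \<cdot>\<^bsub>A\<^esub> amap L (u Y))"
  have p [simp]: "p Y \<in> Arr A" "Dom A (p Y) = omap L (omap R Y)" "Cod A (p Y) = ?G Y"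
    if "Y \<in> Obj A" for Y
    using that by (simp_all add: p_def)
  \<comment> \<open>Precomposition with \<open>p Y\<close> is the transposition along \<open>(L', K)\<close> followed by the
    forgetful functor and the transposition along \<open>(L, R)\<close>.\<close>
  have kp: "k \<cdot>\<^bsub>A\<^esub> p Y = \<epsilon> (Cod A k) \<cdot>\<^bsub>A\<^esub> amap L (amap R k \<cdot>\<^bsub>C\<^esub> u Y)"
    if "Y \<in> Obj A" "k \<in> Arr A" "Dom A k = ?G Y" for Y k
    using that by (simp add: p_def t.counit_nat_chain)
  have nat: "nat_trans A A (L \<circ>\<^sub>F R) (L' \<circ>\<^sub>F K) p"
  proof (rule nat_transI)
    fix f assume f [simp]: "f \<in> Arr A"
    have "p (Cod A f) \<cdot>\<^bsub>A\<^esub> amap L (amap R f)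
        = \<epsilon> (?G (Cod A f)) \<cdot>\<^bsub>A\<^esub> amap L (u (Cod A f) \<cdot>\<^bsub>C\<^esub> amap R f)"
      by (simp add: p_def)
    also have "\<dots> = amap L' (amap K f) \<cdot>\<^bsub>A\<^esub> p (Dom A f)" by (simp add: u_nat kp)
    finally show "p (Cod A f) \<cdot>\<^bsub>A\<^esub> amap (L \<circ>\<^sub>F R) f = amap (L' \<circ>\<^sub>F K) f \<cdot>\<^bsub>A\<^esub> p (Dom A f)" by simp
  qed (simp_all add: in_Hom_iff t.counit.F.cat_functor_axioms t'.counit.F.cat_functor_axioms)
  have coeq: "is_coequalizer A (amap L (amap R (\<epsilon> Y))) (\<epsilon> (omap L (omap R Y))) (p Y)"
    if Y [simp]: "Y \<in> Obj A" for Y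
  proof (rule t.left.target.is_coequalizerI)
    have "p Y \<cdot>\<^bsub>A\<^esub> amap L (amap R (\<epsilon> Y)) = \<epsilon> (?G Y) \<cdot>\<^bsub>A\<^esub> amap L (u Y \<cdot>\<^bsub>C\<^esub> amap R (\<epsilon> Y))"
      by (simp add: p_def)
    also have "\<dots> = \<epsilon> (?G Y) \<cdot>\<^bsub>A\<^esub> \<epsilon> (omap L (omap R (?G Y))) \<cdot>\<^bsub>A\<^esub> amap L (amap R (amap L (u Y)))"
      by (simp add: u_alg t.counit_nat_chain)
    also have "\<dots> = p Y \<cdot>\<^bsub>A\<^esub> \<epsilon> (omap L (omap R Y))" by (simp add: p_def t.counit_nat)
    finally show "p Y \<cdot>\<^bsub>A\<^esub> amap L (amap R (\<epsilon> Y)) = p Y \<cdot>\<^bsub>A\<^esub> \<epsilon> (omap L (omap R Y))" .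
    show "epi_arr A (p Y)" unfolding epi_arr_def
    proof (intro conjI ballI impI)
      fix g h assume [simp]: "g \<in> Arr A" "h \<in> Arr A" "Dom A g = Cod A (p Y)" "Dom A h = Cod A (p Y)"
        and eq: "g \<cdot>\<^bsub>A\<^esub> p Y = h \<cdot>\<^bsub>A\<^esub> p Y"
      have cod [simp]: "Cod A g = Cod A h" using arg_cong[OF eq, of "Cod A"] by simp
      have "amap R g \<cdot>\<^bsub>C\<^esub> u Y = amap R h \<cdot>\<^bsub>C\<^esub> u Y"
        by (rule t.transpose_eqD[of _ _ "Cod A h"])
          (use eq kp[of Y g] kp[of Y h] in simp_all)
      then have "amap K g \<cdot>\<^bsub>M\<^esub> \<eta>' (omap K Y) = amap K h \<cdot>\<^bsub>M\<^esub> \<eta>' (omap K Y)"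
        by (simp add: K_a eta' M_L'_K_\<eta>'_\<epsilon>'_def(1) cat' adj_EM_cat_def EM_cat_def C_L_R_\<eta>_\<epsilon>_def(1)[symmetric])
      then have "\<epsilon>' (Cod A g) \<cdot>\<^bsub>A\<^esub> amap L' (amap K g \<cdot>\<^bsub>M\<^esub> \<eta>' (omap K Y))
          = \<epsilon>' (Cod A h) \<cdot>\<^bsub>A\<^esub> amap L' (amap K h \<cdot>\<^bsub>M\<^esub> \<eta>' (omap K Y))" by simp
      then show "g = h" by (simp add: t'.counit_nat_chain t'.triangle_left del: cod)
    qed simp
  next
    fix h assume [simp]: "h \<in> Arr A" and "Dom A h = Cod A (amap L (amap R (\<epsilon> Y)))"
      and eq: "h \<cdot>\<^bsub>A\<^esub> amap L (amap R (\<epsilon> Y)) = h \<cdot>\<^bsub>A\<^esub> \<epsilon> (omap L (omap R Y))"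
    then have [simp]: "Dom A h = omap L (omap R Y)" by simp
    let ?Z = "Cod A h"
    define t where "t = amap R h \<cdot>\<^bsub>C\<^esub> \<eta> (omap R Y)"
    have t [simp]: "t \<in> Arr C" "Dom C t = omap R Y" "Cod C t = omap R ?Z"
      by (simp_all add: t_def)
    have eLt: "\<epsilon> ?Z \<cdot>\<^bsub>A\<^esub> amap L t = h"
      by (simp add: t_def t.counit_nat_chain t.triangle_left)
    have "t \<cdot>\<^bsub>C\<^esub> amap R (\<epsilon> Y) = amap R (h \<cdot>\<^bsub>A\<^esub> amap L (amap R (\<epsilon> Y))) \<cdot>\<^bsub>C\<^esub> \<eta> (omap R (omap L (omap R Y)))"
      by (simp add: t_def t.unit_nat)
    also have "\<dots> = amap R h" unfolding eq by (simp add: t.triangle_right)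
    also have "\<dots> = amap R (\<epsilon> ?Z) \<cdot>\<^bsub>C\<^esub> amap R (amap L t)"
      using arg_cong[OF eLt, of "amap R"] by simp
    finally have alg: "t \<cdot>\<^bsub>C\<^esub> amap R (\<epsilon> Y) = amap R (\<epsilon> ?Z) \<cdot>\<^bsub>C\<^esub> amap R (amap L t)" .
    define a where "a = Over_arr (omap K Y) t (omap K ?Z)"
    have [simp]: "omap K Y \<in> Obj M" "omap K ?Z \<in> Obj M" by simp_all
    have a [simp]: "a \<in> Arr M" unfolding Marr a_def using alg by (simp add: K_under)
    have [simp]: "Dom M a = omap K Y" "Cod M a = omap K ?Z" by (simp_all add: Msimps a_def)
    define k where "k = \<epsilon>' ?Z \<cdot>\<^bsub>A\<^esub> amap L' a"
    have [simp]: "k \<in> Arr A" "Dom A k = ?G Y" "Cod A k = ?Z" by (simp_all add: k_def)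
    have "amap K k \<cdot>\<^bsub>M\<^esub> \<eta>' (omap K Y) = a"
    proof -
      have "amap K k \<cdot>\<^bsub>M\<^esub> \<eta>' (omap K Y) = amap K (\<epsilon>' ?Z) \<cdot>\<^bsub>M\<^esub> \<eta>' (omap K ?Z) \<cdot>\<^bsub>M\<^esub> a"
        by (simp add: k_def t'.unit_nat)
      also have "\<dots> = a" by (simp add: t'.left.source.chain[OF t'.triangle_right])
      finally show ?thesis .
    qed
    from arg_cong[OF this, of under_arr] have "amap R k \<cdot>\<^bsub>C\<^esub> u Y = t"
      by (simp add: Msimps K_a u_def a_def)
    then have "k \<cdot>\<^bsub>A\<^esub> p Y = h" using eLt by (simp add: kp)
    then show "\<exists>k. k \<in> Hom A (Cod A (p Y)) (Cod A h) \<and> k \<cdot>\<^bsub>A\<^esub> p Y = h"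
      by (intro exI[of _ k]) (simp add: in_Hom_iff)
  qed (simp_all add: parallel_def)
  have "\<epsilon>' Y \<cdot>\<^bsub>A\<^esub> p Y = \<epsilon> Y" if Y [simp]: "Y \<in> Obj A" for Y
  proof -
    have "amap R (\<epsilon>' Y) \<cdot>\<^bsub>C\<^esub> u Y = Idn C (omap R Y)"
      using arg_cong[OF t'.triangle_right[of Y], of under_arr]
      by (simp add: Msimps K_a eta') (simp add: M_L'_K_\<eta>'_\<epsilon>'_def(1) cat' adj_EM_cat_def
        EM_cat_def C_L_R_\<eta>_\<epsilon>_def(1)[symmetric] K_o)
    then show ?thesis by (simp add: kp)
  qed
  then have "derived_from A (L \<circ>\<^sub>F R) \<epsilon> (L' \<circ>\<^sub>F K) \<epsilon>'"
    using nat coeq t'.counit.nat_trans_axioms by (auto simp: derived_from_def)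
  then show ?thesis by (simp add: fold1)
qed

section \<open>The stages of the adjoint decomposition\<close>

lemma category_over_cat:
  assumes "category C" "\<And>X. X \<in> Os \<Longrightarrow> under X \<in> Obj C"
    and "\<And>X. X \<in> Os \<Longrightarrow> P X (Idn C (under X)) X"
    and comp: "\<And>X f Y g Z. \<lbrakk>X \<in> Os; Y \<in> Os; Z \<in> Os; f \<in> Arr C; g \<in> Arr C; Dom C f = under X;
      Cod C f = under Y; Dom C g = under Y; Cod C g = under Z; P X f Y; P Y g Z\<rbrakk> \<Longrightarrow> P X (g \<cdot>\<^bsub>C\<^esub> f) Z"
  shows "category (over_cat C Os P)"
proof -
  interpret category C by fact
  show ?thesis
    using assms(2,3) by unfold_locales (auto simp: in_Hom_iff over_cat_Arr_iff intro: comp)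
qed

text \<open>
  The properties of a stage that the recursion preserves. The projection \<open>sproj\<close> has to be a
  composition of regular epimorphisms, and not merely epic, in order to stay epic under \<open>F\<close> and
  \<open>R'\<close>. The last assumption identifies \<open>acounit\<close> as the factorization of \<open>\<epsilon>\<close> through it.
\<close>

locale decomposition_stage =
  base: adjunction A B L R \<eta> \<epsilon> +
  stg: adjunction A "acat S" "aL S" "aR S" "aunit S" "acounit S" +
  U: cat_functor "acat S" B "sU S" +
  proj: nat_trans "acat S" A "L \<circ>\<^sub>F sU S" "aL S" "sproj S"
  for A :: "('a, 'k) cat" and B :: "('o, 'm) cat"
    and L :: "('o, 'm, 'a, 'k) func" and R :: "('a, 'k, 'o, 'm) func"
    and \<eta> :: "'o \<Rightarrow> 'm" and \<epsilon> :: "'a \<Rightarrow> 'k" and q :: "'k \<Rightarrow> 'k \<Rightarrow> 'k"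
    and S :: "('o, 'm, 'a, 'k) stage" +
  assumes choice: "coequalizer_choice A q"
    and U_faithful: "\<lbrakk>amap (sU S) f = amap (sU S) g; f \<in> Arr (acat S); g \<in> Arr (acat S);
      Dom (acat S) f = Dom (acat S) g; Cod (acat S) f = Cod (acat S) g\<rbrakk> \<Longrightarrow> f = g"
    and UR_omap [simp]: "Y \<in> Obj A \<Longrightarrow> omap (sU S) (omap (aR S) Y) = omap R Y"
    and UR_amap [simp]: "k \<in> Arr A \<Longrightarrow> amap (sU S) (amap (aR S) k) = amap R k"
    and proj_comp_regular_epis: "X \<in> Obj (acat S) \<Longrightarrow> comp_regular_epis A (sproj S X)"
    and counit_proj: "Y \<in> Obj A \<Longrightarrow> acounit S Y \<cdot>\<^bsub>A\<^esub> sproj S (omap (aR S) Y) = \<epsilon> Y"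
begin

abbreviation "\<C> \<equiv> acat S"
abbreviation "\<L> \<equiv> aL S"
abbreviation "\<R> \<equiv> aR S"
abbreviation "\<U> \<equiv> sU S"
abbreviation "\<N> \<equiv> next_cat B R S"
abbreviation "\<kappa> \<equiv> link A L \<epsilon> q S"
abbreviation "\<L>\<^sub>N \<equiv> next_L A L \<epsilon> q S"
abbreviation "\<R>\<^sub>N \<equiv> next_R A R S"

lemmas proj_simps [simp] = proj.component_simps[simplified]
lemmas proj_nat = proj.nat[simplified]

lemma proj_epi: "X \<in> Obj \<C> \<Longrightarrow> epi_arr A (sproj S X)"
  using proj_comp_regular_epis base.left.target.comp_regular_epis_epi by blast

text \<open>
  The projection is the mate of the equation \<open>\<U>\<R> = R\<close>. This makes the next unit compatible with
  the structure maps, and it exhibits \<open>F\<pi>\<close> as the composite of \<open>F\<epsilon>\<close> with \<open>L'(\<U>\<eta>)\<close>, which gives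
  the pair of \<open>R'F_link_coequalizer\<close> its special form.
\<close>

lemma proj_eq_transpose:
  assumes [simp]: "X \<in> Obj \<C>"
  shows "\<epsilon> (omap \<L> X) \<cdot>\<^bsub>A\<^esub> amap L (amap \<U> (aunit S X)) = sproj S X"
proof -
  have "\<epsilon> (omap \<L> X) \<cdot>\<^bsub>A\<^esub> amap L (amap \<U> (aunit S X))
      = acounit S (omap \<L> X) \<cdot>\<^bsub>A\<^esub> sproj S (omap \<R> (omap \<L> X)) \<cdot>\<^bsub>A\<^esub> amap L (amap \<U> (aunit S X))"
    by (simp flip: counit_proj)
  also have "\<dots> = acounit S (omap \<L> X) \<cdot>\<^bsub>A\<^esub> amap \<L> (aunit S X) \<cdot>\<^bsub>A\<^esub> sproj S X"
    by (simp add: proj_nat)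
  also have "\<dots> = sproj S X"
    by (simp add: base.left.target.chain[OF stg.triangle_left])
  finally show ?thesis .
qed

lemma next_Obj_iff:
  "X \<in> Obj \<N> \<longleftrightarrow> (\<exists>Y b. X = Over_obj Y (Base_arr b) \<and> Y \<in> Obj \<C> \<and> b \<in> Arr B \<and>
    Dom B b = omap R (omap \<L> Y) \<and> Cod B b = omap \<U> Y)"
  by (auto simp: next_cat_def in_Hom_iff)

lemma next_Obj_simps [simp]:
  assumes "X \<in> Obj \<N>"
  shows "under X \<in> Obj \<C>" "the_arr (str X) \<in> Arr B"
    "Dom B (the_arr (str X)) = omap R (omap \<L> (under X))"
    "Cod B (the_arr (str X)) = omap \<U> (under X)"
  using assms by (auto simp: next_Obj_iff)

lemma next_Arr_iff:
  "f \<in> Arr \<N> \<longleftrightarrow> (\<exists>X g Y. f = Over_arr X g Y \<and> X \<in> Obj \<N> \<and> Y \<in> Obj \<N> \<and>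
    g \<in> Arr \<C> \<and> Dom \<C> g = under X \<and> Cod \<C> g = under Y \<and>
    amap \<U> g \<cdot>\<^bsub>B\<^esub> the_arr (str X) = the_arr (str Y) \<cdot>\<^bsub>B\<^esub> amap R (amap \<L> g))"
  by (simp add: next_cat_def over_cat_Arr_iff)

lemma next_simps [simp]:
  "Dom \<N> = src" "Cod \<N> = tgt" "Idn \<N> X = Over_arr X (Idn \<C> (under X)) X"
  "g \<cdot>\<^bsub>\<N>\<^esub> f = Over_arr (src f) (under_arr g \<cdot>\<^bsub>\<C>\<^esub> under_arr f) (tgt g)"
  by (simp_all add: next_cat_def)

lemma next_Arr_simps [simp]:
  assumes "f \<in> Arr \<N>"
  shows "src f \<in> Obj \<N>" "tgt f \<in> Obj \<N>" "under_arr f \<in> Arr \<C>"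
    "Dom \<C> (under_arr f) = under (src f)" "Cod \<C> (under_arr f) = under (tgt f)"
  using assms by (auto simp: next_Arr_iff)

lemma next_Arr_square:
  assumes "f \<in> Arr \<N>"
  shows "amap \<U> (under_arr f) \<cdot>\<^bsub>B\<^esub> the_arr (str (src f))
    = the_arr (str (tgt f)) \<cdot>\<^bsub>B\<^esub> amap R (amap \<L> (under_arr f))"
  using assms by (auto simp: next_Arr_iff)

lemma next_Arr_eqI:
  assumes "f \<in> Arr \<N>" "g \<in> Arr \<N>" "src f = src g" "tgt f = tgt g" "under_arr f = under_arr g"
  shows "f = g"
  using assms unfolding next_Arr_iff by auto

lemma category_next: "category \<N>"
  unfolding next_cat_def
proof (rule category_over_cat)
  let ?Os = "{Over_obj X (Base_arr b) |X b. X \<in> Obj \<C> \<and> b \<in> Hom B (omap R (omap \<L> X)) (omap \<U> X)}"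
  have Os: "X \<in> Obj \<N>" if "X \<in> ?Os" for X using that by (simp add: next_cat_def)
  fix X assume "X \<in> ?Os"
  then have X [simp]: "X \<in> Obj \<N>" by (rule Os)
  then show "under X \<in> Obj \<C>" by simp
  show "amap \<U> (Idn \<C> (under X)) \<cdot>\<^bsub>B\<^esub> the_arr (str X)
      = the_arr (str X) \<cdot>\<^bsub>B\<^esub> amap R (amap \<L> (Idn \<C> (under X)))" by simp
  fix Y f g Z assume Y: "Y \<in> ?Os" and Z: "Z \<in> ?Os"
    and [simp]: "f \<in> Arr \<C>" "g \<in> Arr \<C>" "Dom \<C> f = under X"
      "Cod \<C> f = under Y" "Dom \<C> g = under Y" "Cod \<C> g = under Z"
    and f: "amap \<U> f \<cdot>\<^bsub>B\<^esub> the_arr (str X) = the_arr (str Y) \<cdot>\<^bsub>B\<^esub> amap R (amap \<L> f)"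
    and g: "amap \<U> g \<cdot>\<^bsub>B\<^esub> the_arr (str Y) = the_arr (str Z) \<cdot>\<^bsub>B\<^esub> amap R (amap \<L> g)"
  have [simp]: "Y \<in> Obj \<N>" "Z \<in> Obj \<N>" using Os Y Z by blast+
  show "amap \<U> (g \<cdot>\<^bsub>\<C>\<^esub> f) \<cdot>\<^bsub>B\<^esub> the_arr (str X) = the_arr (str Z) \<cdot>\<^bsub>B\<^esub> amap R (amap \<L> (g \<cdot>\<^bsub>\<C>\<^esub> f))"
    by (simp add: f base.left.source.chain[OF g])
qed (rule stg.left.source.category_axioms)

lemma link_coequalizer:
  assumes [simp]: "X \<in> Obj \<N>"
  shows "is_coequalizer A (sproj S (under X) \<cdot>\<^bsub>A\<^esub> amap L (the_arr (str X)))
    (\<epsilon> (omap \<L> (under X))) (\<kappa> X)"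
proof -
  have "parallel A (sproj S (under X) \<cdot>\<^bsub>A\<^esub> amap L (the_arr (str X))) (\<epsilon> (omap \<L> (under X)))"
    by (simp add: parallel_def)
  then show ?thesis using choice by (simp add: coequalizer_choice_def link_def)
qed

lemma link_simps [simp]:
  assumes "X \<in> Obj \<N>"
  shows "\<kappa> X \<in> Arr A" "Dom A (\<kappa> X) = omap \<L> (under X)" "Cod A (\<kappa> X) = omap \<L>\<^sub>N X"
  using coequalizer_simps[OF link_coequalizer[OF assms]] assms by (simp_all add: next_L_def)

lemma link_eq:
  assumes [simp]: "X \<in> Obj \<N>"
  shows "\<kappa> X \<cdot>\<^bsub>A\<^esub> sproj S (under X) \<cdot>\<^bsub>A\<^esub> amap L (the_arr (str X)) = \<kappa> X \<cdot>\<^bsub>A\<^esub> \<epsilon> (omap \<L> (under X))"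
  using coequalizer_simps(8)[OF link_coequalizer[OF assms]] by simp

lemma link_epi: "X \<in> Obj \<N> \<Longrightarrow> epi_arr A (\<kappa> X)"
  using base.left.target.coequalizer_epi link_coequalizer by blast

lemma next_L_Obj [simp]: "X \<in> Obj \<N> \<Longrightarrow> omap \<L>\<^sub>N X \<in> Obj A"
  using base.left.target.Cod_Obj[of "\<kappa> X"] by simp

text \<open>
  The description that defines \<open>\<L>\<^sub>N f\<close> has a unique solution: the square satisfied by \<open>f\<close> and the
  naturality of the projection make \<open>\<kappa> \<circ> \<L> f\<close> coequalize the pair at the source of \<open>f\<close>.
\<close>

lemma next_L_amap:
  assumes f [simp]: "f \<in> Arr \<N>"
  shows "amap \<L>\<^sub>N f \<in> Arr A" "Dom A (amap \<L>\<^sub>N f) = omap \<L>\<^sub>N (src f)"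
    "Cod A (amap \<L>\<^sub>N f) = omap \<L>\<^sub>N (tgt f)"
    "amap \<L>\<^sub>N f \<cdot>\<^bsub>A\<^esub> \<kappa> (src f) = \<kappa> (tgt f) \<cdot>\<^bsub>A\<^esub> amap \<L> (under_arr f)"
proof -
  let ?X = "src f" and ?Y = "tgt f" and ?f = "under_arr f"
  let ?h = "\<kappa> ?Y \<cdot>\<^bsub>A\<^esub> amap \<L> ?f"
  have "?h \<cdot>\<^bsub>A\<^esub> sproj S (under ?X) \<cdot>\<^bsub>A\<^esub> amap L (the_arr (str ?X))
      = \<kappa> ?Y \<cdot>\<^bsub>A\<^esub> sproj S (under ?Y) \<cdot>\<^bsub>A\<^esub> amap L (amap \<U> ?f \<cdot>\<^bsub>B\<^esub> the_arr (str ?X))"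
    by (simp add: base.left.target.chain[OF proj_nat])
  also have "\<dots> = \<kappa> ?Y \<cdot>\<^bsub>A\<^esub> sproj S (under ?Y) \<cdot>\<^bsub>A\<^esub> amap L (the_arr (str ?Y)) \<cdot>\<^bsub>A\<^esub> amap L (amap R (amap \<L> ?f))"
    by (simp add: next_Arr_square)
  also have "\<dots> = (\<kappa> ?Y \<cdot>\<^bsub>A\<^esub> sproj S (under ?Y) \<cdot>\<^bsub>A\<^esub> amap L (the_arr (str ?Y))) \<cdot>\<^bsub>A\<^esub> amap L (amap R (amap \<L> ?f))"
    by simp
  also have "\<dots> = ?h \<cdot>\<^bsub>A\<^esub> \<epsilon> (omap \<L> (under ?X))"
    by (simp add: link_eq base.counit_nat)
  finally have eq: "?h \<cdot>\<^bsub>A\<^esub> sproj S (under ?X) \<cdot>\<^bsub>A\<^esub> amap L (the_arr (str ?X)) = ?h \<cdot>\<^bsub>A\<^esub> \<epsilon> (omap \<L> (under ?X))" .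
  obtain k where k: "k \<in> Arr A" "Dom A k = Cod A (\<kappa> ?X)" "Cod A k = Cod A ?h" "k \<cdot>\<^bsub>A\<^esub> \<kappa> ?X = ?h"
    by (rule coequalizer_factor[OF link_coequalizer[OF next_Arr_simps(1)[OF f]] _ _ eq]) simp_all
  have "\<exists>!g. g \<in> Hom A (Cod A (\<kappa> ?X)) (Cod A (\<kappa> ?Y)) \<and> g \<cdot>\<^bsub>A\<^esub> \<kappa> ?X = ?h"
  proof (rule ex1I[of _ k])
    fix g assume "g \<in> Hom A (Cod A (\<kappa> ?X)) (Cod A (\<kappa> ?Y)) \<and> g \<cdot>\<^bsub>A\<^esub> \<kappa> ?X = ?h"
    then show "g = k" using k by - (rule epi_cancel[OF _ link_epi[of ?X]], simp_all add: in_Hom_iff)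
  qed (use k in \<open>simp add: in_Hom_iff\<close>)
  then have "amap \<L>\<^sub>N f \<in> Hom A (Cod A (\<kappa> ?X)) (Cod A (\<kappa> ?Y)) \<and> amap \<L>\<^sub>N f \<cdot>\<^bsub>A\<^esub> \<kappa> ?X = ?h"
    unfolding next_L_def by simp (rule theI')
  then show "amap \<L>\<^sub>N f \<in> Arr A" "Dom A (amap \<L>\<^sub>N f) = omap \<L>\<^sub>N (src f)"
    "Cod A (amap \<L>\<^sub>N f) = omap \<L>\<^sub>N (tgt f)"
    "amap \<L>\<^sub>N f \<cdot>\<^bsub>A\<^esub> \<kappa> (src f) = \<kappa> (tgt f) \<cdot>\<^bsub>A\<^esub> amap \<L> (under_arr f)"
    by (simp_all add: in_Hom_iff)
qed

lemma next_L_functor: "cat_functor \<N> A \<L>\<^sub>N"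
proof -
  interpret N: category \<N> by (rule category_next)
  note [simp] = next_L_amap(1-3) and lk = next_L_amap(4)
  show ?thesis
  proof unfold_locales
    fix X assume X [simp]: "X \<in> Obj \<N>"
    then have [simp]: "Over_arr X (Idn \<C> (under X)) X \<in> Arr \<N>" using N.Idn_simps(1)[of X] by simp
    show "amap \<L>\<^sub>N (Idn \<N> X) = Idn A (omap \<L>\<^sub>N X)"
      by (rule epi_cancel[OF _ link_epi[OF X]])
        (use lk[of "Over_arr X (Idn \<C> (under X)) X"] in simp_all)
  next
    fix X Y Z f g assume f: "f \<in> Hom \<N> X Y" and g: "g \<in> Hom \<N> Y Z"
    then have [simp]: "f \<in> Arr \<N>" "g \<in> Arr \<N>" "tgt f = src g" by (auto simp: in_Hom_iff)
    have [simp]: "Over_arr (src f) (under_arr g \<cdot>\<^bsub>\<C>\<^esub> under_arr f) (tgt g) \<in> Arr \<N>"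
      using N.Comp_simps(1)[of f g] by simp
    have "(amap \<L>\<^sub>N g \<cdot>\<^bsub>A\<^esub> amap \<L>\<^sub>N f) \<cdot>\<^bsub>A\<^esub> \<kappa> (src f) = amap \<L>\<^sub>N g \<cdot>\<^bsub>A\<^esub> \<kappa> (src g) \<cdot>\<^bsub>A\<^esub> amap \<L> (under_arr f)"
      by (simp add: lk)
    also have "\<dots> = \<kappa> (tgt g) \<cdot>\<^bsub>A\<^esub> amap \<L> (under_arr g) \<cdot>\<^bsub>A\<^esub> amap \<L> (under_arr f)"
      by (simp add: base.left.target.chain[OF lk])
    also have "\<dots> = amap \<L>\<^sub>N (g \<cdot>\<^bsub>\<N>\<^esub> f) \<cdot>\<^bsub>A\<^esub> \<kappa> (src f)"
      using lk[of "Over_arr (src f) (under_arr g \<cdot>\<^bsub>\<C>\<^esub> under_arr f) (tgt g)"] by simp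
    finally have "amap \<L>\<^sub>N g \<cdot>\<^bsub>A\<^esub> amap \<L>\<^sub>N f = amap \<L>\<^sub>N (g \<cdot>\<^bsub>\<N>\<^esub> f)"
      by (rule epi_cancel[OF _ link_epi[of "src f"]]) simp_all
    then show "amap \<L>\<^sub>N (g \<cdot>\<^bsub>\<N>\<^esub> f) = amap \<L>\<^sub>N g \<cdot>\<^bsub>A\<^esub> amap \<L>\<^sub>N f" by (rule sym)
  qed (auto simp: in_Hom_iff)
qed

lemma next_R_omap [simp]: "omap \<R>\<^sub>N Y = Over_obj (omap \<R> Y) (Base_arr (amap R (acounit S Y)))"
  by (simp add: next_R_def)

lemma next_R_amap [simp]: "amap \<R>\<^sub>N f = Over_arr (omap \<R>\<^sub>N (Dom A f)) (amap \<R> f) (omap \<R>\<^sub>N (Cod A f))"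
  by (simp add: next_R_def)

lemma next_R_functor: "cat_functor A \<N> \<R>\<^sub>N"
proof -
  interpret N: category \<N> by (rule category_next)
  have o: "omap \<R>\<^sub>N Y \<in> Obj \<N>" if "Y \<in> Obj A" for Y
    using that by (simp add: next_Obj_iff)
  show ?thesis
  proof unfold_locales
    fix f X Y assume "f \<in> Hom A X Y"
    then have f [simp]: "f \<in> Arr A" and XY: "X = Dom A f" "Y = Cod A f" by (auto simp: in_Hom_iff)
    have "amap R f \<cdot>\<^bsub>B\<^esub> amap R (acounit S (Dom A f)) = amap R (acounit S (Cod A f)) \<cdot>\<^bsub>B\<^esub> amap R (amap \<L> (amap \<R> f))"
      using arg_cong[OF stg.counit_nat[OF f refl], of "amap R"] by simp
    then show "amap \<R>\<^sub>N f \<in> Hom \<N> (omap \<R>\<^sub>N X) (omap \<R>\<^sub>N Y)"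
      using o[of X] o[of Y] by (simp add: XY in_Hom_iff next_Arr_iff)
  qed (use o in \<open>auto simp: in_Hom_iff\<close>)
qed

abbreviation "\<S>\<^sub>N \<equiv> next_stage A B L R \<epsilon> q S"

text \<open>
  The new counit exists since \<open>acounit S Y\<close> coequalizes the pair at \<open>\<R>\<^sub>N Y\<close>: as it factors \<open>\<epsilon> Y\<close>
  through the projection, the first composite is \<open>\<epsilon> Y \<circ> LR(acounit S Y)\<close>, which equals the second
  by naturality of \<open>\<epsilon>\<close>.
\<close>

lemma next_counit:
  assumes Y [simp]: "Y \<in> Obj A"
  shows "acounit \<S>\<^sub>N Y \<in> Arr A" "Dom A (acounit \<S>\<^sub>N Y) = omap \<L>\<^sub>N (omap \<R>\<^sub>N Y)" "Cod A (acounit \<S>\<^sub>N Y) = Y"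
    "acounit \<S>\<^sub>N Y \<cdot>\<^bsub>A\<^esub> \<kappa> (omap \<R>\<^sub>N Y) = acounit S Y"
proof -
  interpret RN: cat_functor A \<N> \<R>\<^sub>N by (rule next_R_functor)
  define X where "X = omap \<R>\<^sub>N Y"
  have X [simp]: "X \<in> Obj \<N>" "under X = omap \<R> Y" "the_arr (str X) = amap R (acounit S Y)"
    using RN.omap_Obj[OF Y] by (simp_all add: X_def)
  have "acounit S Y \<cdot>\<^bsub>A\<^esub> sproj S (under X) \<cdot>\<^bsub>A\<^esub> amap L (the_arr (str X)) = acounit S Y \<cdot>\<^bsub>A\<^esub> \<epsilon> (omap \<L> (under X))"
    by (simp add: base.left.target.chain[OF counit_proj] base.counit_nat)
  then obtain k where k: "k \<in> Arr A" "Dom A k = Cod A (\<kappa> X)" "Cod A k = Cod A (acounit S Y)"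
    "k \<cdot>\<^bsub>A\<^esub> \<kappa> X = acounit S Y"
    by (rule coequalizer_factor[OF link_coequalizer[OF X(1)], rotated 2]) simp_all
  have "\<exists>!g. g \<in> Hom A (omap \<L>\<^sub>N X) Y \<and> g \<cdot>\<^bsub>A\<^esub> \<kappa> X = acounit S Y"
  proof (rule ex1I[of _ k])
    fix g assume "g \<in> Hom A (omap \<L>\<^sub>N X) Y \<and> g \<cdot>\<^bsub>A\<^esub> \<kappa> X = acounit S Y"
    then show "g = k" using k by - (rule epi_cancel[OF _ link_epi[of X]], simp_all add: in_Hom_iff)
  qed (use k in \<open>simp add: in_Hom_iff\<close>)
  then have "acounit \<S>\<^sub>N Y \<in> Hom A (omap \<L>\<^sub>N X) Y \<and> acounit \<S>\<^sub>N Y \<cdot>\<^bsub>A\<^esub> \<kappa> X = acounit S Y"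
    unfolding next_stage_def X_def by simp (rule theI')
  then show "acounit \<S>\<^sub>N Y \<in> Arr A" "Dom A (acounit \<S>\<^sub>N Y) = omap \<L>\<^sub>N (omap \<R>\<^sub>N Y)" "Cod A (acounit \<S>\<^sub>N Y) = Y"
    "acounit \<S>\<^sub>N Y \<cdot>\<^bsub>A\<^esub> \<kappa> (omap \<R>\<^sub>N Y) = acounit S Y" unfolding X_def
    by (simp_all add: in_Hom_iff)
qed

text \<open>
  The underlying arrow \<open>\<R>\<kappa> \<circ> \<eta>\<close> of the new unit is compatible with the structure maps because
  \<open>R\<kappa> \<circ> U\<eta> \<circ> b\<close> and \<open>R\<kappa>\<close> have as transposes the two sides of the equation imposed by \<open>\<kappa>\<close>.
\<close>

lemma next_unit:
  assumes X [simp]: "X \<in> Obj \<N>"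
  shows "aunit \<S>\<^sub>N X \<in> Arr \<N>" "src (aunit \<S>\<^sub>N X) = X" "tgt (aunit \<S>\<^sub>N X) = omap \<R>\<^sub>N (omap \<L>\<^sub>N X)"
    "under_arr (aunit \<S>\<^sub>N X) = amap \<R> (\<kappa> X) \<cdot>\<^bsub>\<C>\<^esub> aunit S (under X)"
proof -
  interpret RN: cat_functor A \<N> \<R>\<^sub>N by (rule next_R_functor)
  let ?u = "amap \<R> (\<kappa> X) \<cdot>\<^bsub>\<C>\<^esub> aunit S (under X)" and ?b = "the_arr (str X)"
  have tr: "amap \<U> ?u \<cdot>\<^bsub>B\<^esub> ?b = amap R (\<kappa> X)"
  proof (rule base.transpose_eqD[of _ _ "omap \<L>\<^sub>N X"])
    have "\<epsilon> (omap \<L>\<^sub>N X) \<cdot>\<^bsub>A\<^esub> amap L (amap \<U> ?u \<cdot>\<^bsub>B\<^esub> ?b)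
        = \<kappa> X \<cdot>\<^bsub>A\<^esub> (\<epsilon> (omap \<L> (under X)) \<cdot>\<^bsub>A\<^esub> amap L (amap \<U> (aunit S (under X)))) \<cdot>\<^bsub>A\<^esub> amap L ?b"
      by (simp add: base.counit_nat_chain)
    also have "\<dots> = \<kappa> X \<cdot>\<^bsub>A\<^esub> \<epsilon> (omap \<L> (under X))" unfolding proj_eq_transpose[OF next_Obj_simps(1)[OF X]]
      by (simp add: link_eq)
    also have "\<dots> = \<epsilon> (omap \<L>\<^sub>N X) \<cdot>\<^bsub>A\<^esub> amap L (amap R (\<kappa> X))"
      by (simp add: base.counit_nat)
    finally show "\<epsilon> (omap \<L>\<^sub>N X) \<cdot>\<^bsub>A\<^esub> amap L (amap \<U> ?u \<cdot>\<^bsub>B\<^esub> ?b) = \<epsilon> (omap \<L>\<^sub>N X) \<cdot>\<^bsub>A\<^esub> amap L (amap R (\<kappa> X))" .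
  qed simp_all
  have cu: "acounit S (omap \<L>\<^sub>N X) \<cdot>\<^bsub>A\<^esub> amap \<L> ?u = \<kappa> X"
    by (simp add: stg.counit_nat_chain stg.triangle_left)
  have o: "omap \<R>\<^sub>N (omap \<L>\<^sub>N X) \<in> Obj \<N>" by (rule RN.omap_Obj) simp
  have "Over_arr X ?u (omap \<R>\<^sub>N (omap \<L>\<^sub>N X)) \<in> Arr \<N>"
    using o tr arg_cong[OF cu, of "amap R"] by (simp add: next_Arr_iff)
  then show "aunit \<S>\<^sub>N X \<in> Arr \<N>" "src (aunit \<S>\<^sub>N X) = X" "tgt (aunit \<S>\<^sub>N X) = omap \<R>\<^sub>N (omap \<L>\<^sub>N X)"
    "under_arr (aunit \<S>\<^sub>N X) = ?u"
    by (simp_all add: next_stage_def)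
qed

lemma next_adjunction: "adjunction A \<N> \<L>\<^sub>N \<R>\<^sub>N (aunit \<S>\<^sub>N) (acounit \<S>\<^sub>N)"
proof -
  interpret N: category \<N> by (rule category_next)
  interpret LN: cat_functor \<N> A \<L>\<^sub>N by (rule next_L_functor)
  interpret RN: cat_functor A \<N> \<R>\<^sub>N by (rule next_R_functor)
  note [simp] = next_counit(1-3) next_unit next_L_amap(1-3) and lk = next_L_amap(4) and ck = next_counit(4)
  note [simp del] = next_R_omap next_R_amap and R_o = next_R_omap and R_a = next_R_amap
  have uR [simp]: "under (omap \<R>\<^sub>N Y) = omap \<R> Y" "under_arr (amap \<R>\<^sub>N f) = amap \<R> f" for Y f
    by (simp_all add: R_o R_a)
  have stR [simp]: "src (amap \<R>\<^sub>N f) = omap \<R>\<^sub>N (Dom A f)" "tgt (amap \<R>\<^sub>N f) = omap \<R>\<^sub>N (Cod A f)" for f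
    by (simp_all add: R_a)
  have RN_Arr [simp]: "amap \<R>\<^sub>N f \<in> Arr \<N>" if "f \<in> Arr A" for f using that by (rule RN.amap_simps)
  show ?thesis
  proof (intro adjunction.intro adjunction_axioms.intro nat_transI)
    fix f assume f [simp]: "f \<in> Arr \<N>"
    let ?X = "src f" and ?Y = "tgt f"
    have "amap \<R> (\<kappa> ?Y) \<cdot>\<^bsub>\<C>\<^esub> aunit S (under ?Y) \<cdot>\<^bsub>\<C>\<^esub> under_arr f
        = amap \<R> (\<kappa> ?Y \<cdot>\<^bsub>A\<^esub> amap \<L> (under_arr f)) \<cdot>\<^bsub>\<C>\<^esub> aunit S (under ?X)"
      by (simp add: stg.unit_nat)
    also have "\<dots> = amap \<R> (amap \<L>\<^sub>N f) \<cdot>\<^bsub>\<C>\<^esub> amap \<R> (\<kappa> ?X) \<cdot>\<^bsub>\<C>\<^esub> aunit S (under ?X)"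
      by (simp add: lk[symmetric])
    finally show "aunit \<S>\<^sub>N (Cod \<N> f) \<cdot>\<^bsub>\<N>\<^esub> amap fid f = amap (\<R>\<^sub>N \<circ>\<^sub>F \<L>\<^sub>N) f \<cdot>\<^bsub>\<N>\<^esub> aunit \<S>\<^sub>N (Dom \<N> f)"
      by simp
  next
    fix f assume f [simp]: "f \<in> Arr A"
    let ?X = "Dom A f" and ?Y = "Cod A f"
    have "(acounit \<S>\<^sub>N ?Y \<cdot>\<^bsub>A\<^esub> amap \<L>\<^sub>N (amap \<R>\<^sub>N f)) \<cdot>\<^bsub>A\<^esub> \<kappa> (omap \<R>\<^sub>N ?X)
        = acounit S ?Y \<cdot>\<^bsub>A\<^esub> amap \<L> (amap \<R> f)"
      using lk[of "amap \<R>\<^sub>N f"] by (simp add: base.left.target.chain[OF ck])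
    also have "\<dots> = (f \<cdot>\<^bsub>A\<^esub> acounit \<S>\<^sub>N ?X) \<cdot>\<^bsub>A\<^esub> \<kappa> (omap \<R>\<^sub>N ?X)"
      by (simp add: stg.counit_nat ck)
    finally have "acounit \<S>\<^sub>N ?Y \<cdot>\<^bsub>A\<^esub> amap \<L>\<^sub>N (amap \<R>\<^sub>N f) = f \<cdot>\<^bsub>A\<^esub> acounit \<S>\<^sub>N ?X"
      by (rule epi_cancel[OF _ link_epi]) simp_all
    then show "acounit \<S>\<^sub>N ?Y \<cdot>\<^bsub>A\<^esub> amap (\<L>\<^sub>N \<circ>\<^sub>F \<R>\<^sub>N) f = amap fid f \<cdot>\<^bsub>A\<^esub> acounit \<S>\<^sub>N ?X" by simp
  next
    fix X assume X [simp]: "X \<in> Obj \<N>"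
    have "(acounit \<S>\<^sub>N (omap \<L>\<^sub>N X) \<cdot>\<^bsub>A\<^esub> amap \<L>\<^sub>N (aunit \<S>\<^sub>N X)) \<cdot>\<^bsub>A\<^esub> \<kappa> X
        = acounit S (omap \<L>\<^sub>N X) \<cdot>\<^bsub>A\<^esub> amap \<L> (under_arr (aunit \<S>\<^sub>N X))"
      using lk[of "aunit \<S>\<^sub>N X"] by (simp add: base.left.target.chain[OF ck])
    also have "\<dots> = Idn A (omap \<L>\<^sub>N X) \<cdot>\<^bsub>A\<^esub> \<kappa> X"
      by (simp add: stg.counit_nat_chain stg.triangle_left)
    finally show "acounit \<S>\<^sub>N (omap \<L>\<^sub>N X) \<cdot>\<^bsub>A\<^esub> amap \<L>\<^sub>N (aunit \<S>\<^sub>N X) = Idn A (omap \<L>\<^sub>N X)"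
      by (rule epi_cancel[OF _ link_epi]) simp_all
  next
    fix Y assume Y [simp]: "Y \<in> Obj A"
    have "amap \<R> (acounit \<S>\<^sub>N Y) \<cdot>\<^bsub>\<C>\<^esub> amap \<R> (\<kappa> (omap \<R>\<^sub>N Y)) \<cdot>\<^bsub>\<C>\<^esub> aunit S (omap \<R> Y)
        = Idn \<C> (omap \<R> Y)"
      using arg_cong[OF ck[OF Y], of "amap \<R>"]
      by (simp add: stg.left.source.chain stg.triangle_right)
    then show "amap \<R>\<^sub>N (acounit \<S>\<^sub>N Y) \<cdot>\<^bsub>\<N>\<^esub> aunit \<S>\<^sub>N (omap \<R>\<^sub>N Y) = Idn \<N> (omap \<R>\<^sub>N Y)" by simp
  qed (simp_all add: in_Hom_iff LN.cat_functor_axioms RN.cat_functor_axioms cat_functor_fcomp[of _ A]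
      cat_functor_fcomp[of _ \<N>] cat_functor_fid N.category_axioms base.left.target.category_axioms)
qed

text \<open>
  Faithfulness of the forgetful functor is inherited because an arrow of \<open>\<N>\<close> is an arrow of
  \<open>\<C>\<close> together with its source and target.
\<close>

lemma next_decomposition_stage: "decomposition_stage A B L R \<eta> \<epsilon> q \<S>\<^sub>N"
proof -
  interpret N: adjunction A \<N> \<L>\<^sub>N \<R>\<^sub>N "aunit \<S>\<^sub>N" "acounit \<S>\<^sub>N" by (rule next_adjunction)
  have sel: "acat \<S>\<^sub>N = \<N>" "aL \<S>\<^sub>N = \<L>\<^sub>N" "aR \<S>\<^sub>N = \<R>\<^sub>N" "sU \<S>\<^sub>N = \<U> \<circ>\<^sub>F forget"
      "sproj \<S>\<^sub>N X = \<kappa> X \<cdot>\<^bsub>A\<^esub> sproj S (under X)" for X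
    by (simp_all add: next_stage_def)
  have forget [simp]: "omap forget X = under X" "amap forget f = under_arr f"
    for X :: "('o, 'm) tobj" and f :: "('o, 'm) tarr"
    by (simp_all add: forget_def)
  have fu: "cat_functor \<N> \<C> forget"
    by unfold_locales (auto simp: in_Hom_iff)
  have U: "cat_functor \<N> B (\<U> \<circ>\<^sub>F forget)"
    by (rule cat_functor_fcomp[OF fu U.cat_functor_axioms])
  have ax: "decomposition_stage_axioms A R \<epsilon> q \<S>\<^sub>N"
    unfolding decomposition_stage_axioms_def sel
  proof (intro conjI allI impI)
    fix f g assume eq: "amap (\<U> \<circ>\<^sub>F forget) f = amap (\<U> \<circ>\<^sub>F forget) g"
      and [simp]: "f \<in> Arr \<N>" "g \<in> Arr \<N>" and d: "Dom \<N> f = Dom \<N> g" "Cod \<N> f = Cod \<N> g"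
    have "under_arr f = under_arr g"
      by (rule U_faithful) (use eq d in simp_all)
    then show "f = g" using d by - (rule next_Arr_eqI, simp_all)
  next
    fix X assume X [simp]: "X \<in> Obj \<N>"
    show "comp_regular_epis A (\<kappa> X \<cdot>\<^bsub>A\<^esub> sproj S (under X))"
    proof (rule comp_regular_epis.compose)
      show "regular_epi A (\<kappa> X)" using link_coequalizer[OF X] by (auto simp: regular_epi_def)
    qed (simp_all add: proj_comp_regular_epis)
  next
    fix Y assume Y [simp]: "Y \<in> Obj A"
    have "omap \<R>\<^sub>N Y \<in> Obj \<N>" by (rule N.right.omap_Obj) simp
    then show "acounit \<S>\<^sub>N Y \<cdot>\<^bsub>A\<^esub> \<kappa> (omap \<R>\<^sub>N Y) \<cdot>\<^bsub>A\<^esub> sproj S (under (omap \<R>\<^sub>N Y)) = \<epsilon> Y"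
      using base.left.target.chain[OF next_counit(4)[OF Y], of "sproj S (omap \<R> Y)"]
        next_counit(1-3)[OF Y] counit_proj[OF Y] by simp
  qed (simp_all add: choice)
  have nat: "nat_trans \<N> A (L \<circ>\<^sub>F \<U> \<circ>\<^sub>F forget) \<L>\<^sub>N (sproj \<S>\<^sub>N)"
  proof (rule nat_transI)
    fix f assume f [simp]: "f \<in> Arr \<N>"
    have "(\<kappa> (tgt f) \<cdot>\<^bsub>A\<^esub> sproj S (under (tgt f))) \<cdot>\<^bsub>A\<^esub> amap L (amap \<U> (under_arr f))
        = (\<kappa> (tgt f) \<cdot>\<^bsub>A\<^esub> amap \<L> (under_arr f)) \<cdot>\<^bsub>A\<^esub> sproj S (under (src f))"
      by (simp add: proj_nat)
    also have "\<dots> = amap \<L>\<^sub>N f \<cdot>\<^bsub>A\<^esub> \<kappa> (src f) \<cdot>\<^bsub>A\<^esub> sproj S (under (src f))"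
      unfolding next_L_amap(4)[OF f, symmetric] by (simp add: next_L_amap(1-3))
    finally show "sproj \<S>\<^sub>N (Cod \<N> f) \<cdot>\<^bsub>A\<^esub> amap (L \<circ>\<^sub>F \<U> \<circ>\<^sub>F forget) f
        = amap \<L>\<^sub>N f \<cdot>\<^bsub>A\<^esub> sproj \<S>\<^sub>N (Dom \<N> f)" by (simp add: sel)
  qed (simp_all add: in_Hom_iff sel N.left.cat_functor_axioms cat_functor_fcomp[OF U base.left.cat_functor_axioms])
  show ?thesis
    using ax next_adjunction base.adjunction_axioms U nat
    by (simp add: decomposition_stage_def sel(1-4))
qed

text \<open>
  Since \<open>\<R>\<^sub>N Y\<close> carries the structure \<open>R(\<epsilon> Y)\<close>, cancelling the epimorphic projection from the
  pair that defines \<open>\<kappa> (\<R>\<^sub>N Y)\<close> leaves \<open>\<L>\<R>\<epsilon>\<close> and \<open>\<epsilon>\<L>\<R>\<close>, where \<open>\<epsilon>\<close> is now the counit of the stage.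
\<close>

lemma next_comonad_derived:
  "derived_from A (\<L> \<circ>\<^sub>F \<R>) (acounit S) (aL \<S>\<^sub>N \<circ>\<^sub>F aR \<S>\<^sub>N) (acounit \<S>\<^sub>N)"
proof -
  interpret N: adjunction A \<N> \<L>\<^sub>N \<R>\<^sub>N "aunit \<S>\<^sub>N" "acounit \<S>\<^sub>N" by (rule next_adjunction)
  note [simp del] = next_R_omap next_R_amap and R_o = next_R_omap and R_a = next_R_amap
  have uR [simp]: "under (omap \<R>\<^sub>N Y) = omap \<R> Y" "under_arr (amap \<R>\<^sub>N f) = amap \<R> f"
      "the_arr (str (omap \<R>\<^sub>N Y)) = amap R (acounit S Y)" for Y f
    by (simp_all add: R_o R_a)
  have stR [simp]: "src (amap \<R>\<^sub>N f) = omap \<R>\<^sub>N (Dom A f)" "tgt (amap \<R>\<^sub>N f) = omap \<R>\<^sub>N (Cod A f)" for f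
    by (simp_all add: R_a)
  let ?p = "\<lambda>Y. \<kappa> (omap \<R>\<^sub>N Y)"
  have nat: "nat_trans A A (\<L> \<circ>\<^sub>F \<R>) (\<L>\<^sub>N \<circ>\<^sub>F \<R>\<^sub>N) ?p"
  proof (rule nat_transI)
    fix f assume f [simp]: "f \<in> Arr A"
    show "?p (Cod A f) \<cdot>\<^bsub>A\<^esub> amap (\<L> \<circ>\<^sub>F \<R>) f = amap (\<L>\<^sub>N \<circ>\<^sub>F \<R>\<^sub>N) f \<cdot>\<^bsub>A\<^esub> ?p (Dom A f)"
      using next_L_amap(4)[of "amap \<R>\<^sub>N f"] by simp
  qed (simp_all add: in_Hom_iff N.counit.F.cat_functor_axioms stg.counit.F.cat_functor_axioms)
  have "is_coequalizer A (amap \<L> (amap \<R> (acounit S Y))) (acounit S (omap \<L> (omap \<R> Y))) (?p Y)"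
    if Y [simp]: "Y \<in> Obj A" for Y
  proof -
    let ?pi = "sproj S (omap \<R> (omap \<L> (omap \<R> Y)))"
    let ?f = "amap \<L> (amap \<R> (acounit S Y))" and ?g = "acounit S (omap \<L> (omap \<R> Y))"
    have f: "?f \<cdot>\<^bsub>A\<^esub> ?pi = sproj S (omap \<R> Y) \<cdot>\<^bsub>A\<^esub> amap L (amap R (acounit S Y))"
      using proj_nat[of "amap \<R> (acounit S Y)" "omap \<R> Y"] by simp
    have g: "?g \<cdot>\<^bsub>A\<^esub> ?pi = \<epsilon> (omap \<L> (omap \<R> Y))" by (simp add: counit_proj)
    have c: "is_coequalizer A (?f \<cdot>\<^bsub>A\<^esub> ?pi) (?g \<cdot>\<^bsub>A\<^esub> ?pi) (?p Y)"
      using link_coequalizer[of "omap \<R>\<^sub>N Y"] by (simp add: f g)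
    have epi: "epi_arr A ?pi" by (rule proj_epi) simp
    have canc: "h \<cdot>\<^bsub>A\<^esub> ?f = h \<cdot>\<^bsub>A\<^esub> ?g \<longleftrightarrow> h \<cdot>\<^bsub>A\<^esub> ?f \<cdot>\<^bsub>A\<^esub> ?pi = h \<cdot>\<^bsub>A\<^esub> ?g \<cdot>\<^bsub>A\<^esub> ?pi"
      if h: "h \<in> Arr A" "Dom A h = omap \<L> (omap \<R> Y)" for h
    proof
      assume "h \<cdot>\<^bsub>A\<^esub> ?f \<cdot>\<^bsub>A\<^esub> ?pi = h \<cdot>\<^bsub>A\<^esub> ?g \<cdot>\<^bsub>A\<^esub> ?pi"
      then have "(h \<cdot>\<^bsub>A\<^esub> ?f) \<cdot>\<^bsub>A\<^esub> ?pi = (h \<cdot>\<^bsub>A\<^esub> ?g) \<cdot>\<^bsub>A\<^esub> ?pi" using h by simp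
      then show "h \<cdot>\<^bsub>A\<^esub> ?f = h \<cdot>\<^bsub>A\<^esub> ?g" by (rule epi_cancel[OF _ epi]) (use h in simp_all)
    next
      assume "h \<cdot>\<^bsub>A\<^esub> ?f = h \<cdot>\<^bsub>A\<^esub> ?g"
      then have "(h \<cdot>\<^bsub>A\<^esub> ?f) \<cdot>\<^bsub>A\<^esub> ?pi = (h \<cdot>\<^bsub>A\<^esub> ?g) \<cdot>\<^bsub>A\<^esub> ?pi" by (rule arg_cong)
      then show "h \<cdot>\<^bsub>A\<^esub> ?f \<cdot>\<^bsub>A\<^esub> ?pi = h \<cdot>\<^bsub>A\<^esub> ?g \<cdot>\<^bsub>A\<^esub> ?pi" using h by simp
    qed
    show ?thesis using c canc unfolding is_coequalizer_def parallel_def by simp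
  qed
  then have "derived_from A (\<L> \<circ>\<^sub>F \<R>) (acounit S) (\<L>\<^sub>N \<circ>\<^sub>F \<R>\<^sub>N) (acounit \<S>\<^sub>N)"
    using nat next_counit(4) N.counit.nat_trans_axioms by (auto simp: derived_from_def)
  moreover have "aL \<S>\<^sub>N = \<L>\<^sub>N" "aR \<S>\<^sub>N = \<R>\<^sub>N" by (simp_all add: next_stage_def)
  ultimately show ?thesis by simp
qed

end

lemma lift_category:
  assumes "category B"
  shows "category (lift_cat B)"
proof -
  interpret category B by fact
  show ?thesis by unfold_locales (auto simp: lift_cat_def in_Hom_iff)
qed

lemma decomposition_stage_0:
  assumes adj: "adjunction A B L R \<eta> \<epsilon>" and q: "coequalizer_choice A q"
  shows "decomposition_stage A B L R \<eta> \<epsilon> q (decomposition A B L R \<eta> \<epsilon> q 0)"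
proof -
  interpret adjunction A B L R \<eta> \<epsilon> by fact
  interpret l: category "lift_cat B" by (rule lift_category) (rule left.source.category_axioms)
  define S where "S = decomposition A B L R \<eta> \<epsilon> q 0"
  have sel: "acat S = lift_cat B" "aL S = L \<circ>\<^sub>F unlift" "aR S = lift \<circ>\<^sub>F R"
    "aunit S = (\<lambda>X. Base_arr (\<eta> (the_obj X)))" "acounit S = \<epsilon>" "sU S = unlift"
    "sproj S = (\<lambda>X. Idn A (omap L (the_obj X)))"
    by (simp_all add: S_def adj.extend_def lift_adj_def)
  have cat: "Obj (lift_cat B) = Base_obj ` Obj B" "Arr (lift_cat B) = Base_arr ` Arr B"
    "Dom (lift_cat B) f = Base_obj (Dom B (the_arr f))"
    "Cod (lift_cat B) f = Base_obj (Cod B (the_arr f))"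
    "Idn (lift_cat B) X = Base_arr (Idn B (the_obj X))"
    "g \<cdot>\<^bsub>lift_cat B\<^esub> f = Base_arr (the_arr g \<cdot>\<^bsub>B\<^esub> the_arr f)" for f g X
    by (simp_all add: lift_cat_def)
  have fu [simp]: "omap lift = Base_obj" "amap lift = Base_arr" "omap unlift = the_obj" "amap unlift = the_arr"
    by (simp_all add: lift_def unlift_def)
  have unlift: "cat_functor (lift_cat B) B unlift" and lift: "cat_functor B (lift_cat B) lift"
    by unfold_locales (auto simp: cat in_Hom_iff)
  note fs = unlift lift cat_functor_fcomp[OF unlift left.cat_functor_axioms]
    cat_functor_fcomp[OF right.cat_functor_axioms lift]
  have "adjunction A (lift_cat B) (L \<circ>\<^sub>F unlift) (lift \<circ>\<^sub>F R) (\<lambda>X. Base_arr (\<eta> (the_obj X))) \<epsilon>"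
    by (intro adjunction.intro adjunction_axioms.intro nat_transI)
      (auto simp: cat in_Hom_iff unit_nat counit_nat triangle_left triangle_right
        intro: fs cat_functor_fcomp[OF fs(3) fs(4)] cat_functor_fcomp[OF fs(4) fs(3)]
          cat_functor_fid l.category_axioms left.target.category_axioms)
  moreover have "nat_trans (lift_cat B) A (L \<circ>\<^sub>F unlift) (L \<circ>\<^sub>F unlift) (\<lambda>X. Idn A (omap L (the_obj X)))"
    by (rule nat_transI) (use fs(3) in \<open>auto simp: cat in_Hom_iff\<close>)
  moreover have "decomposition_stage_axioms A R \<epsilon> q S"
    by unfold_locales (auto simp: sel cat q
        intro!: comp_regular_epis.single left.target.Idn_regular_epi)
  ultimately have "decomposition_stage A B L R \<eta> \<epsilon> q S" using adj unlift
    by (simp add: decomposition_stage_def sel)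
  then show ?thesis by (simp only: S_def)
qed

lemma decomposition_stage_n:
  assumes "adjunction A B L R \<eta> \<epsilon>" "coequalizer_choice A q"
  shows "decomposition_stage A B L R \<eta> \<epsilon> q (decomposition A B L R \<eta> \<epsilon> q n)"
  using assms
  by (induction n)
    (simp_all only: decomposition_stage_0 decomposition.simps(2) decomposition_stage.next_decomposition_stage)


section \<open>Adjunctions over an augmented monad\<close>

locale augmented_setting =
  base: adjunction A B L R \<eta> \<epsilon> +
  prime: adjunction A' B L' R' \<eta>' \<epsilon>' +
  F: cat_functor A A' F +
  aug: augmentation B "R' \<circ>\<^sub>F L'" "\<lambda>X. amap R' (\<epsilon>' (omap L' X))" \<eta>' \<gamma>'
  for A :: "('a, 'k) cat" and A' :: "('c, 'l) cat" and B :: "('o, 'm) cat"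
    and L :: "('o, 'm, 'a, 'k) func" and R :: "('a, 'k, 'o, 'm) func"
    and \<eta> :: "'o \<Rightarrow> 'm" and \<epsilon> :: "'a \<Rightarrow> 'k"
    and L' :: "('o, 'm, 'c, 'l) func" and R' :: "('c, 'l, 'o, 'm) func"
    and \<eta>' :: "'o \<Rightarrow> 'm" and \<epsilon>' :: "'c \<Rightarrow> 'l"
    and F :: "('a, 'k, 'c, 'l) func" and q :: "'k \<Rightarrow> 'k \<Rightarrow> 'k" and \<gamma>' :: "'o \<Rightarrow> 'm" +
  assumes FL: "functor_eq B (F \<circ>\<^sub>F L) L'"
    and choice: "coequalizer_choice A q"
    and F_coequalizer: "parallel A f g \<Longrightarrow> preserves_coequalizer A' F A f g"
    and R'_coequalizer: "\<lbrakk>comp_regular_epis A' p; idempotent_arr A' e; Cod A' e = Dom A' p\<rbrakk>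
      \<Longrightarrow> preserves_coequalizer B R' A' (p \<cdot>\<^bsub>A'\<^esub> e) p"
    and R'_regular_epi: "regular_epi A' p \<Longrightarrow> regular_epi B (amap R' p)"
begin

lemma FL_simps [simp]:
  "X \<in> Obj B \<Longrightarrow> omap F (omap L X) = omap L' X"
  "f \<in> Arr B \<Longrightarrow> amap F (amap L f) = amap L' f"
  using FL by (simp_all add: functor_eq_def)

lemmas aug_simps [simp] = aug.component_simps[simplified]
lemmas aug_unit [simp] = aug.aug_unit
lemmas aug_mult = aug.aug_mult[simplified]

abbreviation "\<zeta> \<equiv> \<xi> B R \<epsilon> R' \<eta>' F"

lemma \<xi>_simps [simp]:
  assumes "Y \<in> Obj A"
  shows "\<zeta> Y \<in> Arr B" "Dom B (\<zeta> Y) = omap R Y" "Cod B (\<zeta> Y) = omap R' (omap F Y)"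
  using assms by (simp_all add: \<xi>_def)

lemma \<xi>_nat:
  assumes f [simp]: "f \<in> Arr A"
  shows "\<zeta> (Cod A f) \<cdot>\<^bsub>B\<^esub> amap R f = amap R' (amap F f) \<cdot>\<^bsub>B\<^esub> \<zeta> (Dom A f)"
proof -
  have "amap F (\<epsilon> (Cod A f)) \<cdot>\<^bsub>A'\<^esub> amap L' (amap R f) = amap F f \<cdot>\<^bsub>A'\<^esub> amap F (\<epsilon> (Dom A f))"
    using arg_cong[OF base.counit_nat[OF f refl], of "amap F"] by simp
  then have "amap R' (amap F (\<epsilon> (Cod A f))) \<cdot>\<^bsub>B\<^esub> amap R' (amap L' (amap R f))
    = amap R' (amap F f \<cdot>\<^bsub>A'\<^esub> amap F (\<epsilon> (Dom A f)))"
    by (simp flip: prime.right.amap_Comp')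
  then show ?thesis
    by (simp add: \<xi>_def prime.unit_nat base.left.source.chain[of "amap R' (amap F (\<epsilon> (Cod A f)))"])
qed

text \<open>The formula for \<open>\<xi>\<close> is that of the transpose of \<open>F\<epsilon> : L'R = FLR \<rightarrow> F\<close> along \<open>(L', R')\<close>.\<close>

lemma \<xi>_transpose:
  assumes [simp]: "Y \<in> Obj A"
  shows "\<epsilon>' (omap F Y) \<cdot>\<^bsub>A'\<^esub> amap L' (\<zeta> Y) = amap F (\<epsilon> Y)"
  by (simp add: \<xi>_def prime.counit_nat_chain prime.triangle_left)

lemma F_is_coequalizer: "is_coequalizer A f g p \<Longrightarrow> is_coequalizer A' (amap F f) (amap F g) (amap F p)"
  using F_coequalizer[of f g] coequalizer_simps(1)[of A f g p] by (auto simp: preserves_coequalizer_def)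

lemma F_regular_epi: "regular_epi A p \<Longrightarrow> regular_epi A' (amap F p)"
  unfolding regular_epi_def using F_is_coequalizer by blast

lemma L'_regular_epi: "regular_epi B p \<Longrightarrow> regular_epi A' (amap L' p)"
  unfolding regular_epi_def using prime.left_adjoint_preserves_coequalizer by blast

lemma F_comp_regular_epis: "comp_regular_epis A p \<Longrightarrow> comp_regular_epis A' (amap F p)"
  by (rule F.comp_regular_epis_amap[OF F_regular_epi])

lemma R'_comp_regular_epis: "comp_regular_epis A' p \<Longrightarrow> comp_regular_epis B (amap R' p)"
  by (rule prime.right.comp_regular_epis_amap[OF R'_regular_epi])

lemma L'_comp_regular_epis: "comp_regular_epis B p \<Longrightarrow> comp_regular_epis A' (amap L' p)"
  by (rule prime.left.comp_regular_epis_amap[OF L'_regular_epi])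

end

text \<open>
  The functor \<open>G\<close> and the transformation \<open>g\<close> stand for \<open>\<Gamma>\<close> and \<open>\<gamma>'\<close> of one stage. The last
  assumption is a criterion for the composite of \<open>a : R'F Y \<rightarrow> X\<close> with \<open>\<xi> Y\<close> to underlie an arrow
  of the stage. It is phrased without reference to the stage, so that it can be propagated.
\<close>

locale rank_stage =
  augmented_setting A A' B L R \<eta> \<epsilon> L' R' \<eta>' \<epsilon>' F q \<gamma>' +
  decomposition_stage A B L R \<eta> \<epsilon> q S +
  G: cat_functor B "acat S" G
  for A :: "('a, 'k) cat" and A' :: "('c, 'l) cat" and B :: "('o, 'm) cat"
    and L :: "('o, 'm, 'a, 'k) func" and R :: "('a, 'k, 'o, 'm) func"
    and \<eta> :: "'o \<Rightarrow> 'm" and \<epsilon> :: "'a \<Rightarrow> 'k"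
    and L' :: "('o, 'm, 'c, 'l) func" and R' :: "('c, 'l, 'o, 'm) func"
    and \<eta>' :: "'o \<Rightarrow> 'm" and \<epsilon>' :: "'c \<Rightarrow> 'l"
    and F :: "('a, 'k, 'c, 'l) func" and q :: "'k \<Rightarrow> 'k \<Rightarrow> 'k" and \<gamma>' :: "'o \<Rightarrow> 'm"
    and S :: "('o, 'm, 'a, 'k) stage" and G :: "('o, 'm, ('o, 'm) tobj, ('o, 'm) tarr) func"
    and g :: "'o \<Rightarrow> 'm" +
  assumes UG_omap [simp]: "X \<in> Obj B \<Longrightarrow> omap (sU S) (omap G X) = X"
    and UG_amap [simp]: "f \<in> Arr B \<Longrightarrow> amap (sU S) (amap G f) = f"
    and g_simps [simp]: "X \<in> Obj B \<Longrightarrow> g X \<in> Arr B"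
      "X \<in> Obj B \<Longrightarrow> Dom B (g X) = omap R' (omap F (omap (aL S) (omap G X)))"
      "X \<in> Obj B \<Longrightarrow> Cod B (g X) = X"
    and g_nat: "f \<in> Arr B \<Longrightarrow> g (Cod B f) \<cdot>\<^bsub>B\<^esub> amap R' (amap F (amap (aL S) (amap G f)))
      = f \<cdot>\<^bsub>B\<^esub> g (Dom B f)"
    and g_proj: "X \<in> Obj B \<Longrightarrow> g X \<cdot>\<^bsub>B\<^esub> amap R' (amap F (sproj S (omap G X))) = \<gamma>' X"
    and g_unit: "X \<in> Obj B \<Longrightarrow> g X \<cdot>\<^bsub>B\<^esub> \<xi> B R \<epsilon> R' \<eta>' F (omap (aL S) (omap G X))
      \<cdot>\<^bsub>B\<^esub> amap (sU S) (aunit S (omap G X)) = Idn B X"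
    and lifting: "\<lbrakk>X \<in> Obj B; Y \<in> Obj A; a \<in> Hom B (omap R' (omap F Y)) X;
      \<gamma>' X \<cdot>\<^bsub>B\<^esub> amap R' (amap L' (a \<cdot>\<^bsub>B\<^esub> \<xi> B R \<epsilon> R' \<eta>' F Y)) = a \<cdot>\<^bsub>B\<^esub> amap R' (amap F (\<epsilon> Y))\<rbrakk>
      \<Longrightarrow> \<exists>h\<in>Hom (acat S) (omap (aR S) Y) (omap G X). amap (sU S) h = a \<cdot>\<^bsub>B\<^esub> \<xi> B R \<epsilon> R' \<eta>' F Y"
begin

abbreviation "\<S> X \<equiv> omap \<L> (omap G X)"
abbreviation "\<gamma> X \<equiv> g X \<cdot>\<^bsub>B\<^esub> \<zeta> (\<S> X)"

text \<open>The multiplicativity of \<open>\<gamma>'\<close> descends along the epimorphism \<open>R'L'R'F\<pi>\<close>.\<close>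

lemma g_mult:
  assumes X [simp]: "X \<in> Obj B"
  shows "\<gamma>' X \<cdot>\<^bsub>B\<^esub> amap R' (amap L' (g X)) = g X \<cdot>\<^bsub>B\<^esub> amap R' (\<epsilon>' (omap F (\<S> X)))"
proof -
  define P where "P = amap F (sproj S (omap G X))"
  have P [simp]: "P \<in> Arr A'" "Dom A' P = omap L' X" "Cod A' P = omap F (\<S> X)" by (simp_all add: P_def)
  have gP: "g X \<cdot>\<^bsub>B\<^esub> amap R' P = \<gamma>' X" by (simp add: P_def g_proj)
  have reg: "comp_regular_epis B (amap R' (amap L' (amap R' P)))"
    unfolding P_def
    by (intro R'_comp_regular_epis L'_comp_regular_epis F_comp_regular_epis proj_comp_regular_epis) simp
  have "(\<gamma>' X \<cdot>\<^bsub>B\<^esub> amap R' (amap L' (g X))) \<cdot>\<^bsub>B\<^esub> amap R' (amap L' (amap R' P))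
      = \<gamma>' X \<cdot>\<^bsub>B\<^esub> amap R' (amap L' (\<gamma>' X))"
    by (simp flip: gP)
  also have "\<dots> = (g X \<cdot>\<^bsub>B\<^esub> amap R' P) \<cdot>\<^bsub>B\<^esub> amap R' (\<epsilon>' (omap L' X))" by (simp add: aug_mult gP)
  also have "\<dots> = g X \<cdot>\<^bsub>B\<^esub> amap R' (P \<cdot>\<^bsub>A'\<^esub> \<epsilon>' (omap L' X))" by simp
  also have "P \<cdot>\<^bsub>A'\<^esub> \<epsilon>' (omap L' X) = \<epsilon>' (omap F (\<S> X)) \<cdot>\<^bsub>A'\<^esub> amap L' (amap R' P)"
    by (simp add: prime.counit_nat)
  also have "g X \<cdot>\<^bsub>B\<^esub> amap R' (\<epsilon>' (omap F (\<S> X)) \<cdot>\<^bsub>A'\<^esub> amap L' (amap R' P))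
      = (g X \<cdot>\<^bsub>B\<^esub> amap R' (\<epsilon>' (omap F (\<S> X)))) \<cdot>\<^bsub>B\<^esub> amap R' (amap L' (amap R' P))" by simp
  finally show ?thesis
    by (rule epi_cancel[OF _ base.left.source.comp_regular_epis_epi[OF reg]]) simp_all
qed

text \<open>\<open>g X\<close> meets the lifting criterion: compose \<open>g_mult\<close> with \<open>R'L'\<xi>\<close> and apply \<open>\<xi>_transpose\<close>.\<close>

lemma \<gamma>_criterion:
  assumes X [simp]: "X \<in> Obj B"
  shows "\<gamma>' X \<cdot>\<^bsub>B\<^esub> amap R' (amap L' (\<gamma> X)) = g X \<cdot>\<^bsub>B\<^esub> amap R' (amap F (\<epsilon> (\<S> X)))"
proof -
  have "\<gamma>' X \<cdot>\<^bsub>B\<^esub> amap R' (amap L' (\<gamma> X))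
      = (\<gamma>' X \<cdot>\<^bsub>B\<^esub> amap R' (amap L' (g X))) \<cdot>\<^bsub>B\<^esub> amap R' (amap L' (\<zeta> (\<S> X)))" by simp
  also have "\<dots> = g X \<cdot>\<^bsub>B\<^esub> amap R' (\<epsilon>' (omap F (\<S> X)) \<cdot>\<^bsub>A'\<^esub> amap L' (\<zeta> (\<S> X)))"
    unfolding g_mult[OF X] by simp
  finally show ?thesis by (simp add: \<xi>_transpose)
qed

lemma \<gamma>_lift:
  assumes X: "X \<in> Obj B"
  obtains h where "h \<in> Arr \<C>" "Dom \<C> h = omap \<R> (\<S> X)" "Cod \<C> h = omap G X" "amap \<U> h = \<gamma> X"
  using lifting[of X "\<S> X" "g X"] \<gamma>_criterion[OF X] X by (auto simp: in_Hom_iff)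

abbreviation "\<Gamma>\<^sub>N \<equiv> next_\<Gamma> B R \<epsilon> R' \<eta>' F S G g"
abbreviation "\<gamma>'\<^sub>N \<equiv> next_\<gamma>' A B L R \<epsilon> q R' \<eta>' F S G g"

lemma next_\<Gamma>_omap: "omap \<Gamma>\<^sub>N X = Over_obj (omap G X) (Base_arr (\<gamma> X))"
  by (simp add: next_\<Gamma>_def)

lemma next_\<Gamma>_under [simp]: "under (omap \<Gamma>\<^sub>N X) = omap G X" "the_arr (str (omap \<Gamma>\<^sub>N X)) = \<gamma> X"
  by (simp_all add: next_\<Gamma>_def)

lemma next_\<Gamma>_amap: "amap \<Gamma>\<^sub>N f = Over_arr (omap \<Gamma>\<^sub>N (Dom B f)) (amap G f) (omap \<Gamma>\<^sub>N (Cod B f))"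
  by (simp add: next_\<Gamma>_def)

lemma next_\<Gamma>_src_tgt [simp]:
  "src (amap \<Gamma>\<^sub>N f) = omap \<Gamma>\<^sub>N (Dom B f)" "tgt (amap \<Gamma>\<^sub>N f) = omap \<Gamma>\<^sub>N (Cod B f)"
  by (simp_all add: next_\<Gamma>_amap)

lemma next_\<Gamma>_Obj [simp]: "X \<in> Obj B \<Longrightarrow> omap \<Gamma>\<^sub>N X \<in> Obj \<N>"
  by (simp add: next_Obj_iff next_\<Gamma>_omap)

text \<open>
  The lift \<open>h\<close> of \<open>\<gamma> X\<close> is a retraction of the unit at \<open>G X\<close>, so \<open>\<L> h\<close> is the counit. Hence the
  two arrows whose coequalizer is the link at \<open>(G X, \<gamma> X)\<close> are equal.
\<close>

lemma link_iso_if_idempotent: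
  assumes idem: "\<And>Y. Y \<in> Obj A \<Longrightarrow> amap \<L> (amap \<R> (acounit S Y)) = acounit S (omap \<L> (omap \<R> Y))"
    and X [simp]: "X \<in> Obj B"
  shows "iso_arr A (\<kappa> (omap \<Gamma>\<^sub>N X))"
proof -
  obtain h where h [simp]: "h \<in> Arr \<C>" "Dom \<C> h = omap \<R> (\<S> X)" "Cod \<C> h = omap G X"
    and Uh: "amap \<U> h = \<gamma> X"
    by (rule \<gamma>_lift[OF X])
  have "h \<cdot>\<^bsub>\<C>\<^esub> aunit S (omap G X) = Idn \<C> (omap G X)"
    by (rule U_faithful) (simp_all add: Uh g_unit)
  then have "amap \<L> h = acounit S (\<S> X)"
    by - (rule stg.idempotent_retraction[OF idem], simp_all add: in_Hom_iff)
  then have "sproj S (omap G X) \<cdot>\<^bsub>A\<^esub> amap L (\<gamma> X) = \<epsilon> (\<S> X)"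
    using proj_nat[of h] by (simp add: Uh counit_proj)
  then show ?thesis
    using link_coequalizer[of "omap \<Gamma>\<^sub>N X"] base.left.target.coequalizer_of_equal_iso by simp
qed

lemma next_\<Gamma>_functor: "cat_functor B \<N> \<Gamma>\<^sub>N"
proof -
  interpret N: category \<N> by (rule category_next)
  show ?thesis
  proof unfold_locales
    fix f X Y assume "f \<in> Hom B X Y"
    then have f [simp]: "f \<in> Arr B" and XY: "X = Dom B f" "Y = Cod B f" by (auto simp: in_Hom_iff)
    have "f \<cdot>\<^bsub>B\<^esub> \<gamma> X = (f \<cdot>\<^bsub>B\<^esub> g X) \<cdot>\<^bsub>B\<^esub> \<zeta> (\<S> X)" by (simp add: XY)
    also have "\<dots> = g Y \<cdot>\<^bsub>B\<^esub> amap R' (amap F (amap \<L> (amap G f))) \<cdot>\<^bsub>B\<^esub> \<zeta> (\<S> X)"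
      by (simp add: XY flip: g_nat)
    also have "\<dots> = \<gamma> Y \<cdot>\<^bsub>B\<^esub> amap R (amap \<L> (amap G f))"
      using \<xi>_nat[of "amap \<L> (amap G f)"] by (simp add: XY)
    finally have "f \<cdot>\<^bsub>B\<^esub> \<gamma> X = \<gamma> Y \<cdot>\<^bsub>B\<^esub> amap R (amap \<L> (amap G f))" .
    then show "amap \<Gamma>\<^sub>N f \<in> Hom \<N> (omap \<Gamma>\<^sub>N X) (omap \<Gamma>\<^sub>N Y)"
      by (simp add: in_Hom_iff next_Arr_iff next_\<Gamma>_amap XY)
  qed (auto simp: in_Hom_iff next_\<Gamma>_amap)
qed

text \<open>
  Under \<open>F\<close>, the pair that defines the link takes the form \<open>(fe, f)\<close> with \<open>f = F(\<epsilon>(\<S> X))\<close> and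
  \<open>e = L'(\<U>\<eta> \<circ> \<gamma> X)\<close>. The arrow \<open>e\<close> is idempotent since \<open>\<gamma> X\<close> is a retraction of \<open>\<U>\<eta>\<close>, and \<open>f\<close> is
  a composition of regular epimorphisms since \<open>\<epsilon>(\<S> X)\<close> is the projection followed by the counit of
  the stage, which splits at \<open>\<L>(G X)\<close>.
\<close>

lemma R'F_link_coequalizer:
  assumes X [simp]: "X \<in> Obj B"
  shows "is_coequalizer B (amap R' (amap F (sproj S (omap G X))) \<cdot>\<^bsub>B\<^esub> amap R' (amap L' (\<gamma> X)))
    (amap R' (amap F (\<epsilon> (\<S> X)))) (amap R' (amap F (\<kappa> (omap \<Gamma>\<^sub>N X))))"
proof -
  let ?f = "amap F (\<epsilon> (\<S> X))"
  define u where "u = amap \<U> (aunit S (omap G X))"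
  have u [simp]: "u \<in> Arr B" "Dom B u = X" "Cod B u = omap R (\<S> X)" by (simp_all add: u_def)
  have gu: "g X \<cdot>\<^bsub>B\<^esub> \<zeta> (\<S> X) \<cdot>\<^bsub>B\<^esub> u = Idn B X" by (simp add: u_def g_unit)
  define e where "e = amap L' (u \<cdot>\<^bsub>B\<^esub> \<gamma> X)"
  have e [simp]: "e \<in> Arr A'" "Dom A' e = omap L' (omap R (\<S> X))" "Cod A' e = omap L' (omap R (\<S> X))"
    by (simp_all add: e_def)
  have "(u \<cdot>\<^bsub>B\<^esub> \<gamma> X) \<cdot>\<^bsub>B\<^esub> (u \<cdot>\<^bsub>B\<^esub> \<gamma> X) = u \<cdot>\<^bsub>B\<^esub> (g X \<cdot>\<^bsub>B\<^esub> \<zeta> (\<S> X) \<cdot>\<^bsub>B\<^esub> u) \<cdot>\<^bsub>B\<^esub> \<gamma> X" by simp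
  also have "\<dots> = u \<cdot>\<^bsub>B\<^esub> \<gamma> X" unfolding gu by simp
  finally have "e \<cdot>\<^bsub>A'\<^esub> e = e" unfolding e_def by (simp flip: prime.left.amap_Comp')
  then have idem: "idempotent_arr A' e" by (simp add: idempotent_arr_def)
  have reg: "comp_regular_epis A' ?f"
  proof -
    have "regular_epi A (acounit S (\<S> X))"
      using base.left.target.split_epi_regular[of "acounit S (\<S> X)" "amap \<L> (aunit S (omap G X))"]
      by (auto simp: regular_epi_def stg.triangle_left)
    then have "comp_regular_epis A (acounit S (\<S> X) \<cdot>\<^bsub>A\<^esub> sproj S (omap \<R> (\<S> X)))"
      by (intro comp_regular_epis.compose proj_comp_regular_epis) simp_all
    then show ?thesis by (intro F_comp_regular_epis) (simp add: counit_proj)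
  qed
  have "?f \<cdot>\<^bsub>A'\<^esub> amap L' u = amap F (sproj S (omap G X))"
    using arg_cong[OF proj_eq_transpose[of "omap G X"], of "amap F"] by (simp add: u_def)
  then have fe: "?f \<cdot>\<^bsub>A'\<^esub> e = amap F (sproj S (omap G X)) \<cdot>\<^bsub>A'\<^esub> amap L' (\<gamma> X)"
    by (simp add: e_def prime.left.target.chain del: prime.left.amap_Comp' add: prime.left.amap_Comp'[of "\<gamma> X" u])
  have "is_coequalizer A' (?f \<cdot>\<^bsub>A'\<^esub> e) ?f (amap F (\<kappa> (omap \<Gamma>\<^sub>N X)))"
    using F_is_coequalizer[OF link_coequalizer[of "omap \<Gamma>\<^sub>N X"]] by (simp add: fe)
  moreover have "preserves_coequalizer B R' A' (?f \<cdot>\<^bsub>A'\<^esub> e) ?f"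
    by (rule R'_coequalizer[OF reg idem]) simp
  ultimately have "is_coequalizer B (amap R' (?f \<cdot>\<^bsub>A'\<^esub> e)) (amap R' ?f) (amap R' (amap F (\<kappa> (omap \<Gamma>\<^sub>N X))))"
    unfolding preserves_coequalizer_def by blast
  then show ?thesis by (simp add: fe)
qed

text \<open>
  By \<open>g_proj\<close> and \<open>\<gamma>_criterion\<close>, the arrow \<open>g X\<close> coequalizes the pair of \<open>R'F_link_coequalizer\<close>.
  Naturality and uniqueness of the factorization follow by cancelling \<open>R'F\<kappa>\<close>.
\<close>

lemma next_\<gamma>':
  "nat_trans B B (R' \<circ>\<^sub>F F \<circ>\<^sub>F \<L>\<^sub>N \<circ>\<^sub>F \<Gamma>\<^sub>N) fid \<gamma>'\<^sub>N"
  "\<And>X. X \<in> Obj B \<Longrightarrow> \<gamma>'\<^sub>N X \<cdot>\<^bsub>B\<^esub> amap R' (amap F (\<kappa> (omap \<Gamma>\<^sub>N X))) = g X"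
proof -
  interpret LN: cat_functor \<N> A \<L>\<^sub>N by (rule next_L_functor)
  interpret GN: cat_functor B \<N> \<Gamma>\<^sub>N by (rule next_\<Gamma>_functor)
  let ?K = "\<lambda>X. amap R' (amap F (\<kappa> (omap \<Gamma>\<^sub>N X)))"
  let ?S = "\<lambda>X. omap R' (omap F (omap \<L>\<^sub>N (omap \<Gamma>\<^sub>N X)))"
  let ?a = "\<lambda>f. amap R' (amap F (amap \<L>\<^sub>N (amap \<Gamma>\<^sub>N f)))"
  have epi: "epi_arr B (?K X)" if "X \<in> Obj B" for X
    using base.left.source.coequalizer_epi R'F_link_coequalizer that by blast
  have "\<exists>k. k \<in> Arr B \<and> Dom B k = ?S X \<and> Cod B k = X \<and> k \<cdot>\<^bsub>B\<^esub> ?K X = g X"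
    if X [simp]: "X \<in> Obj B" for X
  proof -
    have "g X \<cdot>\<^bsub>B\<^esub> amap R' (amap F (sproj S (omap G X))) \<cdot>\<^bsub>B\<^esub> amap R' (amap L' (\<gamma> X))
        = \<gamma>' X \<cdot>\<^bsub>B\<^esub> amap R' (amap L' (\<gamma> X))"
      by (simp add: base.left.source.chain[OF g_proj])
    also note \<gamma>_criterion[OF X]
    finally obtain k where "k \<in> Arr B" "Dom B k = Cod B (?K X)" "Cod B k = Cod B (g X)" "k \<cdot>\<^bsub>B\<^esub> ?K X = g X"
      by (rule coequalizer_factor[OF R'F_link_coequalizer[OF X], rotated 2]) simp_all
    then show ?thesis by (intro exI[of _ k]) simp
  qed
  then obtain k where "\<And>X. X \<in> Obj B \<Longrightarrow> k X \<in> Arr B \<and> Dom B (k X) = ?S X \<and> Cod B (k X) = X \<and>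
      k X \<cdot>\<^bsub>B\<^esub> ?K X = g X"
    by metis
  then have k [simp]: "k X \<in> Arr B" "Dom B (k X) = ?S X" "Cod B (k X) = X"
    and kK: "k X \<cdot>\<^bsub>B\<^esub> ?K X = g X" if "X \<in> Obj B" for X
    using that by blast+
  define t where "t = restrict k (Obj B)"
  have t [simp]: "t X = k X" if "X \<in> Obj B" for X using that by (simp add: t_def)
  let ?P = "\<lambda>t. t \<in> extensional (Obj B) \<and> nat_trans B B (R' \<circ>\<^sub>F F \<circ>\<^sub>F \<L>\<^sub>N \<circ>\<^sub>F \<Gamma>\<^sub>N) fid t \<and>
    (\<forall>X\<in>Obj B. t X \<cdot>\<^bsub>B\<^esub> ?K X = g X)"
  have nat: "nat_trans B B (R' \<circ>\<^sub>F F \<circ>\<^sub>F \<L>\<^sub>N \<circ>\<^sub>F \<Gamma>\<^sub>N) fid t"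
  proof (rule nat_transI)
    fix f assume f [simp]: "f \<in> Arr B"
    let ?X = "Dom B f" and ?Y = "Cod B f"
    have ka: "?a f \<cdot>\<^bsub>B\<^esub> ?K ?X = ?K ?Y \<cdot>\<^bsub>B\<^esub> amap R' (amap F (amap \<L> (amap G f)))"
    proof -
      have "amap \<L>\<^sub>N (amap \<Gamma>\<^sub>N f) \<cdot>\<^bsub>A\<^esub> \<kappa> (omap \<Gamma>\<^sub>N ?X) = \<kappa> (omap \<Gamma>\<^sub>N ?Y) \<cdot>\<^bsub>A\<^esub> amap \<L> (amap G f)"
        using next_L_amap(4)[OF GN.amap_simps(1)[OF f]] by (simp add: next_\<Gamma>_amap)
      from arg_cong[OF this, of "\<lambda>x. amap R' (amap F x)"] show ?thesis by simp
    qed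
    have "(k ?Y \<cdot>\<^bsub>B\<^esub> ?a f) \<cdot>\<^bsub>B\<^esub> ?K ?X = k ?Y \<cdot>\<^bsub>B\<^esub> ?K ?Y \<cdot>\<^bsub>B\<^esub> amap R' (amap F (amap \<L> (amap G f)))"
      by (simp add: ka)
    also have "\<dots> = f \<cdot>\<^bsub>B\<^esub> g ?X" by (simp add: base.left.source.chain[OF kK] g_nat)
    also have "\<dots> = (f \<cdot>\<^bsub>B\<^esub> k ?X) \<cdot>\<^bsub>B\<^esub> ?K ?X" by (simp add: kK)
    finally have "k ?Y \<cdot>\<^bsub>B\<^esub> ?a f = f \<cdot>\<^bsub>B\<^esub> k ?X"
      by (rule epi_cancel[OF _ epi]) simp_all
    then show "t ?Y \<cdot>\<^bsub>B\<^esub> amap (R' \<circ>\<^sub>F F \<circ>\<^sub>F \<L>\<^sub>N \<circ>\<^sub>F \<Gamma>\<^sub>N) f = amap fid f \<cdot>\<^bsub>B\<^esub> t ?X" by simp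
  qed (auto simp: in_Hom_iff intro: cat_functor_fcomp cat_functor_fid base.left.source.category_axioms
      prime.right.cat_functor_axioms F.cat_functor_axioms LN.cat_functor_axioms GN.cat_functor_axioms)
  have "\<exists>!t. ?P t"
  proof (rule ex1I[of _ t])
    show "?P t" using nat kK by (simp add: t_def)
    fix s assume s: "?P s"
    interpret s: nat_trans B B "R' \<circ>\<^sub>F F \<circ>\<^sub>F \<L>\<^sub>N \<circ>\<^sub>F \<Gamma>\<^sub>N" fid s using s by blast
    show "s = t"
    proof (rule extensionalityI[of _ "Obj B"])
      fix X assume X [simp]: "X \<in> Obj B"
      have "s X \<cdot>\<^bsub>B\<^esub> ?K X = t X \<cdot>\<^bsub>B\<^esub> ?K X" using s kK by simp
      then show "s X = t X" by (rule epi_cancel[OF _ epi]) simp_all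
    qed (use s in \<open>simp_all add: t_def\<close>)
  qed
  from theI'[OF this] have "?P \<gamma>'\<^sub>N" unfolding next_\<gamma>'_def .
  then show "nat_trans B B (R' \<circ>\<^sub>F F \<circ>\<^sub>F \<L>\<^sub>N \<circ>\<^sub>F \<Gamma>\<^sub>N) fid \<gamma>'\<^sub>N"
    "\<And>X. X \<in> Obj B \<Longrightarrow> \<gamma>'\<^sub>N X \<cdot>\<^bsub>B\<^esub> ?K X = g X" by blast+
qed

text \<open>
  Only the lifting needs an idea. The lift \<open>h\<close> at the present stage is an arrow of the next one if
  \<open>g X \<circ> R'F\<L> h = a \<circ> R'F(acounit S Y)\<close>, and precomposition with the epimorphism \<open>R'F\<pi>\<close> turns this
  equation into the criterion itself.
\<close>

lemma next_rank_stage: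
  "rank_stage A A' B L R \<eta> \<epsilon> L' R' \<eta>' \<epsilon>' F q \<gamma>' \<S>\<^sub>N \<Gamma>\<^sub>N \<gamma>'\<^sub>N"
proof -
  interpret N: decomposition_stage A B L R \<eta> \<epsilon> q \<S>\<^sub>N by (rule next_decomposition_stage)
  have sel [simp]: "acat \<S>\<^sub>N = \<N>" "aL \<S>\<^sub>N = \<L>\<^sub>N" "aR \<S>\<^sub>N = \<R>\<^sub>N" "omap (sU \<S>\<^sub>N) X = omap \<U> (under X)"
      "amap (sU \<S>\<^sub>N) f = amap \<U> (under_arr f)"
      "sproj \<S>\<^sub>N X = \<kappa> X \<cdot>\<^bsub>A\<^esub> sproj S (under X)" for X f
    by (simp_all add: next_stage_def forget_def)
  interpret GN: cat_functor B \<N> \<Gamma>\<^sub>N by (rule next_\<Gamma>_functor)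
  interpret RN: cat_functor A \<N> \<R>\<^sub>N by (rule next_R_functor)
  interpret gN: nat_trans B B "R' \<circ>\<^sub>F F \<circ>\<^sub>F \<L>\<^sub>N \<circ>\<^sub>F \<Gamma>\<^sub>N" fid \<gamma>'\<^sub>N by (rule next_\<gamma>')
  let ?K = "\<lambda>X. amap R' (amap F (\<kappa> (omap \<Gamma>\<^sub>N X)))"
  have gK: "\<gamma>'\<^sub>N X \<cdot>\<^bsub>B\<^esub> ?K X = g X" if "X \<in> Obj B" for X using that by (rule next_\<gamma>')
  note gN_simps [simp] = gN.component_simps[simplified]
  have "rank_stage_axioms A B R \<epsilon> L' R' \<eta>' F \<gamma>' \<S>\<^sub>N \<Gamma>\<^sub>N \<gamma>'\<^sub>N"
  proof
    fix f assume f [simp]: "f \<in> Arr B"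
    show "amap (sU \<S>\<^sub>N) (amap \<Gamma>\<^sub>N f) = f" by (simp add: next_\<Gamma>_amap)
    show "\<gamma>'\<^sub>N (Cod B f) \<cdot>\<^bsub>B\<^esub> amap R' (amap F (amap (aL \<S>\<^sub>N) (amap \<Gamma>\<^sub>N f))) = f \<cdot>\<^bsub>B\<^esub> \<gamma>'\<^sub>N (Dom B f)"
      using gN.nat[OF f refl] by simp
  next
    fix X assume X [simp]: "X \<in> Obj B"
    show "\<gamma>'\<^sub>N X \<cdot>\<^bsub>B\<^esub> amap R' (amap F (sproj \<S>\<^sub>N (omap \<Gamma>\<^sub>N X))) = \<gamma>' X"
      by (simp add: base.left.source.chain[OF gK] g_proj)
    let ?u = "amap \<U> (aunit S (omap G X))" and ?k = "\<kappa> (omap \<Gamma>\<^sub>N X)"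
    have "\<gamma>'\<^sub>N X \<cdot>\<^bsub>B\<^esub> \<zeta> (omap \<L>\<^sub>N (omap \<Gamma>\<^sub>N X)) \<cdot>\<^bsub>B\<^esub> amap \<U> (under_arr (aunit \<S>\<^sub>N (omap \<Gamma>\<^sub>N X)))
        = \<gamma>'\<^sub>N X \<cdot>\<^bsub>B\<^esub> (\<zeta> (omap \<L>\<^sub>N (omap \<Gamma>\<^sub>N X)) \<cdot>\<^bsub>B\<^esub> amap R ?k) \<cdot>\<^bsub>B\<^esub> ?u"
      by (simp add: next_unit)
    also have "\<dots> = \<gamma>'\<^sub>N X \<cdot>\<^bsub>B\<^esub> ?K X \<cdot>\<^bsub>B\<^esub> \<zeta> (\<S> X) \<cdot>\<^bsub>B\<^esub> ?u"
      using \<xi>_nat[of ?k] by simp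
    also have "\<dots> = Idn B X" by (simp add: base.left.source.chain[OF gK] g_unit)
    finally show "\<gamma>'\<^sub>N X \<cdot>\<^bsub>B\<^esub> \<zeta> (omap (aL \<S>\<^sub>N) (omap \<Gamma>\<^sub>N X))
      \<cdot>\<^bsub>B\<^esub> amap (sU \<S>\<^sub>N) (aunit \<S>\<^sub>N (omap \<Gamma>\<^sub>N X)) = Idn B X" by simp
    fix Y a assume Y [simp]: "Y \<in> Obj A" and a: "a \<in> Hom B (omap R' (omap F Y)) X"
      and crit: "\<gamma>' X \<cdot>\<^bsub>B\<^esub> amap R' (amap L' (a \<cdot>\<^bsub>B\<^esub> \<zeta> Y)) = a \<cdot>\<^bsub>B\<^esub> amap R' (amap F (\<epsilon> Y))"
    have a' [simp]: "a \<in> Arr B" "Dom B a = omap R' (omap F Y)" "Cod B a = X" using a by (auto simp: in_Hom_iff)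
    obtain h where h [simp]: "h \<in> Arr \<C>" "Dom \<C> h = omap \<R> Y" "Cod \<C> h = omap G X"
      and Uh: "amap \<U> h = a \<cdot>\<^bsub>B\<^esub> \<zeta> Y"
      using lifting[OF X Y a crit] by (auto simp: in_Hom_iff)
    let ?Z = "omap \<L> (omap \<R> Y)" and ?P = "amap R' (amap F (sproj S (omap \<R> Y)))"
    have reg: "comp_regular_epis B ?P"
      by (intro R'_comp_regular_epis F_comp_regular_epis proj_comp_regular_epis) simp
    have "(g X \<cdot>\<^bsub>B\<^esub> amap R' (amap F (amap \<L> h))) \<cdot>\<^bsub>B\<^esub> ?P =
        g X \<cdot>\<^bsub>B\<^esub> amap R' (amap F (amap \<L> h \<cdot>\<^bsub>A\<^esub> sproj S (omap \<R> Y)))" by simp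
    also have "amap \<L> h \<cdot>\<^bsub>A\<^esub> sproj S (omap \<R> Y) = sproj S (omap G X) \<cdot>\<^bsub>A\<^esub> amap L (a \<cdot>\<^bsub>B\<^esub> \<zeta> Y)"
      using proj_nat[of h] by (simp add: Uh)
    also have "g X \<cdot>\<^bsub>B\<^esub> amap R' (amap F (sproj S (omap G X) \<cdot>\<^bsub>A\<^esub> amap L (a \<cdot>\<^bsub>B\<^esub> \<zeta> Y)))
        = (g X \<cdot>\<^bsub>B\<^esub> amap R' (amap F (sproj S (omap G X)))) \<cdot>\<^bsub>B\<^esub> amap R' (amap L' (a \<cdot>\<^bsub>B\<^esub> \<zeta> Y))" by simp
    also have "\<dots> = a \<cdot>\<^bsub>B\<^esub> amap R' (amap F (acounit S Y \<cdot>\<^bsub>A\<^esub> sproj S (omap \<R> Y)))"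
      unfolding g_proj[OF X] crit by (simp add: counit_proj)
    also have "\<dots> = (a \<cdot>\<^bsub>B\<^esub> amap R' (amap F (acounit S Y))) \<cdot>\<^bsub>B\<^esub> ?P" by simp
    finally have eq: "g X \<cdot>\<^bsub>B\<^esub> amap R' (amap F (amap \<L> h)) = a \<cdot>\<^bsub>B\<^esub> amap R' (amap F (acounit S Y))"
      by (rule epi_cancel[OF _ base.left.source.comp_regular_epis_epi[OF reg]]) simp_all
    have "amap \<U> h \<cdot>\<^bsub>B\<^esub> amap R (acounit S Y) = (a \<cdot>\<^bsub>B\<^esub> amap R' (amap F (acounit S Y))) \<cdot>\<^bsub>B\<^esub> \<zeta> ?Z"
      using \<xi>_nat[of "acounit S Y"] by (simp add: Uh)
    also have "\<dots> = \<gamma> X \<cdot>\<^bsub>B\<^esub> amap R (amap \<L> h)"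
      using \<xi>_nat[of "amap \<L> h"] by (simp flip: eq)
    finally have "Over_arr (omap \<R>\<^sub>N Y) h (omap \<Gamma>\<^sub>N X) \<in> Arr \<N>"
      using RN.omap_Obj[OF Y] by (simp add: next_Arr_iff)
    then show "\<exists>h\<in>Hom (acat \<S>\<^sub>N) (omap (aR \<S>\<^sub>N) Y) (omap \<Gamma>\<^sub>N X). amap (sU \<S>\<^sub>N) h = a \<cdot>\<^bsub>B\<^esub> \<zeta> Y"
      by (intro bexI[of _ "Over_arr (omap \<R>\<^sub>N Y) h (omap \<Gamma>\<^sub>N X)"]) (simp_all add: in_Hom_iff Uh)
  qed simp_all
  then show ?thesis
    using augmented_setting_axioms next_decomposition_stage next_\<Gamma>_functor
    by (simp add: rank_stage_def)
qed

end

section \<open>Bounding the combinatorial rank\<close>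

lemma augmented_retract_refl:
  assumes "nat_trans A A G fid \<epsilon>"
  shows "augmented_retract A G \<epsilon> G \<epsilon>"
proof -
  interpret nat_trans A A G fid \<epsilon> by fact
  have "nat_trans A A G G (\<lambda>Y. Idn A (omap G Y))"
    by (rule nat_transI) (simp_all add: in_Hom_iff F.cat_functor_axioms)
  then have "augmented_map A G \<epsilon> G \<epsilon> (\<lambda>Y. Idn A (omap G Y))"
    using assms by (simp add: augmented_map_def)
  then show ?thesis unfolding augmented_retract_def
    by (intro exI[of _ "\<lambda>Y. Idn A (omap G Y)"]) simp
qed

lemma monadic_tower_adjunction:
  assumes "adjunction A B L R \<eta> \<epsilon>" "coequalizer_choice A q" and T: "monadic_tower A B L R \<eta> \<epsilon> T"
  shows "adjunction A (acat (T n)) (aL (T n)) (aR (T n)) (aunit (T n)) (acounit (T n))"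
proof (cases n)
  case 0
  have "T 0 = lift_adj B L R \<eta> \<epsilon>" using T by (simp add: monadic_tower_def)
  then show ?thesis using decomposition_stage_0[OF assms(1,2)] 0
    by (simp add: decomposition_stage_def adj.extend_def)
next
  case (Suc m)
  then show ?thesis using T unfolding monadic_tower_def by blast
qed

lemma tower_comonads_retract:
  assumes adj: "adjunction A B L R \<eta> \<epsilon>" and q: "coequalizer_choice A q"
    and T: "monadic_tower A B L R \<eta> \<epsilon> T"
  defines "D \<equiv> decomposition A B L R \<eta> \<epsilon> q"
  shows "augmented_retract A (aL (T n) \<circ>\<^sub>F aR (T n)) (acounit (T n)) (aL (D n) \<circ>\<^sub>F aR (D n)) (acounit (D n))"
proof (induction n)
  case 0
  interpret adjunction A "acat (T 0)" "aL (T 0)" "aR (T 0)" "aunit (T 0)" "acounit (T 0)"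
    by (rule monadic_tower_adjunction[OF adj q T])
  have "T 0 = lift_adj B L R \<eta> \<epsilon>" using T by (simp add: monadic_tower_def)
  then have "aL (D 0) = aL (T 0)" "aR (D 0) = aR (T 0)" "acounit (D 0) = acounit (T 0)"
    by (simp_all add: D_def adj.extend_def)
  then show ?case using augmented_retract_refl[OF counit.nat_trans_axioms] by simp
next
  case (Suc n)
  interpret D: decomposition_stage A B L R \<eta> \<epsilon> q "D n"
    unfolding D_def by (rule decomposition_stage_n[OF adj q])
  have "D (Suc n) = next_stage A B L R \<epsilon> q (D n)" by (simp add: D_def)
  then have d: "derived_from A (aL (D n) \<circ>\<^sub>F aR (D n)) (acounit (D n))
      (aL (D (Suc n)) \<circ>\<^sub>F aR (D (Suc n))) (acounit (D (Suc n)))"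
    using D.next_comonad_derived by simp
  have t: "derived_from A (aL (T n) \<circ>\<^sub>F aR (T n)) (acounit (T n))
      (aL (T (Suc n)) \<circ>\<^sub>F aR (T (Suc n))) (acounit (T (Suc n)))"
    using T by (intro tower_comonad_derived monadic_tower_adjunction[OF adj q T])
      (simp_all add: monadic_tower_def)
  show ?case by (rule augmented_retract_derived[OF Suc t d])
qed

context augmented_setting
begin

abbreviation "\<D> \<equiv> decomposition A B L R \<eta> \<epsilon> q"
abbreviation "\<Gamma>\<^sub>n \<equiv> \<Gamma>\<gamma>' A B L R \<eta> \<epsilon> q R' \<eta>' F \<gamma>'"

lemma rank_stage_0: "rank_stage A A' B L R \<eta> \<epsilon> L' R' \<eta>' \<epsilon>' F q \<gamma>' (\<D> 0) lift \<gamma>'"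
proof -
  define S where "S = \<D> 0"
  interpret l: category "lift_cat B" by (rule lift_category) (rule base.left.source.category_axioms)
  have S: "decomposition_stage A B L R \<eta> \<epsilon> q S"
    unfolding S_def by (rule decomposition_stage_0) (use base.adjunction_axioms choice in auto)
  have sel [simp]: "acat S = lift_cat B" "omap (aL S) X = omap L (the_obj X)"
    "amap (aL S) f = amap L (the_arr f)" "omap (aR S) Y = Base_obj (omap R Y)"
    "aunit S X = Base_arr (\<eta> (the_obj X))" "omap (sU S) X = the_obj X" "amap (sU S) f = the_arr f"
    "sproj S X = Idn A (omap L (the_obj X))" "omap lift Z = Base_obj Z" "amap lift k = Base_arr k"
    for X f Y Z k
    by (simp_all add: S_def adj.extend_def lift_adj_def lift_def unlift_def)
  have cat: "Obj (lift_cat B) = Base_obj ` Obj B" "Arr (lift_cat B) = Base_arr ` Arr B"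
    "Dom (lift_cat B) f = Base_obj (Dom B (the_arr f))"
    "Cod (lift_cat B) f = Base_obj (Cod B (the_arr f))"
    "Idn (lift_cat B) X = Base_arr (Idn B (the_obj X))"
    "g \<cdot>\<^bsub>lift_cat B\<^esub> f = Base_arr (the_arr g \<cdot>\<^bsub>B\<^esub> the_arr f)" for f g X
    by (simp_all add: lift_cat_def)
  have lift: "cat_functor B (acat S) lift" by unfold_locales (auto simp: cat in_Hom_iff)
  have unit: "\<gamma>' X \<cdot>\<^bsub>B\<^esub> \<zeta> (omap L X) \<cdot>\<^bsub>B\<^esub> \<eta> X = Idn B X" if X [simp]: "X \<in> Obj B" for X
  proof -
    have "amap R' (amap F (\<epsilon> (omap L X))) \<cdot>\<^bsub>B\<^esub> amap R' (amap L' (\<eta> X)) = Idn B (omap R' (omap L' X))"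
      using arg_cong[OF base.triangle_left[OF X], of "\<lambda>x. amap R' (amap F x)"] by simp
    then have "\<zeta> (omap L X) \<cdot>\<^bsub>B\<^esub> \<eta> X = \<eta>' X"
      by (simp add: \<xi>_def prime.unit_nat base.left.source.chain)
    then show ?thesis by simp
  qed
  have "rank_stage_axioms A B R \<epsilon> L' R' \<eta>' F \<gamma>' S lift \<gamma>'"
  proof
    fix f assume f: "f \<in> Arr B"
    show "\<gamma>' (Cod B f) \<cdot>\<^bsub>B\<^esub> amap R' (amap F (amap (aL S) (amap lift f))) = f \<cdot>\<^bsub>B\<^esub> \<gamma>' (Dom B f)"
      using aug.nat[OF f refl] f by simp
  next
    fix X Y a assume "X \<in> Obj B" "Y \<in> Obj A" "a \<in> Hom B (omap R' (omap F Y)) X"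
    then show "\<exists>h\<in>Hom (acat S) (omap (aR S) Y) (omap lift X). amap (sU S) h = a \<cdot>\<^bsub>B\<^esub> \<zeta> Y"
      by (intro bexI[of _ "Base_arr (a \<cdot>\<^bsub>B\<^esub> \<zeta> Y)"]) (auto simp: in_Hom_iff cat)
  qed (simp_all add: unit)
  then have "rank_stage A A' B L R \<eta> \<epsilon> L' R' \<eta>' \<epsilon>' F q \<gamma>' S lift \<gamma>'"
    using augmented_setting_axioms S lift by (simp add: rank_stage_def)
  then show ?thesis by (simp only: S_def)
qed

lemma \<Gamma>_Suc:
  "\<Gamma>\<^sub>n (Suc n) = (next_\<Gamma> B R \<epsilon> R' \<eta>' F (\<D> n) (fst (\<Gamma>\<^sub>n n)) (snd (\<Gamma>\<^sub>n n)),
    next_\<gamma>' A B L R \<epsilon> q R' \<eta>' F (\<D> n) (fst (\<Gamma>\<^sub>n n)) (snd (\<Gamma>\<^sub>n n)))"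
  by (simp add: Let_def case_prod_beta)

lemma rank_stage_n:
  "rank_stage A A' B L R \<eta> \<epsilon> L' R' \<eta>' \<epsilon>' F q \<gamma>' (\<D> n) (fst (\<Gamma>\<^sub>n n)) (snd (\<Gamma>\<^sub>n n))"
proof (induction n)
  case 0
  show ?case using rank_stage_0 by (simp only: \<Gamma>\<gamma>'.simps(1) fst_conv snd_conv)
next
  case (Suc n)
  then show ?case unfolding \<Gamma>_Suc fst_conv snd_conv decomposition.simps(2)
    by (rule rank_stage.next_rank_stage)
qed

lemma combinatorial_rank_le:
  assumes T: "monadic_tower A B L R \<eta> \<epsilon> T" and idem: "idempotent_adj A (T N)" and X: "X \<in> Obj B"
  shows "\<exists>n\<le>N. has_combinatorial_rank A B L R \<eta> \<epsilon> q R' \<eta>' F \<gamma>' X n"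
proof -
  interpret T: adjunction A "acat (T N)" "aL (T N)" "aR (T N)" "aunit (T N)" "acounit (T N)"
    by (rule monadic_tower_adjunction[OF base.adjunction_axioms choice T])
  interpret rank_stage A A' B L R \<eta> \<epsilon> L' R' \<eta>' \<epsilon>' F q \<gamma>' "\<D> N" "fst (\<Gamma>\<^sub>n N)" "snd (\<Gamma>\<^sub>n N)"
    by (rule rank_stage_n)
  have "amap \<L> (amap \<R> (acounit (\<D> N) Y)) = acounit (\<D> N) (omap \<L> (omap \<R> Y))" if "Y \<in> Obj A" for Y
    using augmented_retract_idempotent[OF tower_comonads_retract[OF base.adjunction_axioms choice T]]
      T.idempotent_comonad idem that by (simp add: idempotent_adj_def)
  then have "iso_arr A (\<kappa> (omap \<Gamma>\<^sub>N X))" using X by (rule link_iso_if_idempotent)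
  then have iso: "iso_arr A (rank_arrow A B L R \<eta> \<epsilon> q R' \<eta>' F \<gamma>' N X)"
    unfolding rank_arrow_def \<Gamma>_def \<Gamma>_Suc by simp
  define P where "P n = iso_arr A (rank_arrow A B L R \<eta> \<epsilon> q R' \<eta>' F \<gamma>' n X)" for n
  have "P (LEAST n. P n)" "(LEAST n. P n) \<le> N" "\<And>m. m < (LEAST n. P n) \<Longrightarrow> \<not> P m"
    using iso by (auto simp: P_def intro: LeastI Least_le dest: not_less_Least)
  then show ?thesis unfolding has_combinatorial_rank_def P_def by blast
qed

end

lemma fully_faithful_imp_idempotent_adj:
  assumes "adjunction A (acat T) (aL T) (aR T) (aunit T) (acounit T)" "fully_faithful (acat T) A (aL T)"
  shows "idempotent_adj A T"
proof -
  interpret adjunction A "acat T" "aL T" "aR T" "aunit T" "acounit T" by fact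
  show ?thesis using fully_faithful_unit_iso[OF assms(2)] by (simp add: idempotent_adj_def)
qed

theorem theorem7p5:
  fixes A :: "('a, 'k) cat" and A' :: "('c, 'l) cat" and B :: "('o, 'm) cat"
    and L :: "('o, 'm, 'a, 'k) func" and R :: "('a, 'k, 'o, 'm) func"
    and \<eta> :: "'o \<Rightarrow> 'm" and \<epsilon> :: "'a \<Rightarrow> 'k"
    and L' :: "('o, 'm, 'c, 'l) func" and R' :: "('c, 'l, 'o, 'm) func"
    and \<eta>' :: "'o \<Rightarrow> 'm" and \<epsilon>' :: "'c \<Rightarrow> 'l"
    and F :: "('a, 'k, 'c, 'l) func"
    and q :: "'k \<Rightarrow> 'k \<Rightarrow> 'k" and \<gamma>' :: "'o \<Rightarrow> 'm"
    and T :: "nat \<Rightarrow> ('o, 'm, 'a, 'k) adj" and N :: nat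
  assumes "adjunction A B L R \<eta> \<epsilon>"
    and "adjunction A' B L' R' \<eta>' \<epsilon>'"
    and "cat_functor A A' F"
    and "functor_eq B (F \<circ>\<^sub>F L) L'"
    and "has_coequalizers A" and "coequalizer_choice A q"
    and "\<And>f g. parallel A f g \<Longrightarrow> preserves_coequalizer A' F A f g"
    and "\<And>f e. \<lbrakk>comp_regular_epis A' f; idempotent_arr A' e; Cod A' e = Dom A' f\<rbrakk>
           \<Longrightarrow> preserves_coequalizer B R' A' (f \<cdot>\<^bsub>A'\<^esub> e) f"
    and "\<And>p. regular_epi A' p \<Longrightarrow> regular_epi B (amap R' p)"
    and "augmentation B (R' \<circ>\<^sub>F L') (\<lambda>X. amap R' (\<epsilon>' (omap L' X))) \<eta>' \<gamma>'"
    and "monadic_tower A B L R \<eta> \<epsilon> T"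
  shows "(idempotent_adj A (T N) \<longrightarrow>
           (\<forall>X\<in>Obj B. \<exists>n\<le>N. has_combinatorial_rank A B L R \<eta> \<epsilon> q R' \<eta>' F \<gamma>' X n)) \<and>
         (monadic_length A T N \<longrightarrow>
           (\<forall>X\<in>Obj B. \<exists>n\<le>N. has_combinatorial_rank A B L R \<eta> \<epsilon> q R' \<eta>' F \<gamma>' X n))"
proof -
  interpret augmented_setting A A' B L R \<eta> \<epsilon> L' R' \<eta>' \<epsilon>' F q \<gamma>'
    using assms unfolding augmented_setting_def augmented_setting_axioms_def by blast
  have "idempotent_adj A (T N) \<Longrightarrow>
      \<forall>X\<in>Obj B. \<exists>n\<le>N. has_combinatorial_rank A B L R \<eta> \<epsilon> q R' \<eta>' F \<gamma>' X n"
    using combinatorial_rank_le[OF assms(11)] by blast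
  moreover have "idempotent_adj A (T N)" if "monadic_length A T N"
    using that monadic_tower_adjunction[OF assms(1,6,11)]
    by (intro fully_faithful_imp_idempotent_adj) (auto simp: monadic_length_def)
  ultimately show ?thesis by blast
qed

end
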